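(* Consider the inclusion of presheaves of rings $W_{\mathrm{rat}}(\mathcal{O}(\_))\subset W_J(\mathcal{O}(\_))$ on the category of Noetherian affine schemes. Both presheaves satisfy the sheaf condition for fpqc-coverings. They agree on integral Noetherian affine schemes, but differ already for $X=\operatorname{Spec}\mathbb{F}_2[\varepsilon]$ where $\varepsilon^2=0$.
   Context: All rings are commutative and unital. For a ring $A$, $W(A)=1+TA[[T]]$ is the big Witt ring: addition is multiplication of power series (zero element $1$), multiplication is the unique functorial, $T$-adically continuous one with $(1-aT)\cdot(1-bT)=1-abT$, unit $1-T$. $W_{\mathrm{rat}}(A)\subset W(A)$ is the subring of elements $P/Q$ with $P,Q\in A[T]$, $P(0)=1=Q(0)$. For $f=1+a_1T+a_2T^2+\cdots\in W(A)$ put $a_0=1$ and $H(f)=(a_{i+j})_{i,j\ge0}$ (Hankel matrix). $W_J(A)\subset W(A)$ is the set of $f$ for which there is some $n\ge1$ such that all $(n+1)\times(n+1)$-minors of $H(f)$ vanish; it is a subring of $W(A)$ containing $W_{\mathrm{rat}}(A)$. The sheaf condition for a presheaf $Y\mapsto F(\mathcal{O}(Y))$, where $F$ is a functor on rings, means: for every fpqc-covering $\{\operatorname{Spec}A_i\to\operatorname{Spec}A\}_i$ with $A$ and all $A_i$ Noetherian, the sequence $F(A)\to\prod_iF(A_i)\rightrightarrows\prod_{i,j}F(A_i\otimes_AA_j)$ is exact, i.e. $F(A)$ is the equalizer (the functors $W_{\mathrm{rat}}$, $W_J$ being evaluated on the possibly non-Noetherian rings $A_i\otimes_AA_j$). 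*)

theory Defs
  imports
    "HOL-Analysis.Abstract_Topology"
    "HOL-Combinatorics.Permutations"
    "HOL-Number_Theory.Residues"
    "HOL-Algebra.Algebra"
begin

section \<open>The big Witt ring\<close>

text \<open>A power series over \<open>R\<close> is its coefficient sequence, as in the library's \<open>UP R\<close>.\<close>

definition series_ring :: "('a, 'm) ring_scheme \<Rightarrow> (nat \<Rightarrow> 'a) ring" where
  "series_ring R = \<lparr>
     carrier = UNIV \<rightarrow> carrier R,
     monoid.mult = (\<lambda>f g n. \<Oplus>\<^bsub>R\<^esub>k\<in>{..n}. f k \<otimes>\<^bsub>R\<^esub> g (n - k)),
     one = (\<lambda>n. if n = 0 then \<one>\<^bsub>R\<^esub> else \<zero>\<^bsub>R\<^esub>),
     ring.zero = (\<lambda>n. \<zero>\<^bsub>R\<^esub>),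
     add = (\<lambda>f g n. f n \<oplus>\<^bsub>R\<^esub> g n)\<rparr>"

text \<open>The series \<open>1 - a T\<^sup>m\<close>, for \<open>m \<ge> 1\<close>.\<close>

definition one_minus_monom :: "('a, 'm) ring_scheme \<Rightarrow> 'a \<Rightarrow> nat \<Rightarrow> nat \<Rightarrow> 'a" where
  "one_minus_monom R a m =
     (\<lambda>n. if n = 0 then \<one>\<^bsub>R\<^esub> else if n = m then \<ominus>\<^bsub>R\<^esub> a else \<zero>\<^bsub>R\<^esub>)"

definition witt_set :: "('a, 'm) ring_scheme \<Rightarrow> (nat \<Rightarrow> 'a) set" where
  "witt_set R = {f \<in> carrier (series_ring R). f 0 = \<one>\<^bsub>R\<^esub>}"

text \<open>
  Every \<open>f \<in> 1 + T R[[T]]\<close> is uniquely an infinite product of factors \<open>1 - a\<^sub>k T\<^sup>k\<close> with \<open>k \<ge> 1\<close>.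
  Its coefficient at \<open>T\<^sup>n\<close> only involves the factors with \<open>k \<le> n\<close>.  The value at index 0 is a dummy.
\<close>

definition witt_factors :: "('a, 'm) ring_scheme \<Rightarrow> (nat \<Rightarrow> 'a) \<Rightarrow> nat \<Rightarrow> 'a" where
  "witt_factors R f = (THE a. a \<in> UNIV \<rightarrow> carrier R \<and> a 0 = \<zero>\<^bsub>R\<^esub> \<and>
     (\<forall>n. f n = finprod (series_ring R) (\<lambda>k. one_minus_monom R (a k) k) {1..n} n))"

text \<open>
  The functorial, \<open>T\<close>-adically continuous multiplication that distributes over the product of
  power series and satisfies \<open>(1 - a T) * (1 - b T) = 1 - a b T\<close> is given on factors by
  \<open>(1 - a T\<^sup>i) * (1 - b T\<^sup>j) = (1 - a^(l/i) b^(l/j) T^l)^d\<close> with \<open>l = lcm i j\<close> and \<open>d = gcd i j\<close>: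
  write \<open>a = \<alpha>\<^sup>i\<close>, \<open>b = \<beta>\<^sup>j\<close>, so that \<open>1 - a T\<^sup>i\<close> is the product of the \<open>1 - \<zeta> \<alpha> T\<close> over the
  \<open>i\<close>-th roots of unity \<open>\<zeta>\<close>, and likewise for \<open>b\<close>.  As \<open>l \<ge> max i j\<close>, only the factors with
  \<open>i, j \<le> n\<close> contribute to the coefficient at \<open>T\<^sup>n\<close>.
\<close>

definition witt_mult ::
    "('a, 'm) ring_scheme \<Rightarrow> (nat \<Rightarrow> 'a) \<Rightarrow> (nat \<Rightarrow> 'a) \<Rightarrow> nat \<Rightarrow> 'a" where
  "witt_mult R f g = (\<lambda>n. finprod (series_ring R)
     (\<lambda>(i, j). one_minus_monom R
         ((witt_factors R f i [^]\<^bsub>R\<^esub> (lcm i j div i)) \<otimes>\<^bsub>R\<^esub>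
          (witt_factors R g j [^]\<^bsub>R\<^esub> (lcm i j div j))) (lcm i j)
        [^]\<^bsub>series_ring R\<^esub> gcd i j)
     ({1..n} \<times> {1..n}) n)"

definition witt_ring :: "('a, 'm) ring_scheme \<Rightarrow> (nat \<Rightarrow> 'a) ring" where
  "witt_ring R = \<lparr>
     carrier = witt_set R,
     monoid.mult = witt_mult R,
     one = one_minus_monom R \<one>\<^bsub>R\<^esub> 1,
     ring.zero = \<one>\<^bsub>series_ring R\<^esub>,
     add = monoid.mult (series_ring R)\<rparr>"

definition witt_map :: "('a \<Rightarrow> 'b) \<Rightarrow> (nat \<Rightarrow> 'a) \<Rightarrow> (nat \<Rightarrow> 'b)" where
  "witt_map h f = h \<circ> f"

text \<open>\<open>f = P/Q\<close> is written as \<open>Q f = P\<close>; note that \<open>Q\<close> is invertible as a power series.\<close>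

definition W_rat :: "('a, 'm) ring_scheme \<Rightarrow> (nat \<Rightarrow> 'a) ring" where
  "W_rat R = witt_ring R \<lparr>carrier :=
     {f \<in> witt_set R. \<exists>P\<in>carrier (UP R). \<exists>Q\<in>carrier (UP R).
        P 0 = \<one>\<^bsub>R\<^esub> \<and> Q 0 = \<one>\<^bsub>R\<^esub> \<and> Q \<otimes>\<^bsub>series_ring R\<^esub> f = P}\<rparr>"

definition hankel :: "(nat \<Rightarrow> 'a) \<Rightarrow> nat \<Rightarrow> nat \<Rightarrow> 'a" where
  "hankel f i j = f (i + j)"

text \<open>Leibniz formula for the matrix \<open>(M i j)\<close> with \<open>i, j < m\<close>.\<close>

definition det_in :: "('a, 'm) ring_scheme \<Rightarrow> nat \<Rightarrow> (nat \<Rightarrow> nat \<Rightarrow> 'a) \<Rightarrow> 'a" where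
  "det_in R m M = (\<Oplus>\<^bsub>R\<^esub>\<sigma>\<in>{\<sigma>. \<sigma> permutes {..<m}}.
     [sign \<sigma>] \<cdot>\<^bsub>R\<^esub> (\<Otimes>\<^bsub>R\<^esub>i\<in>{..<m}. M i (\<sigma> i)))"

definition minors_vanish ::
    "('a, 'm) ring_scheme \<Rightarrow> nat \<Rightarrow> (nat \<Rightarrow> nat \<Rightarrow> 'a) \<Rightarrow> bool" where
  "minors_vanish R m M \<longleftrightarrow>
     (\<forall>r c. strict_mono_on {..<m} r \<and> strict_mono_on {..<m} c \<longrightarrow>
        det_in R m (\<lambda>i j. M (r i) (c j)) = \<zero>\<^bsub>R\<^esub>)"

definition W_J :: "('a, 'm) ring_scheme \<Rightarrow> (nat \<Rightarrow> 'a) ring" where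
  "W_J R = witt_ring R \<lparr>carrier :=
     {f \<in> witt_set R. \<exists>n\<ge>1. minors_vanish R (n + 1) (hankel f)}\<rparr>"


section \<open>Tensor products\<close>

text \<open>
  \<open>M \<otimes>\<^sub>R N\<close> is the free abelian group on \<open>M \<times> N\<close> modulo the subgroup \<open>tensor_rel R M N\<close>.
\<close>

definition tensor_rel ::
    "('r, 'k) ring_scheme \<Rightarrow> ('r, 'm, 'x) module_scheme \<Rightarrow> ('r, 'n, 'y) module_scheme
       \<Rightarrow> ('m \<times> 'n \<Rightarrow>\<^sub>0 int) set" where
  "tensor_rel R M N = generate (free_Abelian_group (carrier M \<times> carrier N))
     ({frag_of (x \<oplus>\<^bsub>M\<^esub> x', y) - frag_of (x, y) - frag_of (x', y) | x x' y.
         x \<in> carrier M \<and> x' \<in> carrier M \<and> y \<in> carrier N} \<union>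
      {frag_of (x, y \<oplus>\<^bsub>N\<^esub> y') - frag_of (x, y) - frag_of (x, y') | x y y'.
         x \<in> carrier M \<and> y \<in> carrier N \<and> y' \<in> carrier N} \<union>
      {frag_of (r \<odot>\<^bsub>M\<^esub> x, y) - frag_of (x, r \<odot>\<^bsub>N\<^esub> y) | r x y.
         r \<in> carrier R \<and> x \<in> carrier M \<and> y \<in> carrier N})"

definition tensor_group ::
    "('r, 'k) ring_scheme \<Rightarrow> ('r, 'm, 'x) module_scheme \<Rightarrow> ('r, 'n, 'y) module_scheme
       \<Rightarrow> ('m \<times> 'n \<Rightarrow>\<^sub>0 int) set monoid" where
  "tensor_group R M N = free_Abelian_group (carrier M \<times> carrier N) Mod tensor_rel R M N"

text \<open>The map \<open>f \<otimes> id : M \<otimes>\<^sub>R N \<rightarrow> M' \<otimes>\<^sub>R N\<close> induced by a linear map \<open>f : M \<rightarrow> M'\<close>, on cosets.\<close>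

definition tensor_map ::
    "('r, 'k) ring_scheme \<Rightarrow> ('r, 'm, 'x) module_scheme \<Rightarrow> ('r, 'n, 'y) module_scheme
       \<Rightarrow> ('l \<Rightarrow> 'm) \<Rightarrow> ('l \<times> 'n \<Rightarrow>\<^sub>0 int) set \<Rightarrow> ('m \<times> 'n \<Rightarrow>\<^sub>0 int) set" where
  "tensor_map R M' N f t = the_elem ((\<lambda>c. r_coset (free_Abelian_group (carrier M' \<times> carrier N))
       (tensor_rel R M' N) (frag_extend (\<lambda>(x, y). frag_of (f x, y)) c)) ` t)"

text \<open>The ring \<open>B\<close>, viewed as a module along a ring homomorphism \<open>h\<close> into \<open>B\<close>.\<close>

definition scalars_along :: "('r \<Rightarrow> 'b) \<Rightarrow> ('b, 'k) ring_scheme \<Rightarrow> ('r, 'b) module" where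
  "scalars_along h B = \<lparr>carrier = carrier B, monoid.mult = monoid.mult B, one = monoid.one B,
     ring.zero = ring.zero B, add = ring.add B, smult = (\<lambda>r x. h r \<otimes>\<^bsub>B\<^esub> x)\<rparr>"

text \<open>
  \<open>B \<otimes>\<^sub>R C\<close> as a ring: on the free abelian group on \<open>B \<times> C\<close>, i.e. the ring of the
  multiplicative monoid \<open>B \<times> C\<close> over the integers, multiplication is biadditive with
  \<open>(x, y) (x', y') = (x x', y y')\<close>, and \<open>tensor_rel\<close> is an ideal for it.
\<close>

definition pair_monoid_ring ::
    "('b, 'k) ring_scheme \<Rightarrow> ('c, 'l) ring_scheme \<Rightarrow> ('b \<times> 'c \<Rightarrow>\<^sub>0 int) ring" where
  "pair_monoid_ring B C = \<lparr>
     carrier = carrier (free_Abelian_group (carrier B \<times> carrier C)),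
     monoid.mult = (\<lambda>p q. frag_extend (\<lambda>(x, y). frag_extend
               (\<lambda>(x', y'). frag_of (x \<otimes>\<^bsub>B\<^esub> x', y \<otimes>\<^bsub>C\<^esub> y')) q) p),
     one = frag_of (\<one>\<^bsub>B\<^esub>, \<one>\<^bsub>C\<^esub>),
     ring.zero = 0,
     add = (+)\<rparr>"

definition tensor_ring ::
    "('r, 'k) ring_scheme \<Rightarrow> ('r \<Rightarrow> 'b) \<Rightarrow> ('b, 'x) ring_scheme \<Rightarrow> ('r \<Rightarrow> 'c) \<Rightarrow> ('c, 'y) ring_scheme
       \<Rightarrow> ('b \<times> 'c \<Rightarrow>\<^sub>0 int) set ring" where
  "tensor_ring R h B k C =
     pair_monoid_ring B C Quot tensor_rel R (scalars_along h B) (scalars_along k C)"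

definition tensor_elem ::
    "('r, 'k) ring_scheme \<Rightarrow> ('r \<Rightarrow> 'b) \<Rightarrow> ('b, 'x) ring_scheme \<Rightarrow> ('r \<Rightarrow> 'c) \<Rightarrow> ('c, 'y) ring_scheme
       \<Rightarrow> 'b \<Rightarrow> 'c \<Rightarrow> ('b \<times> 'c \<Rightarrow>\<^sub>0 int) set" where
  "tensor_elem R h B k C x y =
     tensor_rel R (scalars_along h B) (scalars_along k C) +>\<^bsub>pair_monoid_ring B C\<^esub> frag_of (x, y)"


section \<open>Flatness\<close>

definition linear_maps ::
    "('r, 'k) ring_scheme \<Rightarrow> ('r, 'm, 'x) module_scheme \<Rightarrow> ('r, 'n, 'y) module_scheme
       \<Rightarrow> ('m \<Rightarrow> 'n) set" where
  "linear_maps R M N = {f \<in> hom (add_monoid M) (add_monoid N).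
     \<forall>r\<in>carrier R. \<forall>x\<in>carrier M. f (r \<odot>\<^bsub>M\<^esub> x) = r \<odot>\<^bsub>N\<^esub> f x}"

text \<open>
  Tensoring with \<open>N\<close> preserves exactness.  HOL cannot quantify over modules in all types, so the
  test modules live in the fixed type of sets of sequences in \<open>R\<close>.  It contains a copy of every
  countably generated module, as cosets of a submodule of the finitely supported sequences.
  Hence it contains all finitely generated modules, which suffice to test flatness.
\<close>

definition flat_module :: "('r, 'k) ring_scheme \<Rightarrow> ('r, 'n, 'y) module_scheme \<Rightarrow> bool" where
  "flat_module R N \<longleftrightarrow> Module.module R N \<and>
     (\<forall>(M1 :: ('r, (nat \<Rightarrow> 'r) set) module) (M2 :: ('r, (nat \<Rightarrow> 'r) set) module)
       (M3 :: ('r, (nat \<Rightarrow> 'r) set) module) f g.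
        Module.module R M1 \<and> Module.module R M2 \<and> Module.module R M3 \<and>
        f \<in> linear_maps R M1 M2 \<and> g \<in> linear_maps R M2 M3 \<and>
        f ` carrier M1 = a_kernel M2 M3 g \<longrightarrow>
        tensor_map R M2 N f ` carrier (tensor_group R M1 N) =
          kernel (tensor_group R M2 N) (tensor_group R M3 N) (tensor_map R M3 N g))"


section \<open>Spectra and fpqc-coverings\<close>

definition Spec :: "('a, 'm) ring_scheme \<Rightarrow> 'a set set" where
  "Spec R = {p. primeideal p R}"

definition zariski :: "('a, 'm) ring_scheme \<Rightarrow> 'a set topology" where
  "zariski R = topology (\<lambda>U. \<exists>S\<subseteq>carrier R. U = {p \<in> Spec R. \<not> S \<subseteq> p})"

definition spec_map :: "('a, 'm) ring_scheme \<Rightarrow> ('a \<Rightarrow> 'b) \<Rightarrow> 'b set \<Rightarrow> 'a set" where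
  "spec_map R h q = {x \<in> carrier R. h x \<in> q}"

text \<open>
  The family \<open>Spec (B i) \<rightarrow> Spec A\<close>, \<open>i \<in> I\<close>, is an fpqc-covering: it is flat, jointly surjective,
  and each quasi-compact open subset of \<open>Spec A\<close> is the image of a quasi-compact open subset of
  the disjoint union of the \<open>Spec (B i)\<close>, i.e. the union of the images of finitely many
  quasi-compact open subsets of members of the family.
\<close>

definition fpqc_covering ::
    "('a, 'm) ring_scheme \<Rightarrow> 'i set \<Rightarrow> ('i \<Rightarrow> ('b, 'n) ring_scheme) \<Rightarrow> ('i \<Rightarrow> 'a \<Rightarrow> 'b) \<Rightarrow> bool" where
  "fpqc_covering A I B h \<longleftrightarrow>
     (\<forall>i\<in>I. h i \<in> ring_hom A (B i) \<and> flat_module A (scalars_along (h i) (B i))) \<and>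
     (\<Union>i\<in>I. spec_map A (h i) ` Spec (B i)) = Spec A \<and>
     (\<forall>U. openin (zariski A) U \<and> compactin (zariski A) U \<longrightarrow>
        (\<exists>J V. finite J \<and> J \<subseteq> I \<and>
           (\<forall>j\<in>J. openin (zariski (B j)) (V j) \<and> compactin (zariski (B j)) (V j)) \<and>
           (\<Union>j\<in>J. spec_map A (h j) ` V j) = U))"


section \<open>The sheaf condition\<close>

text \<open>
  Exactness of \<open>F \<rightarrow> \<Prod>\<^sub>i G i \<rightrightarrows> \<Prod>\<^sub>i\<^sub>j H i j\<close>, with \<open>l i j\<close> and \<open>r i j\<close> the components of the parallel
  arrows, defined on \<open>G i\<close> and on \<open>G j\<close>: a diagram of ring homomorphisms
  which is an equalizer (on underlying sets, as limits of rings are computed there).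
\<close>

definition exact_fork ::
    "'f ring \<Rightarrow> 'i set \<Rightarrow> ('i \<Rightarrow> 'g ring) \<Rightarrow> ('i \<Rightarrow> 'i \<Rightarrow> 'h ring)
      \<Rightarrow> ('i \<Rightarrow> 'f \<Rightarrow> 'g) \<Rightarrow> ('i \<Rightarrow> 'i \<Rightarrow> 'g \<Rightarrow> 'h) \<Rightarrow> ('i \<Rightarrow> 'i \<Rightarrow> 'g \<Rightarrow> 'h) \<Rightarrow> bool" where
  "exact_fork F I G H e l r \<longleftrightarrow>
     (\<forall>i\<in>I. e i \<in> ring_hom F (G i)) \<and>
     (\<forall>i\<in>I. \<forall>j\<in>I. l i j \<in> ring_hom (G i) (H i j) \<and> r i j \<in> ring_hom (G j) (H i j)) \<and>
     bij_betw (\<lambda>x. \<lambda>i\<in>I. e i x) (carrier F)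
       {y \<in> (\<Pi>\<^sub>E i\<in>I. carrier (G i)). \<forall>i\<in>I. \<forall>j\<in>I. l i j (y i) = r i j (y j)}"

text \<open>
  The sheaf condition at one covering.  As \<open>F\<close> is a functor on rings, it occurs through its
  values \<open>FA\<close>, \<open>FB\<close> and \<open>FT\<close> on the three kinds of rings, which have different types.  On maps it
  is \<open>witt_map\<close>.
\<close>

definition witt_sheaf_condition ::
    "('a ring \<Rightarrow> (nat \<Rightarrow> 'a) ring) \<Rightarrow> ('b ring \<Rightarrow> (nat \<Rightarrow> 'b) ring) \<Rightarrow>
     (('b \<times> 'b \<Rightarrow>\<^sub>0 int) set ring \<Rightarrow> (nat \<Rightarrow> ('b \<times> 'b \<Rightarrow>\<^sub>0 int) set) ring) \<Rightarrow>
     'a ring \<Rightarrow> 'i set \<Rightarrow> ('i \<Rightarrow> 'b ring) \<Rightarrow> ('i \<Rightarrow> 'a \<Rightarrow> 'b) \<Rightarrow> bool" where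
  "witt_sheaf_condition FA FB FT A I B h \<longleftrightarrow>
     exact_fork (FA A) I (\<lambda>i. FB (B i)) (\<lambda>i j. FT (tensor_ring A (h i) (B i) (h j) (B j)))
       (\<lambda>i. witt_map (h i))
       (\<lambda>i j. witt_map (\<lambda>x. tensor_elem A (h i) (B i) (h j) (B j) x \<one>\<^bsub>B j\<^esub>))
       (\<lambda>i j. witt_map (\<lambda>y. tensor_elem A (h i) (B i) (h j) (B j) \<one>\<^bsub>B i\<^esub> y))"


section \<open>Dual numbers\<close>

text \<open>\<open>R[\<epsilon>]\<close> with \<open>\<epsilon>\<^sup>2 = 0\<close>; the pair \<open>(a, b)\<close> stands for \<open>a + b \<epsilon>\<close>.\<close>

definition dual_numbers :: "('a, 'm) ring_scheme \<Rightarrow> ('a \<times> 'a) ring" where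
  "dual_numbers R = \<lparr>
     carrier = carrier R \<times> carrier R,
     monoid.mult = (\<lambda>(a, b) (c, d). (a \<otimes>\<^bsub>R\<^esub> c, (a \<otimes>\<^bsub>R\<^esub> d) \<oplus>\<^bsub>R\<^esub> (b \<otimes>\<^bsub>R\<^esub> c))),
     one = (\<one>\<^bsub>R\<^esub>, \<zero>\<^bsub>R\<^esub>),
     ring.zero = (\<zero>\<^bsub>R\<^esub>, \<zero>\<^bsub>R\<^esub>),
     add = (\<lambda>(a, b) (c, d). (a \<oplus>\<^bsub>R\<^esub> c, b \<oplus>\<^bsub>R\<^esub> d))\<rparr>"

end

theory Submission
  imports Defs
begin

text \<open>
  The coefficients of \<open>f\<close> satisfy a linear recurrence with leading coefficient \<open>1\<close> if and only if \<open>f\<close>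
  is rational.  Over a Noetherian ring \<open>A\<close> descent along a flat family \<open>A \<rightarrow> B\<^sub>i\<close>, jointly surjective on
  spectra, comes from one principle: if \<open>b \<in> B\<^sub>i\<^sup>n\<close> and \<open>b\<^sub>l\<close> lies outside a prime \<open>q\<close> of \<open>B\<^sub>i\<close>, then
  there is \<open>u \<in> A\<^sup>n\<close> which satisfies all linear equations over \<open>A\<close> satisfied by \<open>b\<close>, and with
  \<open>u\<^sub>l\<close> not mapped into \<open>q\<close>.  So an ideal of \<open>A\<close> containing all such \<open>u\<^sub>l\<close>, for all \<open>i\<close>
  and \<open>q\<close>, lies in no prime and contains \<open>1\<close>.  This is applied to the possible leading coefficients of recurrences for \<open>f\<close>, to the annihilators of
  Hankel minors, and to the denominators \<open>c\<close> for which the family \<open>c y\<^sub>i\<close> comes from \<open>A\<close>, when \<open>(y\<^sub>i)\<close>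
  is a matching family of coefficients.

  Over a Noetherian domain, if the Hankel matrix has rank \<open>r\<close> then the module generated by the shifts
  of \<open>f\<close> embeds into \<open>A\<^sup>r\<close> by Cramer's rule.  Hence it is finitely generated, which gives a recurrence
  with leading coefficient \<open>1\<close>.
\<close>

section \<open>The Witt ring as a functor\<close>

subsection \<open>The ring of power series\<close>

text \<open>The principle behind the descent is exactness: the relations over \<open>A\<close>
  between the entries of \<open>b\<close> form a finitely generated module, its generators are the
  rows of a matrix from \<open>A^n\<close> to \<open>A^m\<close> with kernel \<open>K\<close>, and
  flatness puts \<open>b\<close> into the image of \<open>K \<otimes> B\<close>. Stating the
  conclusion as membership in an ideal avoids carrying the resulting linear combinations along.

  Gluing has to cope with an arbitrary index set. Passing to the product of the members would not
  help, since tensor products do not commute with infinite products. So near a prime of one member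
  the comparison of that member with itself gives a denominator for its own entry alone; the
  comparison with any other member shows that the remaining error there is killed by a further
  denominator, which depends on that member. That one denominator serves all members is a second use
  of the Noetherian property of \<open>A\<close>.

  A matching family of series is glued coefficient by coefficient. What needs separate descent is
  the length of a recurrence or the size of the minors, which might grow from member to
  member.\<close>

lemma carrier_series_ring [simp]: "carrier (series_ring R) = UNIV \<rightarrow> carrier R"
  by (simp add: series_ring_def)

lemma one_series_ring: "\<one>\<^bsub>series_ring R\<^esub> = (\<lambda>n. if n = 0 then \<one>\<^bsub>R\<^esub> else \<zero>\<^bsub>R\<^esub>)"
  by (simp add: series_ring_def)

lemma add_series_ring [simp]: "(f \<oplus>\<^bsub>series_ring R\<^esub> g) n = f n \<oplus>\<^bsub>R\<^esub> g n"
  by (simp add: series_ring_def)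

lemma zero_series_ring [simp]: "\<zero>\<^bsub>series_ring R\<^esub> n = \<zero>\<^bsub>R\<^esub>"
  by (simp add: series_ring_def)

lemma mult_series_ring:
  "(f \<otimes>\<^bsub>series_ring R\<^esub> g) n = (\<Oplus>\<^bsub>R\<^esub>k\<in>{..n}. f k \<otimes>\<^bsub>R\<^esub> g (n - k))"
  by (simp add: series_ring_def)

context cring
begin

lemma finsum_cong2:
  assumes "\<And>i. i \<in> A \<Longrightarrow> g i \<in> carrier R" "\<And>i. i \<in> A \<Longrightarrow> f i = g i"
  shows "finsum R f A = finsum R g A"
  using assms by (intro finsum_cong') auto

lemma series_mult_closed:
  assumes "f \<in> UNIV \<rightarrow> carrier R" "g \<in> UNIV \<rightarrow> carrier R"
  shows "f \<otimes>\<^bsub>series_ring R\<^esub> g \<in> UNIV \<rightarrow> carrier R"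
  using assms by (auto simp: mult_series_ring Pi_iff intro!: finsum_closed)

lemma series_mult_trunc:
  assumes f: "f \<in> UNIV \<rightarrow> carrier R" and g: "g \<in> UNIV \<rightarrow> carrier R"
    and p: "p \<in> carrier (UP R)" "\<And>i. i \<le> n \<Longrightarrow> p i = f i"
    and q: "q \<in> carrier (UP R)" "\<And>i. i \<le> n \<Longrightarrow> q i = g i"
    and m: "m \<le> n"
  shows "(p \<otimes>\<^bsub>UP R\<^esub> q) m = (f \<otimes>\<^bsub>series_ring R\<^esub> g) m"
proof -
  have pq: "p \<in> up R" "q \<in> up R" using p q by (auto simp: UP_def)
  have "(p \<otimes>\<^bsub>UP R\<^esub> q) m = (\<Oplus>i\<in>{..m}. p i \<otimes> q (m - i))"
    using pq by (simp add: UP_def)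
  also have "\<dots> = (\<Oplus>i\<in>{..m}. f i \<otimes> g (m - i))"
    using f g p(2) q(2) m by (intro finsum_cong2) (auto simp: Pi_iff)
  finally show ?thesis by (simp add: mult_series_ring)
qed

text \<open>
  The coefficient of a product at \<open>T\<^sup>n\<close> only involves the truncations of the factors, so the ring
  laws are inherited from polynomials.
\<close>

lemma series_trunc:
  assumes "f \<in> UNIV \<rightarrow> carrier R"
  obtains p where "p \<in> carrier (UP R)" "\<And>i. i \<le> n \<Longrightarrow> p i = f i"
proof
  show "(\<lambda>i. if i \<le> n then f i else \<zero>) \<in> carrier (UP R)"
    using assms by (auto simp: UP_def Pi_iff intro!: exI[of _ n])
qed auto

lemma series_assoc:
  assumes f: "f \<in> UNIV \<rightarrow> carrier R" and g: "g \<in> UNIV \<rightarrow> carrier R" and h: "h \<in> UNIV \<rightarrow> carrier R"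
  shows "(f \<otimes>\<^bsub>series_ring R\<^esub> g) \<otimes>\<^bsub>series_ring R\<^esub> h =
    f \<otimes>\<^bsub>series_ring R\<^esub> (g \<otimes>\<^bsub>series_ring R\<^esub> h)"
proof
  fix n
  interpret U: UP_cring R "UP R" by unfold_locales simp
  obtain p where p: "p \<in> carrier (UP R)" "\<And>i. i \<le> n \<Longrightarrow> p i = f i" using series_trunc[OF f] by blast
  obtain q where q: "q \<in> carrier (UP R)" "\<And>i. i \<le> n \<Longrightarrow> q i = g i" using series_trunc[OF g] by blast
  obtain r where r: "r \<in> carrier (UP R)" "\<And>i. i \<le> n \<Longrightarrow> r i = h i" using series_trunc[OF h] by blast
  have "((p \<otimes>\<^bsub>UP R\<^esub> q) \<otimes>\<^bsub>UP R\<^esub> r) n = ((f \<otimes>\<^bsub>series_ring R\<^esub> g) \<otimes>\<^bsub>series_ring R\<^esub> h) n"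
    by (rule series_mult_trunc[where n=n])
      (use series_mult_closed[OF f g] h r p q series_mult_trunc[OF f g p q] U.UP_mult_closed in auto)
  moreover have "(p \<otimes>\<^bsub>UP R\<^esub> (q \<otimes>\<^bsub>UP R\<^esub> r)) n = (f \<otimes>\<^bsub>series_ring R\<^esub> (g \<otimes>\<^bsub>series_ring R\<^esub> h)) n"
    by (rule series_mult_trunc[where n=n])
      (use series_mult_closed[OF g h] f r p q series_mult_trunc[OF g h q r] U.UP_mult_closed in auto)
  ultimately show "((f \<otimes>\<^bsub>series_ring R\<^esub> g) \<otimes>\<^bsub>series_ring R\<^esub> h) n =
    (f \<otimes>\<^bsub>series_ring R\<^esub> (g \<otimes>\<^bsub>series_ring R\<^esub> h)) n"
    using U.UP_m_assoc p q r by simp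
qed

lemma series_comm:
  assumes f: "f \<in> UNIV \<rightarrow> carrier R" and g: "g \<in> UNIV \<rightarrow> carrier R"
  shows "f \<otimes>\<^bsub>series_ring R\<^esub> g = g \<otimes>\<^bsub>series_ring R\<^esub> f"
proof
  fix n
  interpret U: UP_cring R "UP R" by unfold_locales simp
  obtain p where p: "p \<in> carrier (UP R)" "\<And>i. i \<le> n \<Longrightarrow> p i = f i" using series_trunc[OF f] by blast
  obtain q where q: "q \<in> carrier (UP R)" "\<And>i. i \<le> n \<Longrightarrow> q i = g i" using series_trunc[OF g] by blast
  show "(f \<otimes>\<^bsub>series_ring R\<^esub> g) n = (g \<otimes>\<^bsub>series_ring R\<^esub> f) n"
    using series_mult_trunc[OF f g p q, of n] series_mult_trunc[OF g f q p, of n] U.UP_m_comm[OF p(1) q(1)]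
    by simp
qed

lemma series_one_mult:
  assumes f: "f \<in> UNIV \<rightarrow> carrier R"
  shows "\<one>\<^bsub>series_ring R\<^esub> \<otimes>\<^bsub>series_ring R\<^esub> f = f"
proof
  fix n
  interpret U: UP_cring R "UP R" by unfold_locales simp
  obtain p where p: "p \<in> carrier (UP R)" "\<And>i. i \<le> n \<Longrightarrow> p i = f i" using series_trunc[OF f] by blast
  have 1: "\<one>\<^bsub>UP R\<^esub> i = \<one>\<^bsub>series_ring R\<^esub> i" for i by (simp add: UP_def one_series_ring)
  have "(\<one>\<^bsub>UP R\<^esub> \<otimes>\<^bsub>UP R\<^esub> p) n = (\<one>\<^bsub>series_ring R\<^esub> \<otimes>\<^bsub>series_ring R\<^esub> f) n"
    by (rule series_mult_trunc[where n=n]) (use 1 f p U.UP_one_closed in \<open>auto simp: one_series_ring\<close>)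
  then show "(\<one>\<^bsub>series_ring R\<^esub> \<otimes>\<^bsub>series_ring R\<^esub> f) n = f n" using p by simp
qed

lemma series_distr:
  assumes f: "f \<in> UNIV \<rightarrow> carrier R" and g: "g \<in> UNIV \<rightarrow> carrier R" and h: "h \<in> UNIV \<rightarrow> carrier R"
  shows "(f \<oplus>\<^bsub>series_ring R\<^esub> g) \<otimes>\<^bsub>series_ring R\<^esub> h =
    f \<otimes>\<^bsub>series_ring R\<^esub> h \<oplus>\<^bsub>series_ring R\<^esub> g \<otimes>\<^bsub>series_ring R\<^esub> h"
proof
  fix n
  have "(\<Oplus>k\<in>{..n}. (f k \<oplus> g k) \<otimes> h (n - k)) = (\<Oplus>k\<in>{..n}. f k \<otimes> h (n - k) \<oplus> g k \<otimes> h (n - k))"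
    using f g h by (intro finsum_cong2) (auto simp: Pi_iff l_distr)
  also have "\<dots> = (\<Oplus>k\<in>{..n}. f k \<otimes> h (n - k)) \<oplus> (\<Oplus>k\<in>{..n}. g k \<otimes> h (n - k))"
    using f g h by (intro finsum_addf) (auto simp: Pi_iff)
  finally show "((f \<oplus>\<^bsub>series_ring R\<^esub> g) \<otimes>\<^bsub>series_ring R\<^esub> h) n =
    (f \<otimes>\<^bsub>series_ring R\<^esub> h \<oplus>\<^bsub>series_ring R\<^esub> g \<otimes>\<^bsub>series_ring R\<^esub> h) n"
    by (simp add: mult_series_ring)
qed

lemma cring_series_ring: "cring (series_ring R)"
proof (rule cringI)
  show "abelian_group (series_ring R)"
  proof (rule abelian_groupI)
    fix f assume "f \<in> carrier (series_ring R)"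
    then show "\<exists>g\<in>carrier (series_ring R). g \<oplus>\<^bsub>series_ring R\<^esub> f = \<zero>\<^bsub>series_ring R\<^esub>"
      by (intro bexI[of _ "\<lambda>n. \<ominus> f n"]) (auto simp: fun_eq_iff Pi_iff l_neg)
  qed (auto simp: fun_eq_iff Pi_iff a_ac)
  show "comm_monoid (series_ring R)"
    by (rule comm_monoidI)
      (simp_all add: series_mult_closed series_assoc series_one_mult, simp_all add: one_series_ring series_comm)
qed (simp add: series_distr)

lemma one_minus_monom_closed: "a \<in> carrier R \<Longrightarrow> one_minus_monom R a m \<in> UNIV \<rightarrow> carrier R"
  by (auto simp: one_minus_monom_def)

text \<open>Only the terms with k = 0 and k = m of the Cauchy product survive; \<open>m\<close> is
  positive, so these are two different terms.\<close>

lemma one_minus_monom_mult: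
  assumes "a \<in> carrier R" "g \<in> UNIV \<rightarrow> carrier R" "m \<ge> 1"
  shows "(one_minus_monom R a m \<otimes>\<^bsub>series_ring R\<^esub> g) n =
    (if n < m then g n else g n \<ominus> a \<otimes> g (n - m))"
proof -
  have g: "g i \<in> carrier R" for i using assms by auto
  have zero: "(\<Oplus>k\<in>{..n}. one_minus_monom R a m k \<otimes> g (n - k)) =
    (\<Oplus>k\<in>(if n < m then {0} else {0, m}). one_minus_monom R a m k \<otimes> g (n - k))"
    using assms g
    by (cases "n < m"; intro add.finprod_mono_neutral_cong_right) (auto simp: one_minus_monom_def)
  show ?thesis
    unfolding mult_series_ring zero using assms(1,3) g
    by (cases "n < m") (auto simp: one_minus_monom_def a_minus_def l_minus)
qed

end

lemma ring_hom_series_ring: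
  assumes "cring R" "cring S" "h \<in> ring_hom R S"
  shows "(\<lambda>f. h \<circ> f) \<in> ring_hom (series_ring R) (series_ring S)"
proof -
  interpret ring_hom_cring R S h using assms by (simp add: ring_hom_cring_def ring_hom_cring_axioms_def)
  show ?thesis
  proof (rule ring_hom_memI)
    fix f g assume f: "f \<in> carrier (series_ring R)" and g: "g \<in> carrier (series_ring R)"
    show "h \<circ> f \<otimes>\<^bsub>series_ring R\<^esub> g = (h \<circ> f) \<otimes>\<^bsub>series_ring S\<^esub> (h \<circ> g)"
    proof
      fix n
      have "h (\<Oplus>\<^bsub>R\<^esub>k\<in>{..n}. f k \<otimes>\<^bsub>R\<^esub> g (n - k)) = (\<Oplus>\<^bsub>S\<^esub>k\<in>{..n}. (h \<circ> (\<lambda>k. f k \<otimes>\<^bsub>R\<^esub> g (n - k))) k)"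
        using f g by (intro hom_finsum) auto
      also have "\<dots> = (\<Oplus>\<^bsub>S\<^esub>k\<in>{..n}. h (f k) \<otimes>\<^bsub>S\<^esub> h (g (n - k)))"
        using f g by (intro S.finsum_cong2) (auto simp: Pi_iff)
      finally show "(h \<circ> f \<otimes>\<^bsub>series_ring R\<^esub> g) n = ((h \<circ> f) \<otimes>\<^bsub>series_ring S\<^esub> (h \<circ> g)) n"
        by (simp add: mult_series_ring)
    qed
    show "h \<circ> f \<oplus>\<^bsub>series_ring R\<^esub> g = (h \<circ> f) \<oplus>\<^bsub>series_ring S\<^esub> (h \<circ> g)"
      using f g by (auto simp: fun_eq_iff Pi_iff)
  qed (auto simp: one_series_ring fun_eq_iff Pi_iff)
qed

subsection \<open>Factorisation into factors \<open>1 - a T\<^sup>k\<close>\<close>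

text \<open>The property under the description operator in \<open>witt_factors\<close>, named so
  that existence and uniqueness can be proved for it separately.\<close>

definition is_witt_factors :: "('a, 'm) ring_scheme \<Rightarrow> (nat \<Rightarrow> 'a) \<Rightarrow> (nat \<Rightarrow> 'a) \<Rightarrow> bool" where
  "is_witt_factors R f a \<longleftrightarrow> a \<in> UNIV \<rightarrow> carrier R \<and> a 0 = \<zero>\<^bsub>R\<^esub> \<and>
     (\<forall>n. f n = finprod (series_ring R) (\<lambda>k. one_minus_monom R (a k) k) {1..n} n)"

text \<open>Partial products of the infinite factorisation. A factor with index k changes no
  coefficient below \<open>T^k\<close>, so the n-th partial product already shows the final
  coefficient at \<open>T^n\<close>.\<close>

definition witt_prod :: "('a, 'm) ring_scheme \<Rightarrow> (nat \<Rightarrow> 'a) \<Rightarrow> nat \<Rightarrow> nat \<Rightarrow> 'a" where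
  "witt_prod R a n = finprod (series_ring R) (\<lambda>k. one_minus_monom R (a k) k) {1..n}"

context cring
begin

lemma witt_prod_closed:
  assumes "\<And>k. k \<in> {1..n} \<Longrightarrow> a k \<in> carrier R"
  shows "witt_prod R a n \<in> UNIV \<rightarrow> carrier R"
proof -
  interpret S: cring "series_ring R" by (rule cring_series_ring)
  show ?thesis
    using S.finprod_closed[of "\<lambda>k. one_minus_monom R (a k) k" "{1..n}"] assms one_minus_monom_closed
    by (auto simp: witt_prod_def Pi_iff)
qed

lemma witt_prod_Suc:
  assumes "\<And>k. k \<in> {1..Suc n} \<Longrightarrow> a k \<in> carrier R"
  shows "witt_prod R a (Suc n) =
    one_minus_monom R (a (Suc n)) (Suc n) \<otimes>\<^bsub>series_ring R\<^esub> witt_prod R a n"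
proof -
  interpret S: cring "series_ring R" by (rule cring_series_ring)
  have "{1..Suc n} = insert (Suc n) {1..n}" by auto
  moreover have "finprod (series_ring R) (\<lambda>k. one_minus_monom R (a k) k) (insert (Suc n) {1..n}) =
    one_minus_monom R (a (Suc n)) (Suc n) \<otimes>\<^bsub>series_ring R\<^esub>
    finprod (series_ring R) (\<lambda>k. one_minus_monom R (a k) k) {1..n}"
    using assms one_minus_monom_closed by (intro S.finprod_insert) (auto simp: Pi_iff)
  ultimately show ?thesis by (simp add: witt_prod_def)
qed

lemma witt_prod_0:
  assumes "\<And>k. k \<in> {1..n} \<Longrightarrow> a k \<in> carrier R"
  shows "witt_prod R a n 0 = \<one>"
proof -
  interpret S: cring "series_ring R" by (rule cring_series_ring)
  show ?thesis using assms
  proof (induction n)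
    case 0 then show ?case by (simp add: witt_prod_def one_series_ring)
  next
    case (Suc n)
    have cl: "witt_prod R a n \<in> UNIV \<rightarrow> carrier R" by (rule witt_prod_closed) (use Suc.prems in auto)
    show ?case using Suc one_minus_monom_mult[OF _ cl, of "a (Suc n)" "Suc n" 0]
      by (subst witt_prod_Suc) auto
  qed
qed

text \<open>As the partial product has constant term 1, the next factor subtracts exactly its own
  parameter. This triangular relation determines the parameters one after the other.\<close>

lemma witt_prod_coeff_Suc:
  assumes a: "\<And>k. k \<in> {1..Suc n} \<Longrightarrow> a k \<in> carrier R"
  shows "witt_prod R a (Suc n) (Suc n) = witt_prod R a n (Suc n) \<ominus> a (Suc n)"
proof -
  have cl: "witt_prod R a n \<in> UNIV \<rightarrow> carrier R" by (rule witt_prod_closed) (use a in auto)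
  show ?thesis using a one_minus_monom_mult[OF _ cl, of "a (Suc n)" "Suc n" "Suc n"]
      witt_prod_0[of n a] by (subst witt_prod_Suc) auto
qed

lemma witt_prod_cong:
  assumes "\<And>k. k \<in> {1..n} \<Longrightarrow> a k \<in> carrier R" "\<And>k. k \<in> {1..n} \<Longrightarrow> a k = b k"
  shows "witt_prod R a n = witt_prod R b n"
proof -
  interpret S: cring "series_ring R" by (rule cring_series_ring)
  have bc: "b k \<in> carrier R" if "k \<in> {1..n}" for k using that assms by metis
  then have "one_minus_monom R (b k) k \<in> UNIV \<rightarrow> carrier R" if "k \<in> {1..n}" for k
    using that one_minus_monom_closed by blast
  then show ?thesis unfolding witt_prod_def using assms
    by (intro S.finprod_cong') auto
qed

text \<open>Strong induction: if the parameters agree below \<open>n\<close>, the partial products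
  agree and the triangular relation at \<open>T^n\<close> forces equality there.\<close>

lemma witt_factors_unique:
  assumes "is_witt_factors R f a" "is_witt_factors R f b"
  shows "a = b"
proof
  fix n show "a n = b n"
  proof (induction n rule: less_induct)
    case (less n)
    show ?case
    proof (cases n)
      case 0 then show ?thesis using assms by (simp add: is_witt_factors_def)
    next
      case (Suc m)
      have ac: "a k \<in> carrier R" "b k \<in> carrier R" for k using assms by (auto simp: is_witt_factors_def)
      have "witt_prod R a (Suc m) (Suc m) = witt_prod R b (Suc m) (Suc m)"
        using assms by (metis is_witt_factors_def witt_prod_def)
      moreover have eq: "witt_prod R a m = witt_prod R b m"
        using less.IH Suc ac by (intro witt_prod_cong) auto
      moreover have "witt_prod R b m (Suc m) \<in> carrier R"
        using witt_prod_closed[of m b] ac by auto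
      ultimately show ?thesis using ac Suc
        by (simp add: witt_prod_coeff_Suc a_minus_def) (metis a_inv_closed add.l_cancel minus_minus)
    qed
  qed
qed

text \<open>Solves the triangular relation by recursion: the parameter at \<open>n\<close> is what
  the product of the earlier factors has in excess of \<open>f n\<close>.\<close>

lemma witt_factors_exist:
  assumes f: "f \<in> witt_set R"
  shows "\<exists>a. is_witt_factors R f a"
proof -
  define step where "step = (\<lambda>(a :: nat \<Rightarrow> 'a) n. if n = 0 then \<zero> else witt_prod R a (n - 1) n \<ominus> f n)"
  have fc: "f n \<in> carrier R" for n using f by (auto simp: witt_set_def)
  \<comment> \<open>Truncation lets the recursion see only values already computed; the value zero
    elsewhere keeps everything in the carrier.\<close>
  define cut where "cut = (\<lambda>(a :: nat \<Rightarrow> 'a) n k. if k < n then a k else \<zero>)"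
  define a where "a = wfrec less_than (\<lambda>a n. step (cut a n) n)"
  have rec: "a n = step (cut a n) n" for n
    unfolding a_def by (subst wfrec) (auto intro!: arg_cong2[of _ _ _ _ step] simp: cut_def cut_apply fun_eq_iff)
  have ac: "a n \<in> carrier R" for n
  proof (induction n rule: less_induct)
    case (less n)
    have "witt_prod R (cut a n) (n - 1) \<in> UNIV \<rightarrow> carrier R"
      by (rule witt_prod_closed) (auto simp: cut_def less.IH)
    then show ?case by (subst rec) (use fc[of n] in \<open>auto simp: step_def Pi_iff\<close>)
  qed
  have "f n = witt_prod R a n n" for n
  proof (cases n)
    case 0 then show ?thesis using f witt_prod_0[of 0 a] by (simp add: witt_set_def)
  next
    case (Suc m)
    have "witt_prod R (cut a n) m = witt_prod R a m"
      using ac Suc by (intro witt_prod_cong) (auto simp: cut_def)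
    then have "a n = witt_prod R a m n \<ominus> f n" using rec[of n] Suc by (simp add: step_def)
    moreover have "witt_prod R a m n \<in> carrier R" using witt_prod_closed[of m a] ac by auto
    ultimately show ?thesis using Suc ac fc[of n]
      by (simp add: witt_prod_coeff_Suc) (simp add: a_minus_def minus_add r_neg2)
  qed
  moreover have "a 0 = \<zero>" by (subst rec) (simp add: step_def)
  ultimately show ?thesis using ac by (intro exI[of _ a]) (auto simp: is_witt_factors_def witt_prod_def)
qed

lemma is_witt_factors:
  assumes "f \<in> witt_set R" shows "is_witt_factors R f (witt_factors R f)"
proof -
  have "witt_factors R f = (THE a. is_witt_factors R f a)"
    by (simp add: witt_factors_def is_witt_factors_def)
  then show ?thesis using witt_factors_exist[OF assms] witt_factors_unique theI'[of "is_witt_factors R f"]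
    by metis
qed

end

subsection \<open>Functoriality\<close>

context ring_hom_cring
begin

lemma series_hom: "ring_hom_cring (series_ring R) (series_ring S) (\<lambda>f. h \<circ> f)"
  using ring_hom_series_ring[OF R.is_cring S.is_cring homh] R.cring_series_ring S.cring_series_ring
  by (simp add: ring_hom_cring_def ring_hom_cring_axioms_def)

lemma hom_one_minus_monom:
  "a \<in> carrier R \<Longrightarrow> h \<circ> one_minus_monom R a m = one_minus_monom S (h a) m"
  by (auto simp: one_minus_monom_def fun_eq_iff)

lemma witt_map_closed: "f \<in> witt_set R \<Longrightarrow> witt_map h f \<in> witt_set S"
  by (auto simp: witt_set_def witt_map_def Pi_iff)

text \<open>The image of a factorisation of \<open>f\<close> is a factorisation of the image, and
  uniqueness identifies it with the chosen one.\<close>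

lemma hom_witt_factors:
  assumes f: "f \<in> witt_set R"
  shows "witt_factors S (h \<circ> f) = h \<circ> witt_factors R f"
proof -
  interpret ser: ring_hom_cring "series_ring R" "series_ring S" "\<lambda>f. h \<circ> f" by (rule series_hom)
  let ?a = "witt_factors R f"
  have a: "is_witt_factors R f ?a" by (rule R.is_witt_factors[OF f])
  then have ac: "?a k \<in> carrier R" for k by (auto simp: is_witt_factors_def)
  have "h \<circ> finprod (series_ring R) (\<lambda>k. one_minus_monom R (?a k) k) {1..n} =
    finprod (series_ring S) (\<lambda>k. one_minus_monom S ((h \<circ> ?a) k) k) {1..n}" for n
    using ac R.one_minus_monom_closed S.one_minus_monom_closed
    by (subst ser.hom_finprod) (auto simp: hom_one_minus_monom Pi_iff intro!: ser.S.finprod_cong')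
  then have "is_witt_factors S (h \<circ> f) (h \<circ> ?a)"
    using a ac by (auto simp: is_witt_factors_def) (metis comp_apply)
  moreover have "h \<circ> f \<in> witt_set S" using witt_map_closed[OF f] by (simp add: witt_map_def)
  ultimately show ?thesis using S.is_witt_factors S.witt_factors_unique by blast
qed

text \<open>Each coefficient comes from a finite product of explicit factors in the parameters of
  \<open>f\<close> and \<open>g\<close>, and \<open>h\<close> commutes with taking parameters by
  \<open>hom_witt_factors\<close>.\<close>

lemma hom_witt_mult:
  assumes f: "f \<in> witt_set R" and g: "g \<in> witt_set R"
  shows "h \<circ> witt_mult R f g = witt_mult S (h \<circ> f) (h \<circ> g)"
proof
  fix n
  interpret ser: ring_hom_cring "series_ring R" "series_ring S" "\<lambda>f. h \<circ> f" by (rule series_hom)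
  let ?a = "witt_factors R f" and ?b = "witt_factors R g"
  have ac: "?a k \<in> carrier R" "?b k \<in> carrier R" for k
    using R.is_witt_factors[OF f] R.is_witt_factors[OF g] by (auto simp: is_witt_factors_def)
  define F where "F = (\<lambda>(i, j). one_minus_monom R ((?a i [^]\<^bsub>R\<^esub> (lcm i j div i)) \<otimes>\<^bsub>R\<^esub>
     (?b j [^]\<^bsub>R\<^esub> (lcm i j div j))) (lcm i j) [^]\<^bsub>series_ring R\<^esub> gcd i j)"
  define G where "G = (\<lambda>(i, j). one_minus_monom S ((h (?a i) [^]\<^bsub>S\<^esub> (lcm i j div i)) \<otimes>\<^bsub>S\<^esub>
     (h (?b j) [^]\<^bsub>S\<^esub> (lcm i j div j))) (lcm i j) [^]\<^bsub>series_ring S\<^esub> gcd i j)"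
  have Fc: "F p \<in> carrier (series_ring R)" for p
  proof (cases p)
    case (Pair i j)
    show ?thesis unfolding F_def Pair prod.case
      by (rule ser.R.nat_pow_closed) (simp add: ac R.one_minus_monom_closed)
  qed
  have FG: "h \<circ> F p = G p" for p
  proof (cases p)
    case (Pair i j)
    let ?c = "(?a i [^]\<^bsub>R\<^esub> (lcm i j div i)) \<otimes>\<^bsub>R\<^esub> (?b j [^]\<^bsub>R\<^esub> (lcm i j div j))"
    have "h \<circ> F (i, j) = (h \<circ> one_minus_monom R ?c (lcm i j)) [^]\<^bsub>series_ring S\<^esub> gcd i j"
      unfolding F_def prod.case
      using ac R.one_minus_monom_closed by (intro ser.ring.hom_nat_pow) auto
    then show ?thesis using ac Pair by (simp add: G_def hom_one_minus_monom hom_nat_pow)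
  qed
  have "h \<circ> finprod (series_ring R) F ({1..n} \<times> {1..n}) = finprod (series_ring S) G ({1..n} \<times> {1..n})"
    using Fc by (subst ser.hom_finprod) (auto simp: o_def FG[unfolded o_def])
  then show "(h \<circ> witt_mult R f g) n = witt_mult S (h \<circ> f) (h \<circ> g) n"
    by (simp add: witt_mult_def hom_witt_factors f g F_def G_def fun_eq_iff)
qed

text \<open>The carriers are left arbitrary so that one statement serves \<open>W_rat\<close> and
  \<open>W_J\<close>: both have the operations of \<open>witt_ring\<close> and differ only in the
  carrier.\<close>

lemma ring_hom_witt_map:
  assumes A: "A \<subseteq> witt_set R" and AB: "\<And>f. f \<in> A \<Longrightarrow> witt_map h f \<in> B"
  shows "witt_map h \<in> ring_hom (witt_ring R\<lparr>carrier := A\<rparr>) (witt_ring S\<lparr>carrier := B\<rparr>)"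
proof -
  interpret ser: ring_hom_cring "series_ring R" "series_ring S" "\<lambda>f. h \<circ> f" by (rule series_hom)
  show ?thesis
  proof (rule ring_hom_memI; simp add: witt_ring_def)
    fix f g assume fg: "f \<in> A" "g \<in> A"
    then have *: "f \<in> witt_set R" "g \<in> witt_set R" using A by auto
    then have "f \<in> carrier (series_ring R)" "g \<in> carrier (series_ring R)" by (auto simp: witt_set_def)
    then show "witt_map h (f \<otimes>\<^bsub>series_ring R\<^esub> g) = witt_map h f \<otimes>\<^bsub>series_ring S\<^esub> witt_map h g"
      using ser.hom_mult by (simp add: witt_map_def)
    show "witt_map h (witt_mult R f g) = witt_mult S (witt_map h f) (witt_map h g)"
      using hom_witt_mult * by (simp add: witt_map_def)
  qed (use AB in \<open>auto simp: witt_map_def hom_one_minus_monom one_series_ring\<close>)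
qed

end

section \<open>Determinants over commutative rings\<close>

context cring
begin

text \<open>\<open>det_in\<close> multiplies by the sign as an integer; as an element of
  \<open>R\<close> it can be moved through ring products.\<close>

definition sgn_in :: "(nat \<Rightarrow> nat) \<Rightarrow> 'a" where
  "sgn_in \<rho> = (if evenperm \<rho> then \<one> else \<ominus> \<one>)"

lemma sgn_in_closed [simp]: "sgn_in \<rho> \<in> carrier R"
  by (simp add: sgn_in_def)

lemma sgn_in_comp:
  assumes "\<rho> permutes {..<m}" "\<tau> permutes {..<m}"
  shows "sgn_in (\<rho> \<circ> \<tau>) = sgn_in \<rho> \<otimes> sgn_in \<tau>"
proof -
  have "permutation \<rho>" "permutation \<tau>" using assms permutation_permutes by blast+
  then show ?thesis by (auto simp: sgn_in_def evenperm_comp l_minus)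
qed

lemma sgn_in_inv:
  assumes "\<rho> permutes {..<m}"
  shows "sgn_in (Hilbert_Choice.inv \<rho>) = sgn_in \<rho>"
proof -
  have "permutation \<rho>" using assms permutation_permutes by blast
  then show ?thesis by (auto simp: sgn_in_def evenperm_inv)
qed

lemma sgn_in_square: "sgn_in \<rho> \<otimes> sgn_in \<rho> = \<one>"
  by (simp add: sgn_in_def l_minus)

lemma sgn_in_smult:
  assumes "x \<in> carrier R"
  shows "add_pow R (sign \<rho>) x = sgn_in \<rho> \<otimes> x"
proof (cases "evenperm \<rho>")
  case True
  then show ?thesis using assms add.int_pow_1[OF assms] by (simp add: sgn_in_def sign_def)
next
  case False
  then have "add_pow R (sign \<rho>) x = \<ominus> (add_pow R (1::int) x)"
    using add.int_pow_neg[OF assms, of 1] by (simp add: sign_def)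
  then show ?thesis using assms False add.int_pow_1[OF assms] by (simp add: sgn_in_def l_minus)
qed

lemma finprod_cong2:
  assumes "\<And>i. i \<in> A \<Longrightarrow> g i \<in> carrier R" "\<And>i. i \<in> A \<Longrightarrow> f i = g i"
  shows "finprod R f A = finprod R g A"
  using assms by (intro finprod_cong') auto

definition mat_in :: "nat \<Rightarrow> (nat \<Rightarrow> nat \<Rightarrow> 'a) \<Rightarrow> bool" where
  "mat_in m M \<longleftrightarrow> (\<forall>i<m. \<forall>j<m. M i j \<in> carrier R)"

lemma mat_inD: "mat_in m M \<Longrightarrow> i < m \<Longrightarrow> j < m \<Longrightarrow> M i j \<in> carrier R"
  by (simp add: mat_in_def)

lemma mat_in_perm:
  assumes "mat_in m M" "\<rho> permutes {..<m}" "i < m"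
  shows "M i (\<rho> i) \<in> carrier R"
  using assms permutes_in_image[OF assms(2), of i] by (auto simp: mat_in_def)

lemma diag_closed:
  assumes "mat_in m M" "\<rho> permutes {..<m}"
  shows "(\<Otimes>i\<in>{..<m}. M i (\<rho> i)) \<in> carrier R"
  by (rule finprod_closed) (use mat_in_perm[OF assms] in auto)

lemma det_in_eq:
  assumes M: "mat_in m M"
  shows "det_in R m M = (\<Oplus>\<rho>\<in>{\<rho>. \<rho> permutes {..<m}}. sgn_in \<rho> \<otimes> (\<Otimes>i\<in>{..<m}. M i (\<rho> i)))"
  unfolding det_in_def using diag_closed[OF M]
  by (intro finsum_cong2) (auto simp: sgn_in_smult)

lemma det_in_closed:
  assumes M: "mat_in m M" shows "det_in R m M \<in> carrier R"
  unfolding det_in_eq[OF M] using diag_closed[OF M] by (intro finsum_closed) auto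

lemma det_in_cong:
  assumes M: "mat_in m M" and eq: "\<And>i j. i < m \<Longrightarrow> j < m \<Longrightarrow> N i j = M i j"
  shows "det_in R m N = det_in R m M"
proof -
  have N: "mat_in m N" using assms by (auto simp: mat_in_def)
  have "(\<Otimes>i\<in>{..<m}. N i (\<rho> i)) = (\<Otimes>i\<in>{..<m}. M i (\<rho> i))" if "\<rho> permutes {..<m}" for \<rho>
    using mat_in_perm[OF M that] eq permutes_in_image[OF that] by (intro finprod_cong2) auto
  then show ?thesis unfolding det_in_eq[OF M] det_in_eq[OF N]
    using diag_closed[OF M] by (intro finsum_cong2) auto
qed

lemma finprod_permute:
  assumes "\<pi> permutes {..<m}" "\<And>i. i < m \<Longrightarrow> f i \<in> carrier R"
  shows "(\<Otimes>i\<in>{..<m}. f (\<pi> i)) = (\<Otimes>i\<in>{..<m}. f i)"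
  using finprod_reindex[of f \<pi> "{..<m}"] assms permutes_image[OF assms(1)] permutes_inj_on[OF assms(1)]
  by auto

text \<open>Reindexing the Leibniz sum by right composition with \<pi> permutes the factors inside
  each product and costs the sign of \<pi>.\<close>

lemma det_in_permute_rows:
  assumes M: "mat_in m M" and \<pi>: "\<pi> permutes {..<m}"
  shows "det_in R m (\<lambda>i. M (\<pi> i)) = sgn_in \<pi> \<otimes> det_in R m M"
proof -
  let ?P = "{\<rho>. \<rho> permutes {..<m}}"
  have M\<pi>: "mat_in m (\<lambda>i. M (\<pi> i))"
    using M permutes_in_image[OF \<pi>] by (auto simp: mat_in_def)
  have im: "?P = (\<lambda>\<tau>. \<tau> \<circ> \<pi>) ` ?P"
    using image_compose_permutations_right[OF \<pi>] by (simp add: setcompr_eq_image)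
  have inj: "inj_on (\<lambda>\<tau>. \<tau> \<circ> \<pi>) ?P"
    by (rule inj_on_inverseI[of _ "\<lambda>\<tau>. \<tau> \<circ> Hilbert_Choice.inv \<pi>"])
      (simp add: fun_eq_iff permutes_inverses[OF \<pi>])
  have eq: "sgn_in (\<tau> \<circ> \<pi>) \<otimes> (\<Otimes>i\<in>{..<m}. M (\<pi> i) ((\<tau> \<circ> \<pi>) i)) =
      sgn_in \<pi> \<otimes> (sgn_in \<tau> \<otimes> (\<Otimes>i\<in>{..<m}. M i (\<tau> i)))" if "\<tau> \<in> ?P" for \<tau>
  proof -
    have \<tau>: "\<tau> permutes {..<m}" using that by simp
    have "(\<Otimes>i\<in>{..<m}. M (\<pi> i) ((\<tau> \<circ> \<pi>) i)) = (\<Otimes>i\<in>{..<m}. M i (\<tau> i))"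
      using finprod_permute[OF \<pi>, of "\<lambda>i. M i (\<tau> i)"] mat_in_perm[OF M \<tau>] by simp
    then show ?thesis using diag_closed[OF M \<tau>] by (simp add: sgn_in_comp[OF \<tau> \<pi>] m_ac)
  qed
  have cl: "sgn_in (\<tau> \<circ> \<pi>) \<otimes> (\<Otimes>i\<in>{..<m}. M (\<pi> i) ((\<tau> \<circ> \<pi>) i)) \<in> carrier R" if "\<tau> \<in> ?P" for \<tau>
    using eq[OF that] diag_closed[OF M] that by simp
  have "det_in R m (\<lambda>i. M (\<pi> i)) =
    (\<Oplus>\<rho>\<in>(\<lambda>\<tau>. \<tau> \<circ> \<pi>) ` ?P. sgn_in \<rho> \<otimes> (\<Otimes>i\<in>{..<m}. M (\<pi> i) (\<rho> i)))"
    unfolding det_in_eq[OF M\<pi>] by (subst im) rule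
  also have "\<dots> = (\<Oplus>\<tau>\<in>?P. sgn_in (\<tau> \<circ> \<pi>) \<otimes> (\<Otimes>i\<in>{..<m}. M (\<pi> i) ((\<tau> \<circ> \<pi>) i)))"
    using cl inj by (intro finsum_reindex) auto
  also have "\<dots> = (\<Oplus>\<tau>\<in>?P. sgn_in \<pi> \<otimes> (sgn_in \<tau> \<otimes> (\<Otimes>i\<in>{..<m}. M i (\<tau> i))))"
    using diag_closed[OF M] eq by (intro finsum_cong2) auto
  also have "\<dots> = sgn_in \<pi> \<otimes> det_in R m M"
    unfolding det_in_eq[OF M] using diag_closed[OF M]
    by (intro finsum_rdistr[symmetric]) (auto simp: finite_permutations)
  finally show ?thesis .
qed

text \<open>Reindexing by inverse permutations, which have the same sign.\<close>

lemma det_in_transpose: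
  assumes M: "mat_in m M"
  shows "det_in R m (\<lambda>i j. M j i) = det_in R m M"
proof -
  let ?P = "{\<rho>. \<rho> permutes {..<m}}"
  have Mt: "mat_in m (\<lambda>i j. M j i)" using M by (auto simp: mat_in_def)
  have im: "?P = Hilbert_Choice.inv ` ?P" using image_inverse_permutations[of "{..<m}"] by auto
  have inj: "inj_on Hilbert_Choice.inv ?P"
    by (intro inj_onI) (metis mem_Collect_eq permutes_inv_inv)
  have eq: "sgn_in (Hilbert_Choice.inv \<tau>) \<otimes> (\<Otimes>i\<in>{..<m}. M (Hilbert_Choice.inv \<tau> i) i) =
      sgn_in \<tau> \<otimes> (\<Otimes>i\<in>{..<m}. M i (\<tau> i))" if "\<tau> \<in> ?P" for \<tau>
  proof -
    have \<tau>: "\<tau> permutes {..<m}" using that by simp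
    have "(\<Otimes>i\<in>{..<m}. M (Hilbert_Choice.inv \<tau> (\<tau> i)) (\<tau> i)) = (\<Otimes>i\<in>{..<m}. M (Hilbert_Choice.inv \<tau> i) i)"
      using permutes_in_image[OF \<tau>] permutes_in_image[OF permutes_inv[OF \<tau>]] M
      by (intro finprod_permute[OF \<tau>]) (auto simp: mat_in_def)
    then show ?thesis by (simp add: sgn_in_inv[OF \<tau>] permutes_inverses[OF \<tau>])
  qed
  have cl: "sgn_in (Hilbert_Choice.inv \<tau>) \<otimes> (\<Otimes>i\<in>{..<m}. M (Hilbert_Choice.inv \<tau> i) i) \<in> carrier R" if "\<tau> \<in> ?P" for \<tau>
    using eq[OF that] diag_closed[OF M] that by simp
  have "det_in R m (\<lambda>i j. M j i) = (\<Oplus>\<rho>\<in>Hilbert_Choice.inv ` ?P. sgn_in \<rho> \<otimes> (\<Otimes>i\<in>{..<m}. M (\<rho> i) i))"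
    unfolding det_in_eq[OF Mt] by (subst im) rule
  also have "\<dots> = (\<Oplus>\<tau>\<in>?P. sgn_in (Hilbert_Choice.inv \<tau>) \<otimes> (\<Otimes>i\<in>{..<m}. M (Hilbert_Choice.inv \<tau> i) i))"
    using cl inj by (intro finsum_reindex) auto
  also have "\<dots> = det_in R m M"
    unfolding det_in_eq[OF M] using diag_closed[OF M] eq by (intro finsum_cong2) auto
  finally show ?thesis .
qed

lemma det_in_permute_cols:
  assumes M: "mat_in m M" and \<pi>: "\<pi> permutes {..<m}"
  shows "det_in R m (\<lambda>i j. M i (\<pi> j)) = sgn_in \<pi> \<otimes> det_in R m M"
proof -
  have Mt: "mat_in m (\<lambda>i j. M j i)" using M by (auto simp: mat_in_def)
  have "mat_in m (\<lambda>i j. M i (\<pi> j))"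
    using M permutes_in_image[OF \<pi>] by (auto simp: mat_in_def)
  then show ?thesis
    using det_in_permute_rows[OF Mt \<pi>] det_in_transpose[OF M] det_in_transpose[of m "\<lambda>i j. M i (\<pi> j)"]
    by simp
qed

text \<open>Even permutations are paired with odd ones by composition with the transposition of the
  two rows, and paired terms cancel. Antisymmetry alone would only show that twice the determinant
  vanishes, which says nothing in characteristic 2.\<close>

lemma det_in_equal_rows:
  assumes M: "mat_in m M" and ij: "i < m" "j < m" "i \<noteq> j" and eq: "\<And>k. k < m \<Longrightarrow> M i k = M j k"
  shows "det_in R m M = \<zero>"
proof -
  let ?t = "transpose i j"
  have t: "?t permutes {..<m}" using ij by (intro permutes_swap_id) auto
  have pt: "permutation ?t" "\<not> evenperm ?t" using ij by (auto simp: permutation_swap_id evenperm_swap)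
  define E where "E = {\<rho>. \<rho> permutes {..<m} \<and> evenperm \<rho>}"
  define D where "D = {\<rho>. \<rho> permutes {..<m} \<and> \<not> evenperm \<rho>}"
  have perm: "permutation \<rho>" if "\<rho> permutes {..<m}" for \<rho> using that permutation_permutes by blast
  have fin: "finite E" "finite D"
    unfolding E_def D_def by (rule finite_subset[OF _ finite_permutations[of "{..<m}"]]; auto)+
  have U: "{\<rho>. \<rho> permutes {..<m}} = E \<union> D" "E \<inter> D = {}" by (auto simp: E_def D_def)
  define P where "P = (\<lambda>\<rho>. \<Otimes>i\<in>{..<m}. M i (\<rho> i))"
  have P: "P \<rho> \<in> carrier R" if "\<rho> \<in> E \<or> \<rho> \<in> D" for \<rho>
    unfolding P_def by (rule diag_closed[OF M]) (use that in \<open>auto simp: E_def D_def\<close>)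
  have P': "(\<Otimes>i\<in>{..<m}. M i (\<rho> i)) = P \<rho>" for \<rho> by (simp add: P_def)
  have D: "D = (\<lambda>\<rho>. \<rho> \<circ> ?t) ` E"
  proof (intro equalityI subsetI)
    fix \<rho> assume s: "\<rho> \<in> D"
    then have "\<rho> \<circ> ?t \<in> E"
      using t pt perm by (auto simp: E_def D_def evenperm_comp intro: permutes_compose)
    moreover have "\<rho> = (\<rho> \<circ> ?t) \<circ> ?t" by (auto simp: fun_eq_iff)
    ultimately show "\<rho> \<in> (\<lambda>\<rho>. \<rho> \<circ> ?t) ` E" by blast
  qed (use t pt perm in \<open>auto simp: E_def D_def evenperm_comp intro: permutes_compose\<close>)
  have inj: "inj_on (\<lambda>\<rho>. \<rho> \<circ> ?t) E"
    by (rule inj_on_inverseI[of _ "\<lambda>\<rho>. \<rho> \<circ> ?t"]) (auto simp: fun_eq_iff)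
  have Pt: "P (\<rho> \<circ> ?t) = P \<rho>" if "\<rho> \<in> E" for \<rho>
  proof -
    have \<rho>: "\<rho> permutes {..<m}" using that by (simp add: E_def)
    have \<rho>c: "\<rho> k < m" if "k < m" for k using permutes_in_image[OF \<rho>, of k] that by auto
    have "(\<Otimes>k\<in>{..<m}. M (?t (?t k)) (\<rho> (?t k))) = (\<Otimes>k\<in>{..<m}. M (?t k) (\<rho> k))"
      using M \<rho>c permutes_in_image[OF t]
      by (intro finprod_permute[OF t, of "\<lambda>k. M (?t k) (\<rho> k)"]) (auto simp: mat_in_def)
    also have "\<dots> = P \<rho>"
      unfolding P_def using \<rho>c eq ij mat_in_perm[OF M \<rho>]
      by (intro finprod_cong2) (auto simp: transpose_def)
    finally show ?thesis by (simp add: P_def)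
  qed
  have "det_in R m M = (\<Oplus>\<rho>\<in>E. sgn_in \<rho> \<otimes> P \<rho>) \<oplus> (\<Oplus>\<rho>\<in>D. sgn_in \<rho> \<otimes> P \<rho>)"
    unfolding det_in_eq[OF M] P' U using fin U P
    by (intro finsum_Un_disjoint) auto
  also have "(\<Oplus>\<rho>\<in>D. sgn_in \<rho> \<otimes> P \<rho>) = (\<Oplus>\<rho>\<in>E. sgn_in (\<rho> \<circ> ?t) \<otimes> P (\<rho> \<circ> ?t))"
    unfolding D using inj P Pt by (intro finsum_reindex) auto
  also have "\<dots> = (\<Oplus>\<rho>\<in>E. \<ominus> (sgn_in \<rho> \<otimes> P \<rho>))"
    using P Pt pt perm by (intro finsum_cong2) (auto simp: E_def sgn_in_def evenperm_comp l_minus)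
  also have "(\<Oplus>\<rho>\<in>E. sgn_in \<rho> \<otimes> P \<rho>) \<oplus> \<dots> = (\<Oplus>\<rho>\<in>E. sgn_in \<rho> \<otimes> P \<rho> \<oplus> \<ominus> (sgn_in \<rho> \<otimes> P \<rho>))"
    using P by (intro finsum_addf[symmetric]) auto
  also have "\<dots> = (\<Oplus>\<rho>\<in>E. \<zero>)"
    using P by (intro finsum_cong2) (auto simp: r_neg)
  finally show ?thesis by simp
qed

section \<open>Multilinearity in the rows\<close>

lemma diag_update:
  assumes M: "mat_in m M" and i: "i < m" and v: "\<And>j. j < m \<Longrightarrow> v j \<in> carrier R" and \<rho>: "\<rho> permutes {..<m}"
  shows "(\<Otimes>k\<in>{..<m}. (M(i := v)) k (\<rho> k)) = v (\<rho> i) \<otimes> (\<Otimes>k\<in>{..<m} - {i}. M k (\<rho> k))"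
proof -
  have \<rho>i: "\<rho> k < m" if "k < m" for k using permutes_in_image[OF \<rho>, of k] that by auto
  have "(\<Otimes>k\<in>insert i ({..<m} - {i}). (M(i := v)) k (\<rho> k)) =
    (M(i := v)) i (\<rho> i) \<otimes> (\<Otimes>k\<in>{..<m} - {i}. (M(i := v)) k (\<rho> k))"
    using i v \<rho>i mat_in_perm[OF M \<rho>] by (intro finprod_insert) auto
  also have "(\<Otimes>k\<in>{..<m} - {i}. (M(i := v)) k (\<rho> k)) = (\<Otimes>k\<in>{..<m} - {i}. M k (\<rho> k))"
    using mat_in_perm[OF M \<rho>] by (intro finprod_cong2) auto
  finally show ?thesis using i by (simp add: insert_absorb)
qed

lemma mat_in_update:
  "mat_in m M \<Longrightarrow> (\<And>j. j < m \<Longrightarrow> v j \<in> carrier R) \<Longrightarrow> mat_in m (M(i := v))"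
  by (auto simp: mat_in_def)

lemma det_in_row_add:
  assumes M: "mat_in m M" and i: "i < m"
    and v: "\<And>j. j < m \<Longrightarrow> v j \<in> carrier R" and w: "\<And>j. j < m \<Longrightarrow> w j \<in> carrier R"
    and a: "a \<in> carrier R"
  shows "det_in R m (M(i := (\<lambda>j. a \<otimes> v j \<oplus> w j))) =
    a \<otimes> det_in R m (M(i := v)) \<oplus> det_in R m (M(i := w))"
proof -
  let ?P = "{\<rho>. \<rho> permutes {..<m}}"
  let ?u = "\<lambda>j. a \<otimes> v j \<oplus> w j"
  have u: "?u j \<in> carrier R" if "j < m" for j using v w a that by auto
  have Q: "(\<Otimes>k\<in>{..<m} - {i}. M k (\<rho> k)) \<in> carrier R" if "\<rho> \<in> ?P" for \<rho>
    using that mat_in_perm[OF M] by (intro finprod_closed) auto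
  have \<rho>i: "\<rho> i < m" if "\<rho> \<in> ?P" for \<rho> using permutes_in_image[of \<rho> "{..<m}" i] that i by auto
  have cl: "sgn_in \<rho> \<otimes> (x (\<rho> i) \<otimes> (\<Otimes>k\<in>{..<m} - {i}. M k (\<rho> k))) \<in> carrier R"
    if "\<rho> \<in> ?P" "\<And>j. j < m \<Longrightarrow> x j \<in> carrier R" for \<rho> x
    using Q \<rho>i that by auto
  have e: "det_in R m (M(i := x)) =
      (\<Oplus>\<rho>\<in>?P. sgn_in \<rho> \<otimes> (x (\<rho> i) \<otimes> (\<Otimes>k\<in>{..<m} - {i}. M k (\<rho> k))))"
    if x: "\<And>j. j < m \<Longrightarrow> x j \<in> carrier R" for x
  proof -
    have X: "mat_in m (M(i := x))" by (rule mat_in_update[OF M]) (use x in auto)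
    show ?thesis unfolding det_in_eq[OF X]
    proof (rule finsum_cong2)
      fix \<rho> assume s: "\<rho> \<in> ?P"
      show "sgn_in \<rho> \<otimes> (x (\<rho> i) \<otimes> (\<Otimes>k\<in>{..<m} - {i}. M k (\<rho> k))) \<in> carrier R"
        by (rule cl[OF s x])
      show "sgn_in \<rho> \<otimes> (\<Otimes>k\<in>{..<m}. (M(i := x)) k (\<rho> k)) =
        sgn_in \<rho> \<otimes> (x (\<rho> i) \<otimes> (\<Otimes>k\<in>{..<m} - {i}. M k (\<rho> k)))"
        using s x by (subst diag_update[OF M i]) auto
    qed
  qed
  have eu: "det_in R m (M(i := ?u)) =
      (\<Oplus>\<rho>\<in>?P. sgn_in \<rho> \<otimes> (?u (\<rho> i) \<otimes> (\<Otimes>k\<in>{..<m} - {i}. M k (\<rho> k))))"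
    by (rule e) (rule u)
  have ev: "det_in R m (M(i := v)) =
      (\<Oplus>\<rho>\<in>?P. sgn_in \<rho> \<otimes> (v (\<rho> i) \<otimes> (\<Otimes>k\<in>{..<m} - {i}. M k (\<rho> k))))"
    by (rule e) (rule v)
  have ew: "det_in R m (M(i := w)) =
      (\<Oplus>\<rho>\<in>?P. sgn_in \<rho> \<otimes> (w (\<rho> i) \<otimes> (\<Otimes>k\<in>{..<m} - {i}. M k (\<rho> k))))"
    by (rule e) (rule w)
  have "det_in R m (M(i := ?u)) =
    (\<Oplus>\<rho>\<in>?P. a \<otimes> (sgn_in \<rho> \<otimes> (v (\<rho> i) \<otimes> (\<Otimes>k\<in>{..<m} - {i}. M k (\<rho> k)))) \<oplus>
       sgn_in \<rho> \<otimes> (w (\<rho> i) \<otimes> (\<Otimes>k\<in>{..<m} - {i}. M k (\<rho> k))))"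
    unfolding eu
  proof (rule finsum_cong2)
    fix \<rho> assume s: "\<rho> \<in> ?P"
    show "a \<otimes> (sgn_in \<rho> \<otimes> (v (\<rho> i) \<otimes> (\<Otimes>k\<in>{..<m} - {i}. M k (\<rho> k)))) \<oplus>
       sgn_in \<rho> \<otimes> (w (\<rho> i) \<otimes> (\<Otimes>k\<in>{..<m} - {i}. M k (\<rho> k))) \<in> carrier R"
      using cl[OF s] v w a by auto
    show "sgn_in \<rho> \<otimes> ((a \<otimes> v (\<rho> i) \<oplus> w (\<rho> i)) \<otimes> (\<Otimes>k\<in>{..<m} - {i}. M k (\<rho> k))) =
      a \<otimes> (sgn_in \<rho> \<otimes> (v (\<rho> i) \<otimes> (\<Otimes>k\<in>{..<m} - {i}. M k (\<rho> k)))) \<oplus>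
       sgn_in \<rho> \<otimes> (w (\<rho> i) \<otimes> (\<Otimes>k\<in>{..<m} - {i}. M k (\<rho> k)))"
      using Q[OF s] \<rho>i[OF s] v w a by (simp add: l_distr r_distr m_ac)
  qed
  also have "\<dots> = (\<Oplus>\<rho>\<in>?P. a \<otimes> (sgn_in \<rho> \<otimes> (v (\<rho> i) \<otimes> (\<Otimes>k\<in>{..<m} - {i}. M k (\<rho> k))))) \<oplus>
      (\<Oplus>\<rho>\<in>?P. sgn_in \<rho> \<otimes> (w (\<rho> i) \<otimes> (\<Otimes>k\<in>{..<m} - {i}. M k (\<rho> k))))"
    using cl v w a by (intro finsum_addf) auto
  also have "(\<Oplus>\<rho>\<in>?P. a \<otimes> (sgn_in \<rho> \<otimes> (v (\<rho> i) \<otimes> (\<Otimes>k\<in>{..<m} - {i}. M k (\<rho> k))))) =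
      a \<otimes> (\<Oplus>\<rho>\<in>?P. sgn_in \<rho> \<otimes> (v (\<rho> i) \<otimes> (\<Otimes>k\<in>{..<m} - {i}. M k (\<rho> k))))"
    using cl v a by (intro finsum_rdistr[symmetric]) (auto simp: finite_permutations)
  finally show ?thesis unfolding ev ew .
qed

lemma det_in_row_zero:
  assumes M: "mat_in m M" and i: "i < m"
  shows "det_in R m (M(i := (\<lambda>_. \<zero>))) = \<zero>"
proof -
  let ?P = "{\<rho>. \<rho> permutes {..<m}}"
  have Z: "mat_in m (M(i := (\<lambda>_. \<zero>)))" by (rule mat_in_update[OF M]) simp
  have "det_in R m (M(i := (\<lambda>_. \<zero>))) = (\<Oplus>\<rho>\<in>?P. \<zero>)"
    unfolding det_in_eq[OF Z]
  proof (rule finsum_cong2)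
    fix \<rho> assume "\<rho> \<in> ?P"
    then have s: "\<rho> permutes {..<m}" by simp
    have "(\<Otimes>k\<in>{..<m} - {i}. M k (\<rho> k)) \<in> carrier R"
      using mat_in_perm[OF M s] by (intro finprod_closed) auto
    then show "sgn_in \<rho> \<otimes> (\<Otimes>k\<in>{..<m}. (M(i := (\<lambda>_. \<zero>))) k (\<rho> k)) = \<zero>"
      by (subst diag_update[OF M i _ s]) auto
  qed auto
  then show ?thesis by simp
qed

lemma det_in_row_finsum:
  assumes M: "mat_in m M" and i: "i < m" and K: "finite K"
    and v: "\<And>k j. k \<in> K \<Longrightarrow> j < m \<Longrightarrow> v k j \<in> carrier R" and c: "\<And>k. k \<in> K \<Longrightarrow> c k \<in> carrier R"
  shows "det_in R m (M(i := (\<lambda>j. \<Oplus>k\<in>K. c k \<otimes> v k j))) = (\<Oplus>k\<in>K. c k \<otimes> det_in R m (M(i := v k)))"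
  using K v c
proof (induction K rule: finite_induct)
  case empty then show ?case using det_in_row_zero[OF M i] by (simp add: fun_upd_def)
next
  case (insert k K)
  let ?w = "\<lambda>j. \<Oplus>k\<in>K. c k \<otimes> v k j"
  have w: "?w j \<in> carrier R" if "j < m" for j using that insert.prems by (intro finsum_closed) auto
  have dc: "det_in R m (M(i := v l)) \<in> carrier R" if "l \<in> insert k K" for l
    using that insert.prems by (intro det_in_closed mat_in_update[OF M]) auto
  have "det_in R m (M(i := (\<lambda>j. \<Oplus>k\<in>insert k K. c k \<otimes> v k j))) =
      det_in R m (M(i := (\<lambda>j. c k \<otimes> v k j \<oplus> ?w j)))"
    using insert w by (intro det_in_cong mat_in_update[OF M]) (auto simp: Pi_iff)
  also have "\<dots> = c k \<otimes> det_in R m (M(i := v k)) \<oplus> det_in R m (M(i := ?w))"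
    using insert.prems w by (intro det_in_row_add[OF M i]) auto
  also have "det_in R m (M(i := ?w)) = (\<Oplus>k\<in>K. c k \<otimes> det_in R m (M(i := v k)))"
    by (rule insert.IH) (use insert.prems in auto)
  also have "c k \<otimes> det_in R m (M(i := v k)) \<oplus> \<dots> =
      (\<Oplus>k\<in>insert k K. c k \<otimes> det_in R m (M(i := v k)))"
    using insert.hyps insert.prems dc by (intro finsum_insert[symmetric]) auto
  finally show ?case .
qed

text \<open>Every row is a combination of the \<open>n\<close> rows \<open>v k\<close>. Expanding
  all rows leaves determinants whose \<open>m\<close> rows are chosen among these, and as
  \<open>m > n\<close> two of them coincide.\<close>

lemma det_in_low_rank:
  assumes nm: "n < m" and c: "\<And>i k. i < m \<Longrightarrow> k < n \<Longrightarrow> c i k \<in> carrier R"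
    and v: "\<And>k j. k < n \<Longrightarrow> j < m \<Longrightarrow> v k j \<in> carrier R"
  shows "det_in R m (\<lambda>i j. \<Oplus>k\<in>{..<n}. c i k \<otimes> v k j) = \<zero>"
proof -
  \<comment> \<open>Induction on the number \<open>t\<close> of rows not yet expanded. The others
    are rows \<open>v (p i)\<close>, and the choice \<open>p\<close> has to vary in the
    induction.\<close>
  have claim: "det_in R m (\<lambda>i j. if i < t then \<Oplus>k\<in>{..<n}. c i k \<otimes> v k j else v (p i) j) = \<zero>"
    if "t \<le> m" "\<And>i. i < m \<Longrightarrow> p i < n" for t p
    using that
  proof (induction t arbitrary: p)
    case 0
    have "\<not> inj_on p {..<m}"
    proof
      assume "inj_on p {..<m}"
      then have "card {..<m} \<le> card {..<n}" using 0 by (intro card_inj_on_le[of p]) auto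
      then show False using nm by simp
    qed
    then obtain i j where ij: "i < m" "j < m" "i \<noteq> j" "p i = p j" by (auto simp: inj_on_def)
    have "mat_in m (\<lambda>i j. v (p i) j)" using 0 v by (auto simp: mat_in_def)
    then show ?case using det_in_equal_rows[of m "\<lambda>i j. v (p i) j" i j] ij by simp
  next
    case (Suc t)
    define M where "M = (\<lambda>i j. if i < t then \<Oplus>k\<in>{..<n}. c i k \<otimes> v k j else v (p i) j)"
    have M: "mat_in m M" using Suc.prems c v
      by (auto simp: mat_in_def M_def Pi_iff intro!: finsum_closed)
    have M': "mat_in m (M(t := (\<lambda>j. \<Oplus>k\<in>{..<n}. c t k \<otimes> v k j)))"
      using Suc.prems c v by (intro mat_in_update[OF M] finsum_closed) auto
    have "det_in R m (\<lambda>i j. if i < Suc t then \<Oplus>k\<in>{..<n}. c i k \<otimes> v k j else v (p i) j) =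
      det_in R m (M(t := (\<lambda>j. \<Oplus>k\<in>{..<n}. c t k \<otimes> v k j)))"
      by (rule det_in_cong[OF M']) (auto simp: M_def less_Suc_eq)
    also have "\<dots> = (\<Oplus>k\<in>{..<n}. c t k \<otimes> det_in R m (M(t := v k)))"
      using Suc.prems c v by (intro det_in_row_finsum[OF M]) auto
    also have "\<dots> = (\<Oplus>k\<in>{..<n}. \<zero>)"
    proof (rule finsum_cong2)
      fix k assume k: "k \<in> {..<n}"
      have "M(t := v k) = (\<lambda>i j. if i < t then \<Oplus>k\<in>{..<n}. c i k \<otimes> v k j else v ((p(t := k)) i) j)"
        by (auto simp: M_def fun_eq_iff)
      then have "det_in R m (M(t := v k)) = \<zero>"
        using Suc.IH[of "p(t := k)"] Suc.prems k by auto
      then show "c t k \<otimes> det_in R m (M(t := v k)) = \<zero>" using c k Suc.prems by simp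
    qed simp
    finally show ?case by simp
  qed
  show ?thesis
  \<comment> \<open>For \<open>n = 0\<close> there is no choice \<open>p\<close> to start from, but
    then all rows are empty sums.\<close>
  proof (cases "n = 0")
    case True
    then have "0 < m" using nm by simp
    have "mat_in m (\<lambda>_ _. \<zero>)" by (simp add: mat_in_def)
    then show ?thesis using det_in_row_zero[of m "\<lambda>_ _. \<zero>" 0] True \<open>0 < m\<close> by (simp add: fun_upd_def)
  next
    case False
    have cl: "mat_in m (\<lambda>i j. \<Oplus>k\<in>{..<n}. c i k \<otimes> v k j)"
      using c v by (auto simp: mat_in_def Pi_iff intro!: finsum_closed)
    have "det_in R m (\<lambda>i j. if i < m then \<Oplus>k\<in>{..<n}. c i k \<otimes> v k j else v 0 j) = \<zero>"
      using claim[of m "\<lambda>_. 0"] False by simp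
    moreover have "det_in R m (\<lambda>i j. if i < m then \<Oplus>k\<in>{..<n}. c i k \<otimes> v k j else v 0 j) =
      det_in R m (\<lambda>i j. \<Oplus>k\<in>{..<n}. c i k \<otimes> v k j)"
      by (rule det_in_cong[OF cl]) simp
    ultimately show ?thesis by simp
  qed
qed

section \<open>Expansion along a row\<close>

definition unit_row :: "nat \<Rightarrow> nat \<Rightarrow> 'a" where
  "unit_row s = (\<lambda>j. if j = s then \<one> else \<zero>)"

lemma unit_row_closed [simp]: "unit_row s j \<in> carrier R"
  by (simp add: unit_row_def)

text \<open>Cofactors are written as determinants with a unit vector as row, so that neither signs
  nor deleted columns have to be handled.\<close>

lemma det_in_expand_row:
  assumes M: "mat_in m M" and i: "i < m"
  shows "det_in R m M = (\<Oplus>s\<in>{..<m}. M i s \<otimes> det_in R m (M(i := unit_row s)))"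
proof -
  have row: "(\<Oplus>s\<in>{..<m}. M i s \<otimes> unit_row s j) = M i j" if j: "j < m" for j
  proof -
    have "(\<Oplus>s\<in>{..<m}. M i s \<otimes> unit_row s j) = (\<Oplus>s\<in>{..<m}. if j = s then M i s else \<zero>)"
      using mat_inD[OF M i] by (intro finsum_cong2) (auto simp: unit_row_def)
    then show ?thesis using j mat_inD[OF M i] add.finprod_singleton[of j "{..<m}" "M i"] by auto
  qed
  have "det_in R m M = det_in R m (M(i := (\<lambda>j. \<Oplus>s\<in>{..<m}. M i s \<otimes> unit_row s j)))"
    by (rule det_in_cong[symmetric, OF M]) (auto simp: row)
  also have "\<dots> = (\<Oplus>s\<in>{..<m}. M i s \<otimes> det_in R m (M(i := unit_row s)))"
    using mat_inD[OF M i] by (intro det_in_row_finsum[OF M i]) auto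
  finally show ?thesis .
qed

text \<open>In the Leibniz sum only permutations fixing \<open>m\<close> contribute, and these are
  the permutations of \<open>{..<m}\<close>.\<close>

lemma det_in_unit_last_row:
  assumes M: "mat_in (Suc m) M"
  shows "det_in R (Suc m) (M(m := unit_row m)) = det_in R m M"
proof -
  let ?P = "{\<rho>. \<rho> permutes {..<Suc m}}" and ?Q = "{\<rho>. \<rho> permutes {..<m}}"
  have M': "mat_in m M" using M by (simp add: mat_in_def)
  have U: "mat_in (Suc m) (M(m := unit_row m))" by (rule mat_in_update[OF M]) simp
  have sub: "?Q \<subseteq> ?P" using permutes_subset[of _ "{..<m}" "{..<Suc m}"] by auto
  have d: "{..<Suc m} - {m} = {..<m}" by auto
  have eq: "(\<Otimes>k\<in>{..<Suc m}. (M(m := unit_row m)) k (\<rho> k)) = unit_row m (\<rho> m) \<otimes> (\<Otimes>k\<in>{..<m}. M k (\<rho> k))"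
    if "\<rho> \<in> ?P" for \<rho>
    using diag_update[OF M, of m "unit_row m" \<rho>] that by (simp add: d)
  have Qc: "(\<Otimes>k\<in>{..<m}. M k (\<rho> k)) \<in> carrier R" if "\<rho> \<in> ?P" for \<rho>
    using that mat_in_perm[OF M] by (intro finprod_closed) auto
  have notin: "\<rho> m \<noteq> m" if "\<rho> \<in> ?P - ?Q" for \<rho>
  proof
    assume m: "\<rho> m = m"
    have "\<rho> permutes {..<m}"
    proof (rule permutes_superset)
      show "\<rho> permutes {..<Suc m}" using that by simp
      fix x assume "x \<in> {..<Suc m} - {..<m}"
      then have "x = m" by auto
      then show "\<rho> x = x" using m by simp
    qed
    then show False using that by simp
  qed
  have fix_m: "\<rho> m = m" if "\<rho> \<in> ?Q" for \<rho>
  proof (rule permutes_not_in)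
    show "\<rho> permutes {..<m}" using that by simp
  qed simp
  show ?thesis
    unfolding det_in_eq[OF U] det_in_eq[OF M']
  proof (rule add.finprod_mono_neutral_cong_right)
    show "finite ?P" by (simp add: finite_permutations)
    fix \<rho>
    { assume s: "\<rho> \<in> ?P - ?Q"
      then have "(\<Otimes>k\<in>{..<Suc m}. (M(m := unit_row m)) k (\<rho> k)) = \<zero>"
        using eq notin[OF s] Qc by (auto simp: unit_row_def)
      then show "sgn_in \<rho> \<otimes> (\<Otimes>k\<in>{..<Suc m}. (M(m := unit_row m)) k (\<rho> k)) = \<zero>" by simp }
    { assume "\<rho> \<in> ?Q"
      then show "sgn_in \<rho> \<otimes> (\<Otimes>k\<in>{..<Suc m}. (M(m := unit_row m)) k (\<rho> k)) =
        sgn_in \<rho> \<otimes> (\<Otimes>k\<in>{..<m}. M k (\<rho> k))"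
        using eq fix_m Qc sub by (auto simp: unit_row_def) }
  qed (use sub diag_closed[OF U] in auto)
qed

end

lemma (in ring_hom_cring) hom_det_in:
  assumes M: "R.mat_in m M"
  shows "h (det_in R m M) = det_in S m (\<lambda>i j. h (M i j))"
proof -
  let ?P = "{\<rho>. \<rho> permutes {..<m}}"
  have M': "S.mat_in m (\<lambda>i j. h (M i j))" using M by (auto simp: R.mat_in_def S.mat_in_def)
  have sg: "h (R.sgn_in \<rho>) = S.sgn_in \<rho>" for \<rho> by (simp add: R.sgn_in_def S.sgn_in_def)
  have pr: "h (\<Otimes>\<^bsub>R\<^esub>i\<in>{..<m}. M i (\<rho> i)) = (\<Otimes>\<^bsub>S\<^esub>i\<in>{..<m}. h (M i (\<rho> i)))" if "\<rho> permutes {..<m}" for \<rho>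
    using R.mat_in_perm[OF M that] by (subst hom_finprod) (auto simp: o_def)
  have "h (det_in R m M) = (\<Oplus>\<^bsub>S\<^esub>\<rho>\<in>?P. (h \<circ> (\<lambda>\<rho>. R.sgn_in \<rho> \<otimes>\<^bsub>R\<^esub> (\<Otimes>\<^bsub>R\<^esub>i\<in>{..<m}. M i (\<rho> i)))) \<rho>)"
    unfolding R.det_in_eq[OF M] using R.diag_closed[OF M] by (intro hom_finsum) auto
  also have "\<dots> = det_in S m (\<lambda>i j. h (M i j))"
    unfolding S.det_in_eq[OF M'] using R.diag_closed[OF M] S.diag_closed[OF M'] pr
    by (intro S.finsum_cong2) (auto simp: sg)
  finally show ?thesis .
qed

section \<open>Minors of Hankel matrices\<close>

context cring
begin

text \<open>Minors are defined with increasing indices; this brings an arbitrary injective choice of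
  indices into increasing order.\<close>

lemma exists_sorting_permutation:
  fixes r :: "nat \<Rightarrow> nat"
  assumes "inj_on r {..<m}"
  obtains \<pi> where "\<pi> permutes {..<m}" "strict_mono_on {..<m} (r \<circ> \<pi>)"
proof -
  let ?X = "r ` {..<m}"
  let ?xs = "sorted_list_of_set ?X"
  have len: "length ?xs = m" using assms by (simp add: card_image)
  have sm: "?xs ! i < ?xs ! j" if "i < j" "j < m" for i j
    using sorted_wrt_nth_less[OF strict_sorted_list_of_set[of ?X], of i j] that len by simp
  define \<pi> where "\<pi> = (\<lambda>i. if i < m then inv_into {..<m} r (?xs ! i) else i)"
  have mem: "?xs ! i \<in> ?X" if "i < m" for i using that len nth_mem[of i ?xs] by simp
  have r\<pi>: "r (\<pi> i) = ?xs ! i" if "i < m" for i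
    using f_inv_into_f[OF mem[OF that]] that by (simp add: \<pi>_def)
  have "\<pi> i < m" if "i < m" for i using inv_into_into[OF mem[OF that]] that by (simp add: \<pi>_def)
  moreover have "inj_on \<pi> {..<m}"
  proof (rule inj_onI)
    fix i j assume ij: "i \<in> {..<m}" "j \<in> {..<m}" "\<pi> i = \<pi> j"
    then have "?xs ! i = ?xs ! j" using r\<pi> by (metis lessThan_iff)
    then show "i = j" using sm[of i j] sm[of j i] ij by (cases i j rule: linorder_cases) auto
  qed
  ultimately have "bij_betw \<pi> {..<m} {..<m}"
    by (simp add: bij_betw_def endo_inj_surj image_subset_iff)
  then have "\<pi> permutes {..<m}" by (rule bij_imp_permutes) (simp add: \<pi>_def)
  moreover have "strict_mono_on {..<m} (r \<circ> \<pi>)"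
    by (rule strict_mono_onI) (simp add: r\<pi> sm)
  ultimately show ?thesis using that by blast
qed

text \<open>A repeated index gives two equal rows, and distinct indices are sorted at the cost of a
  sign. Columns are reduced to rows by transposition, which only exchanges \<open>r\<close> and
  \<open>c\<close> in a Hankel minor.\<close>

lemma minors_vanish_imp_all:
  assumes f: "f \<in> UNIV \<rightarrow> carrier R" and van: "minors_vanish R m (hankel f)"
  shows "det_in R m (\<lambda>i j. f (r i + c j)) = \<zero>"
proof -
  have mat: "mat_in m (\<lambda>i j. f (r i + c j))" for r c :: "nat \<Rightarrow> nat"
    using f by (auto simp: mat_in_def)
  have inv: "x = \<zero>" if "sgn_in \<pi> \<otimes> x = \<zero>" "x \<in> carrier R" for x \<pi>
  proof -
    have "x = (sgn_in \<pi> \<otimes> sgn_in \<pi>) \<otimes> x" using that by (simp add: sgn_in_square)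
    also have "\<dots> = sgn_in \<pi> \<otimes> (sgn_in \<pi> \<otimes> x)" using that(2) by (intro m_assoc) auto
    finally show ?thesis using that by simp
  qed
  have step: "det_in R m (\<lambda>i j. f (r i + c j)) = \<zero>"
    if "\<And>r'. strict_mono_on {..<m} r' \<Longrightarrow> det_in R m (\<lambda>i j. f (r' i + c j)) = \<zero>" for r c :: "nat \<Rightarrow> nat"
  proof (cases "inj_on r {..<m}")
    case True
    then obtain \<pi> where \<pi>: "\<pi> permutes {..<m}" "strict_mono_on {..<m} (r \<circ> \<pi>)"
      using exists_sorting_permutation by blast
    have "sgn_in \<pi> \<otimes> det_in R m (\<lambda>i j. f (r i + c j)) = \<zero>"
      using det_in_permute_rows[OF mat \<pi>(1), of r c] that[OF \<pi>(2)] by simp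
    then show ?thesis using inv det_in_closed[OF mat] by blast
  next
    case False
    then obtain i j where "i < m" "j < m" "i \<noteq> j" "r i = r j" by (auto simp: inj_on_def)
    then show ?thesis using det_in_equal_rows[OF mat[of r c], of i j] by simp
  qed
  have "det_in R m (\<lambda>i j. f (r' i + c j)) = \<zero>" if r': "strict_mono_on {..<m} r'" for r'
  proof -
    have "det_in R m (\<lambda>i j. f (c i + r' j)) = \<zero>"
    proof (rule step)
      fix c' :: "nat \<Rightarrow> nat" assume "strict_mono_on {..<m} c'"
      then show "det_in R m (\<lambda>i j. f (c' i + r' j)) = \<zero>"
        using van r' by (auto simp: minors_vanish_def hankel_def)
    qed
    then show ?thesis using det_in_transpose[OF mat[of c r']] by (simp add: add.commute)
  qed
  then show ?thesis by (rule step)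
qed

lemma minors_vanishI:
  "(\<And>r c. det_in R m (\<lambda>i j. f (r i + c j)) = \<zero>) \<Longrightarrow> minors_vanish R m (hankel f)"
  by (simp add: minors_vanish_def hankel_def)

text \<open>Expansion along the last row: after moving column \<open>s\<close> to the end, the
  cofactor is a minor of size \<open>m\<close> up to sign.\<close>

lemma minors_vanish_Suc:
  assumes f: "f \<in> UNIV \<rightarrow> carrier R" and van: "minors_vanish R m (hankel f)"
  shows "minors_vanish R (Suc m) (hankel f)"
proof (rule minors_vanishI)
  fix r c :: "nat \<Rightarrow> nat"
  let ?M = "\<lambda>i j. f (r i + c j)"
  have M: "mat_in (Suc m) ?M" using f by (auto simp: mat_in_def)
  have 0: "det_in R (Suc m) (?M(m := unit_row s)) = \<zero>" if s: "s < Suc m" for s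
  proof -
    let ?t = "transpose s m"
    have t: "?t permutes {..<Suc m}" using s by (intro permutes_swap_id) auto
    let ?N = "\<lambda>i j. f (r i + c (?t j))"
    have N: "mat_in (Suc m) ?N" using f by (auto simp: mat_in_def)
    have N': "mat_in (Suc m) (?N(m := unit_row m))" by (rule mat_in_update[OF N]) simp
    have "det_in R (Suc m) (?N(m := unit_row m)) = det_in R m ?N" by (rule det_in_unit_last_row[OF N])
    also have "\<dots> = \<zero>" using minors_vanish_imp_all[OF f van, of r "\<lambda>j. c (?t j)"] .
    finally have z: "det_in R (Suc m) (?N(m := unit_row m)) = \<zero>" .
    have "?M(m := unit_row s) = (\<lambda>i j. (?N(m := unit_row m)) i (?t j))"
      by (auto simp: fun_eq_iff unit_row_def transpose_def)
    then have "det_in R (Suc m) (?M(m := unit_row s)) = det_in R (Suc m) (\<lambda>i j. (?N(m := unit_row m)) i (?t j))"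
      by (rule arg_cong)
    also have "\<dots> = sgn_in ?t \<otimes> det_in R (Suc m) (?N(m := unit_row m))"
      by (rule det_in_permute_cols[OF N' t])
    also have "\<dots> = \<zero>" unfolding z by simp
    finally show ?thesis .
  qed
  have "det_in R (Suc m) ?M = (\<Oplus>s\<in>{..<Suc m}. f (r m + c s) \<otimes> det_in R (Suc m) (?M(m := unit_row s)))"
    by (rule det_in_expand_row[OF M]) simp
  also have "\<dots> = (\<Oplus>s\<in>{..<Suc m}. \<zero>)"
    using 0 f by (intro finsum_cong2) (auto simp: Pi_iff)
  finally show "det_in R (Suc m) ?M = \<zero>" by simp
qed

lemma minors_vanish_mono:
  assumes f: "f \<in> UNIV \<rightarrow> carrier R" and van: "minors_vanish R m (hankel f)" and mn: "m \<le> n"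
  shows "minors_vanish R n (hankel f)"
  using mn by (induction n rule: dec_induct) (use van minors_vanish_Suc[OF f] in auto)

end

section \<open>Submodules of sequences\<close>

text \<open>Submodules of the module of all sequences. A finite power of \<open>R\<close> consists
  of the sequences vanishing from some index on, so vectors of all lengths share one type.\<close>

definition vec_closed :: "('a, 'm) ring_scheme \<Rightarrow> (nat \<Rightarrow> 'a) set \<Rightarrow> bool" where
  "vec_closed R N \<longleftrightarrow> N \<subseteq> UNIV \<rightarrow> carrier R \<and> (\<lambda>_. \<zero>\<^bsub>R\<^esub>) \<in> N \<and>
     (\<forall>v\<in>N. \<forall>w\<in>N. (\<lambda>i. v i \<oplus>\<^bsub>R\<^esub> w i) \<in> N) \<and> (\<forall>a\<in>carrier R. \<forall>v\<in>N. (\<lambda>i. a \<otimes>\<^bsub>R\<^esub> v i) \<in> N)"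

context cring
begin

lemma vec_closedD:
  assumes "vec_closed R N"
  shows "v \<in> N \<Longrightarrow> v i \<in> carrier R" "(\<lambda>_. \<zero>) \<in> N"
    "v \<in> N \<Longrightarrow> w \<in> N \<Longrightarrow> (\<lambda>i. v i \<oplus> w i) \<in> N"
    "a \<in> carrier R \<Longrightarrow> v \<in> N \<Longrightarrow> (\<lambda>i. a \<otimes> v i) \<in> N"
  using assms by (auto simp: vec_closed_def)

lemma vec_closed_minus:
  assumes N: "vec_closed R N" and "v \<in> N" "w \<in> N"
  shows "(\<lambda>i. v i \<ominus> w i) \<in> N"
proof -
  have "(\<lambda>i. v i \<oplus> \<ominus> \<one> \<otimes> w i) \<in> N" using vec_closedD[OF N] assms by auto
  moreover have "v i \<oplus> \<ominus> \<one> \<otimes> w i = v i \<ominus> w i" for i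
    using vec_closedD(1)[OF N] assms by (simp add: a_minus_def l_minus)
  ultimately show ?thesis by simp
qed

lemma vec_closed_finsum:
  assumes N: "vec_closed R N" and S: "finite S" and v: "\<And>s. s \<in> S \<Longrightarrow> v s \<in> N"
    and a: "\<And>s. s \<in> S \<Longrightarrow> a s \<in> carrier R"
  shows "(\<lambda>i. \<Oplus>s\<in>S. a s \<otimes> v s i) \<in> N"
  using S v a
proof (induction S rule: finite_induct)
  case empty then show ?case using vec_closedD(2)[OF N] by simp
next
  case (insert x S)
  have "(\<lambda>i. a x \<otimes> v x i \<oplus> (\<Oplus>s\<in>S. a s \<otimes> v s i)) \<in> N"
    using insert vec_closedD[OF N] by auto
  moreover have "(\<Oplus>s\<in>insert x S. a s \<otimes> v s i) = a x \<otimes> v x i \<oplus> (\<Oplus>s\<in>S. a s \<otimes> v s i)" for i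
    using insert vec_closedD(1)[OF N] by (intro finsum_insert) auto
  ultimately show ?case by simp
qed

lemma vec_closed_Int:
  "vec_closed R N \<Longrightarrow> vec_closed R N' \<Longrightarrow> vec_closed R (N \<inter> N')"
  by (auto simp: vec_closed_def)

text \<open>The positions \<open>J s\<close> are free, so that one statement covers a single
  coordinate, a linear equation in \<open>n\<close> unknowns and values at selected columns of a
  Hankel matrix.\<close>

lemma vec_closed_kernel:
  assumes S: "finite S" and F: "\<And>s. s \<in> S \<Longrightarrow> F s \<in> carrier R"
  shows "vec_closed R {v \<in> UNIV \<rightarrow> carrier R. (\<Oplus>s\<in>S. v (J s) \<otimes> F s) = \<zero>}"
proof -
  have add: "(\<Oplus>s\<in>S. (v (J s) \<oplus> w (J s)) \<otimes> F s) = (\<Oplus>s\<in>S. v (J s) \<otimes> F s) \<oplus> (\<Oplus>s\<in>S. w (J s) \<otimes> F s)"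
    if "v \<in> UNIV \<rightarrow> carrier R" "w \<in> UNIV \<rightarrow> carrier R" for v w
  proof -
    have "(\<Oplus>s\<in>S. (v (J s) \<oplus> w (J s)) \<otimes> F s) = (\<Oplus>s\<in>S. v (J s) \<otimes> F s \<oplus> w (J s) \<otimes> F s)"
      using that F by (intro finsum_cong2) (auto simp: Pi_iff l_distr)
    also have "\<dots> = (\<Oplus>s\<in>S. v (J s) \<otimes> F s) \<oplus> (\<Oplus>s\<in>S. w (J s) \<otimes> F s)"
      using that F by (intro finsum_addf) (auto simp: Pi_iff)
    finally show ?thesis .
  qed
  have mult: "(\<Oplus>s\<in>S. (a \<otimes> v (J s)) \<otimes> F s) = a \<otimes> (\<Oplus>s\<in>S. v (J s) \<otimes> F s)"
    if "v \<in> UNIV \<rightarrow> carrier R" "a \<in> carrier R" for v a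
  proof -
    have "(\<Oplus>s\<in>S. (a \<otimes> v (J s)) \<otimes> F s) = (\<Oplus>s\<in>S. a \<otimes> (v (J s) \<otimes> F s))"
      using that F by (intro finsum_cong2) (auto simp: Pi_iff m_assoc)
    also have "\<dots> = a \<otimes> (\<Oplus>s\<in>S. v (J s) \<otimes> F s)"
      using that F S by (intro finsum_rdistr[symmetric]) (auto simp: Pi_iff)
    finally show ?thesis .
  qed
  have zero: "(\<Oplus>s\<in>S. \<zero> \<otimes> F s) = \<zero>"
    using finsum_cong2[of S "\<lambda>_. \<zero>" "\<lambda>s. \<zero> \<otimes> F s"] F by simp
  show ?thesis unfolding vec_closed_def using add mult zero by (auto simp: Pi_iff)
qed

text \<open>
  Hilbert's argument: a submodule of \<open>R\<^sup>n\<close> over a Noetherian ring is finitely generated, as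
  its last coordinates form an ideal and its elements with vanishing last coordinate lie in
  \<open>R\<^bsup>n-1\<^esup>\<close>.
\<close>

lemma vec_closed_finitely_generated:
  assumes "noetherian_ring R" "vec_closed R N" "\<And>v i. v \<in> N \<Longrightarrow> n \<le> i \<Longrightarrow> v i = \<zero>"
  shows "\<exists>F. finite F \<and> F \<subseteq> N \<and> (\<forall>N'. vec_closed R N' \<longrightarrow> F \<subseteq> N' \<longrightarrow> N \<subseteq> N')"
  using assms(2,3)
proof (induction n arbitrary: N)
  case 0
  then have "N \<subseteq> {\<lambda>_. \<zero>}" by (auto simp: fun_eq_iff)
  then have "\<forall>N'. vec_closed R N' \<longrightarrow> {} \<subseteq> N' \<longrightarrow> N \<subseteq> N'" using vec_closedD(2) by blast
  then show ?case by blast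
next
  case (Suc n)
  note N = \<open>vec_closed R N\<close>
  have ideal_eval: "ideal ((\<lambda>v. v n) ` M) R" if M: "vec_closed R M" for M
  proof (rule idealI[OF ring_axioms])
    show "subgroup ((\<lambda>v. v n) ` M) (add_monoid R)"
    proof (rule add.subgroupI)
      show "(\<lambda>v. v n) ` M \<subseteq> carrier R" using vec_closedD(1)[OF M] by auto
      show "(\<lambda>v. v n) ` M \<noteq> {}" using vec_closedD(2)[OF M] by blast
    next
      fix a assume "a \<in> (\<lambda>v. v n) ` M"
      then obtain v where v: "v \<in> M" "a = v n" by blast
      have "(\<lambda>i. \<ominus> \<one> \<otimes> v i) \<in> M" using vec_closedD(4)[OF M] v by simp
      moreover have "\<ominus> \<one> \<otimes> v n = \<ominus> a" using vec_closedD(1)[OF M] v by (simp add: l_minus)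
      ultimately show "\<ominus> a \<in> (\<lambda>v. v n) ` M"
        using image_eqI[of "\<ominus> a" "\<lambda>v. v n" "\<lambda>i. \<ominus> \<one> \<otimes> v i" M] by simp
    next
      fix a b assume "a \<in> (\<lambda>v. v n) ` M" "b \<in> (\<lambda>v. v n) ` M"
      then obtain v w where "v \<in> M" "a = v n" "w \<in> M" "b = w n" by blast
      then show "a \<oplus> b \<in> (\<lambda>v. v n) ` M" using vec_closedD(3)[OF M] by force
    qed
  next
    fix a x assume "a \<in> (\<lambda>v. v n) ` M" "x \<in> carrier R"
    then obtain v where v: "v \<in> M" "a = v n" by blast
    then have "(\<lambda>i. x \<otimes> v i) \<in> M" using vec_closedD(4)[OF M] \<open>x \<in> carrier R\<close> by simp
    then show "x \<otimes> a \<in> (\<lambda>v. v n) ` M" using v by force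
    then show "a \<otimes> x \<in> (\<lambda>v. v n) ` M"
      using v \<open>x \<in> carrier R\<close> vec_closedD(1)[OF M] by (simp add: m_comm)
  qed
  obtain G where G: "G \<subseteq> carrier R" "finite G" "(\<lambda>v. v n) ` N = Idl G"
    using noetherian_ring.finetely_gen[OF assms(1) ideal_eval[OF N]] by blast
  have "\<forall>g\<in>G. \<exists>v\<in>N. v n = g" using genideal_self[OF G(1)] unfolding G(3)[symmetric] by fastforce
  then obtain w where w: "\<And>g. g \<in> G \<Longrightarrow> w g \<in> N \<and> w g n = g" by metis
  \<comment> \<open>Vanishing of the coordinate \<open>n\<close>, written as a one-term sum to be an
    instance of \<open>vec_closed_kernel\<close>.\<close>
  define Z where "Z = {v \<in> UNIV \<rightarrow> carrier R. (\<Oplus>s\<in>{n}. v s \<otimes> \<one>) = \<zero>}"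
  have Z: "vec_closed R Z" unfolding Z_def by (rule vec_closed_kernel) auto
  have Z_iff: "v \<in> Z \<longleftrightarrow> v n = \<zero>" if "v \<in> N" for v
    using vec_closedD(1)[OF N that] by (auto simp: Z_def)
  have "vec_closed R (N \<inter> Z)" by (rule vec_closed_Int[OF N Z])
  moreover have "v i = \<zero>" if "v \<in> N \<inter> Z" "n \<le> i" for v i
    using that Suc.prems(2)[of v i] Z_iff[of v] by (cases "i = n") auto
  ultimately obtain F where F: "finite F" "F \<subseteq> N \<inter> Z"
    "\<And>N'. vec_closed R N' \<Longrightarrow> F \<subseteq> N' \<Longrightarrow> N \<inter> Z \<subseteq> N'"
    using Suc.IH by meson
  have "N \<subseteq> N'" if N': "vec_closed R N'" and sub: "F \<union> w ` G \<subseteq> N'" for N'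
  proof
    fix v assume v: "v \<in> N"
    \<comment> \<open>The coordinates at \<open>n\<close> of elements of
      \<open>N \<inter> N'\<close> form an ideal containing \<open>G\<close>, hence containing
      \<open>Idl G\<close>. So some \<open>u\<close> in both has the same coordinate as
      \<open>v\<close>, without any linear combination being written down.\<close>
    have "vec_closed R (N \<inter> N')" by (rule vec_closed_Int[OF N N'])
    moreover have "G \<subseteq> (\<lambda>v. v n) ` (N \<inter> N')"
    proof
      fix g assume g: "g \<in> G"
      show "g \<in> (\<lambda>v. v n) ` (N \<inter> N')"
        by (rule image_eqI[of _ _ "w g"]) (use w[OF g] g sub in auto)
    qed
    ultimately have "Idl G \<subseteq> (\<lambda>v. v n) ` (N \<inter> N')" by (intro genideal_minimal ideal_eval)
    moreover have "v n \<in> Idl G" unfolding G(3)[symmetric] using v by (rule imageI)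
    ultimately have "v n \<in> (\<lambda>v. v n) ` (N \<inter> N')" by (rule subsetD)
    then obtain u where "v n = u n" "u \<in> N \<inter> N'" by (rule imageE)
    then have u: "u \<in> N" "u \<in> N'" "u n = v n" by simp_all
    have d: "(\<lambda>i. v i \<ominus> u i) \<in> N" by (rule vec_closed_minus[OF N v u(1)])
    have "v n \<ominus> u n = \<zero>" using u vec_closedD(1)[OF N v] by (simp add: a_minus_def r_neg)
    then have "(\<lambda>i. v i \<ominus> u i) \<in> N'" using F(3)[OF N'] sub d Z_iff[OF d] by auto
    then have "(\<lambda>i. (v i \<ominus> u i) \<oplus> u i) \<in> N'" using vec_closedD(3)[OF N'] u by auto
    moreover have "(v i \<ominus> u i) \<oplus> u i = v i" for i
      using vec_closedD(1)[OF N v, of i] vec_closedD(1)[OF N u(1), of i]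
      by (simp add: a_minus_def a_assoc l_neg)
    ultimately show "v \<in> N'" by simp
  qed
  then show ?case using F w G by (intro exI[of _ "F \<union> w ` G"]) auto
qed

end

section \<open>Rational series and linear recurrences\<close>

text \<open>\<open>q i\<close> is paired with \<open>f (k + n - i)\<close>, so the equations say
  that the product of \<open>f\<close> with the polynomial having coefficients \<open>q\<close> has
  no terms from \<open>T^n\<close> on. The leading coefficient of the recurrence is
  \<open>q 0\<close>, the constant term of the denominator.\<close>

definition recurrence :: "('a, 'm) ring_scheme \<Rightarrow> (nat \<Rightarrow> 'a) \<Rightarrow> nat \<Rightarrow> (nat \<Rightarrow> 'a) \<Rightarrow> bool" where
  "recurrence R f n q \<longleftrightarrow> (\<forall>i<Suc n. q i \<in> carrier R) \<and>
     (\<forall>k. (\<Oplus>\<^bsub>R\<^esub>i\<in>{..<Suc n}. q i \<otimes>\<^bsub>R\<^esub> f (k + n - i)) = \<zero>\<^bsub>R\<^esub>)"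

text \<open>The module spanned by the first \<open>n\<close> rows of the Hankel matrix.\<close>

definition shift_span :: "('a, 'm) ring_scheme \<Rightarrow> (nat \<Rightarrow> 'a) \<Rightarrow> nat \<Rightarrow> (nat \<Rightarrow> 'a) set" where
  "shift_span R f n =
     {\<lambda>j. \<Oplus>\<^bsub>R\<^esub>k\<in>{..<n}. c k \<otimes>\<^bsub>R\<^esub> f (k + j) | c. c \<in> UNIV \<rightarrow> carrier R}"

context cring
begin

lemma W_rat_witt_set: "carrier (W_rat R) \<subseteq> witt_set R"
  by (auto simp: W_rat_def)

lemma W_J_witt_set: "carrier (W_J R) \<subseteq> witt_set R"
  by (auto simp: W_J_def)

lemma witt_setD: "f \<in> witt_set R \<Longrightarrow> f \<in> UNIV \<rightarrow> carrier R"
  by (simp add: witt_set_def)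

text \<open>A denominator \<open>Q\<close> of \<open>f\<close> amounts to a recurrence, because the
  coefficients of \<open>Q f\<close> vanish beyond the degree of the numerator.\<close>

lemma rational_iff_recurrence:
  assumes f: "f \<in> witt_set R"
  shows "f \<in> carrier (W_rat R) \<longleftrightarrow> (\<exists>n q. recurrence R f n q \<and> q 0 = \<one>)"
proof
  have fc: "f i \<in> carrier R" for i using f by (auto simp: witt_set_def)
  \<comment> \<open>The coefficient of \<open>Q f\<close> at \<open>T^(k + n)\<close> has only
    \<open>n + 1\<close> terms when \<open>Q\<close> vanishes above \<open>n\<close>.\<close>
  have cut: "(\<Oplus>i\<in>{..k + n}. Q i \<otimes> f (k + n - i)) = (\<Oplus>i\<in>{..<Suc n}. Q i \<otimes> f (k + n - i))"
    if "\<And>i. Q i \<in> carrier R" "\<And>i. n < i \<Longrightarrow> Q i = \<zero>" for k n Q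
    using that fc by (intro add.finprod_mono_neutral_cong_right) auto
  {
    assume "f \<in> carrier (W_rat R)"
    then obtain P Q where PQ: "P \<in> carrier (UP R)" "Q \<in> carrier (UP R)" "Q 0 = \<one>" "Q \<otimes>\<^bsub>series_ring R\<^esub> f = P"
      by (auto simp: W_rat_def)
    have "P \<in> up R" "Q \<in> up R" using PQ by (simp_all add: UP_def)
    then obtain a b where "bound \<zero> a P" "bound \<zero> b Q" and Qc: "\<And>i. Q i \<in> carrier R"
      using bound_upD mem_upD by metis
    then have a: "\<And>i. a < i \<Longrightarrow> P i = \<zero>" and b: "\<And>i. b < i \<Longrightarrow> Q i = \<zero>"
      by (simp_all add: bound_def)
    \<comment> \<open>The order must bound the degree of \<open>Q\<close> and exceed that of
      \<open>P\<close>, so that \<open>P (k + n)\<close> vanishes already for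
      \<open>k = 0\<close>.\<close>
    define n where "n = Suc (max a b)"
    have "(\<Oplus>i\<in>{..<Suc n}. Q i \<otimes> f (k + n - i)) = \<zero>" for k
    proof -
      have "(\<Oplus>i\<in>{..k + n}. Q i \<otimes> f (k + n - i)) = P (k + n)"
        using PQ(4) by (metis mult_series_ring)
      then show ?thesis using cut[of Q n k] Qc a b by (auto simp: n_def)
    qed
    then have "recurrence R f n Q" using Qc by (auto simp: recurrence_def)
    then show "\<exists>n q. recurrence R f n q \<and> q 0 = \<one>" using PQ by blast
  }
  {
    assume "\<exists>n q. recurrence R f n q \<and> q 0 = \<one>"
    then obtain n q where q: "\<And>i. i < Suc n \<Longrightarrow> q i \<in> carrier R" "q 0 = \<one>"
      "\<And>k. (\<Oplus>i\<in>{..<Suc n}. q i \<otimes> f (k + n - i)) = \<zero>" by (auto simp: recurrence_def)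
    define Q where "Q = (\<lambda>i. if i < Suc n then q i else \<zero>)"
    define P where "P = Q \<otimes>\<^bsub>series_ring R\<^esub> f"
    have Qc: "Q i \<in> carrier R" for i using q by (simp add: Q_def)
    have "P m = \<zero>" if "n < m" for m
    proof -
      have "P m = (\<Oplus>i\<in>{..(m - n) + n}. Q i \<otimes> f (m - n + n - i))"
        using that by (simp add: P_def mult_series_ring)
      also have "\<dots> = (\<Oplus>i\<in>{..<Suc n}. Q i \<otimes> f (m - n + n - i))"
        by (rule cut) (use Qc in \<open>auto simp: Q_def\<close>)
      also have "\<dots> = (\<Oplus>i\<in>{..<Suc n}. q i \<otimes> f (m - n + n - i))"
        using q fc by (intro finsum_cong2) (auto simp: Q_def)
      finally show ?thesis using q(3) by simp
    qed
    moreover have "P \<in> UNIV \<rightarrow> carrier R" unfolding P_def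
      by (rule series_mult_closed) (use Qc fc in auto)
    ultimately have "P \<in> carrier (UP R)" by (auto simp: UP_def)
    moreover have "Q \<in> carrier (UP R)" using Qc by (auto simp: UP_def Q_def intro!: exI[of _ n])
    moreover have "P 0 = \<one>" "Q 0 = \<one>"
      using q f by (auto simp: P_def mult_series_ring Q_def witt_set_def)
    ultimately show "f \<in> carrier (W_rat R)" using f by (auto simp: W_rat_def P_def)
  }
qed

text \<open>With a zero appended, the equation of order \<open>n + 1\<close> at \<open>k\<close> is
  the one of order \<open>n\<close> at \<open>k + 1\<close>. Raising orders is what allows
  recurrences to be added.\<close>

lemma recurrence_Suc:
  assumes f: "f \<in> UNIV \<rightarrow> carrier R" and q: "recurrence R f n q"
  shows "recurrence R f (Suc n) (q(Suc n := \<zero>))"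
  unfolding recurrence_def
proof (intro conjI allI impI)
  fix k
  have "{..<Suc (Suc n)} = insert (Suc n) {..<Suc n}" by auto
  moreover have "(\<Oplus>i\<in>insert (Suc n) {..<Suc n}. (q(Suc n := \<zero>)) i \<otimes> f (k + Suc n - i)) =
      (q(Suc n := \<zero>)) (Suc n) \<otimes> f (k + Suc n - Suc n) \<oplus>
      (\<Oplus>i\<in>{..<Suc n}. (q(Suc n := \<zero>)) i \<otimes> f (k + Suc n - i))"
    using f q by (intro finsum_insert) (auto simp: recurrence_def Pi_iff)
  moreover have "(\<Oplus>i\<in>{..<Suc n}. (q(Suc n := \<zero>)) i \<otimes> f (k + Suc n - i)) =
      (\<Oplus>i\<in>{..<Suc n}. q i \<otimes> f (Suc k + n - i))"
    using f q by (intro finsum_cong2) (auto simp: recurrence_def Pi_iff)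
  moreover have "(\<Oplus>i\<in>{..<Suc n}. q i \<otimes> f (Suc k + n - i)) = \<zero>"
    using q by (simp only: recurrence_def)
  ultimately show "(\<Oplus>i\<in>{..<Suc (Suc n)}. (q(Suc n := \<zero>)) i \<otimes> f (k + Suc n - i)) = \<zero>"
    using f by (simp add: Pi_iff)
qed (use q in \<open>auto simp: recurrence_def less_Suc_eq\<close>)

section \<open>Spans of shifts\<close>

lemma shift_span_closed:
  assumes f: "f \<in> UNIV \<rightarrow> carrier R"
  shows "vec_closed R (shift_span R f n)"
proof -
  have fc: "f i \<in> carrier R" for i using f by auto
  have add: "(\<Oplus>k\<in>{..<n}. c k \<otimes> f (k + j)) \<oplus> (\<Oplus>k\<in>{..<n}. d k \<otimes> f (k + j)) =
    (\<Oplus>k\<in>{..<n}. (c k \<oplus> d k) \<otimes> f (k + j))" if "c \<in> UNIV \<rightarrow> carrier R" "d \<in> UNIV \<rightarrow> carrier R" for c d j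
  proof -
    have "(\<Oplus>k\<in>{..<n}. (c k \<oplus> d k) \<otimes> f (k + j)) = (\<Oplus>k\<in>{..<n}. c k \<otimes> f (k + j) \<oplus> d k \<otimes> f (k + j))"
      using that fc by (intro finsum_cong2) (auto simp: Pi_iff l_distr)
    also have "\<dots> = (\<Oplus>k\<in>{..<n}. c k \<otimes> f (k + j)) \<oplus> (\<Oplus>k\<in>{..<n}. d k \<otimes> f (k + j))"
      using that fc by (intro finsum_addf) (auto simp: Pi_iff)
    finally show ?thesis by simp
  qed
  have mult: "a \<otimes> (\<Oplus>k\<in>{..<n}. c k \<otimes> f (k + j)) = (\<Oplus>k\<in>{..<n}. (a \<otimes> c k) \<otimes> f (k + j))"
    if "c \<in> UNIV \<rightarrow> carrier R" "a \<in> carrier R" for a c j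
  proof -
    have "a \<otimes> (\<Oplus>k\<in>{..<n}. c k \<otimes> f (k + j)) = (\<Oplus>k\<in>{..<n}. a \<otimes> (c k \<otimes> f (k + j)))"
      using that fc by (intro finsum_rdistr) (auto simp: Pi_iff)
    also have "\<dots> = (\<Oplus>k\<in>{..<n}. (a \<otimes> c k) \<otimes> f (k + j))"
      using that fc by (intro finsum_cong2) (auto simp: Pi_iff m_assoc)
    finally show ?thesis .
  qed
  show ?thesis
    unfolding vec_closed_def
  proof (intro conjI ballI)
    show "shift_span R f n \<subseteq> UNIV \<rightarrow> carrier R"
      using fc by (auto simp: shift_span_def Pi_iff intro!: finsum_closed)
    have "(\<lambda>j. \<Oplus>k\<in>{..<n}. \<zero> \<otimes> f (k + j)) \<in> shift_span R f n"
      unfolding shift_span_def by (rule CollectI, rule exI[of _ "\<lambda>_. \<zero>"]) auto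
    then show "(\<lambda>_. \<zero>) \<in> shift_span R f n" using fc by simp
  next
    fix v w assume "v \<in> shift_span R f n" "w \<in> shift_span R f n"
    then obtain c d where "c \<in> UNIV \<rightarrow> carrier R" "d \<in> UNIV \<rightarrow> carrier R"
      "v = (\<lambda>j. \<Oplus>k\<in>{..<n}. c k \<otimes> f (k + j))" "w = (\<lambda>j. \<Oplus>k\<in>{..<n}. d k \<otimes> f (k + j))"
      by (auto simp: shift_span_def)
    then show "(\<lambda>i. v i \<oplus> w i) \<in> shift_span R f n"
      unfolding shift_span_def by (intro CollectI exI[of _ "\<lambda>k. c k \<oplus> d k"]) (auto simp: add)
  next
    fix a v assume "a \<in> carrier R" "v \<in> shift_span R f n"
    then obtain c where "c \<in> UNIV \<rightarrow> carrier R" "v = (\<lambda>j. \<Oplus>k\<in>{..<n}. c k \<otimes> f (k + j))"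
      by (auto simp: shift_span_def)
    then show "(\<lambda>i. a \<otimes> v i) \<in> shift_span R f n"
      using \<open>a \<in> carrier R\<close>
      unfolding shift_span_def by (intro CollectI exI[of _ "\<lambda>k. a \<otimes> c k"]) (auto simp: mult)
  qed
qed

lemma shift_in_span:
  assumes f: "f \<in> UNIV \<rightarrow> carrier R" and i: "i < n"
  shows "(\<lambda>j. f (i + j)) \<in> shift_span R f n"
proof -
  have "(\<Oplus>k\<in>{..<n}. unit_row i k \<otimes> f (k + j)) = f (i + j)" for j
  proof -
    have "(\<Oplus>k\<in>{..<n}. unit_row i k \<otimes> f (k + j)) = (\<Oplus>k\<in>{..<n}. if i = k then f (k + j) else \<zero>)"
      using f by (intro finsum_cong2) (auto simp: unit_row_def Pi_iff)
    then show ?thesis using i f add.finprod_singleton[of i "{..<n}" "\<lambda>k. f (k + j)"] by auto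
  qed
  then show ?thesis unfolding shift_span_def by (intro CollectI exI[of _ "unit_row i"]) auto
qed

lemma shift_span_minimal:
  assumes N: "vec_closed R N" and f: "\<And>i. i < n \<Longrightarrow> (\<lambda>j. f (i + j)) \<in> N"
  shows "shift_span R f n \<subseteq> N"
  using vec_closed_finsum[OF N, of "{..<n}" "\<lambda>i j. f (i + j)"] f by (auto simp: shift_span_def)

lemma shift_span_mono:
  assumes f: "f \<in> UNIV \<rightarrow> carrier R" and "m \<le> n"
  shows "shift_span R f m \<subseteq> shift_span R f n"
  using shift_span_minimal[OF shift_span_closed[OF f]] shift_in_span[OF f] assms by auto

lemma finsum_lessThan_rev:
  assumes "\<And>i. i < m \<Longrightarrow> g i \<in> carrier R"
  shows "(\<Oplus>i\<in>{..<m}. g (m - Suc i)) = (\<Oplus>i\<in>{..<m}. g i)"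
proof -
  let ?h = "\<lambda>i. m - Suc i"
  have "?h ` {..<m} = {..<m}"
  proof (intro equalityI subsetI)
    fix x assume "x \<in> {..<m}"
    then have "x = ?h (?h x)" "?h x \<in> {..<m}" by auto
    then show "x \<in> ?h ` {..<m}" by blast
  qed auto
  moreover have "inj_on ?h {..<m}" by (auto simp: inj_on_def)
  ultimately show ?thesis using finsum_reindex[of g ?h "{..<m}"] assms by auto
qed

lemma finsum_lessThan_Suc2:
  assumes "\<And>i. i < Suc n \<Longrightarrow> g i \<in> carrier R"
  shows "(\<Oplus>i\<in>{..<Suc n}. g i) = g 0 \<oplus> (\<Oplus>i\<in>{..<n}. g (Suc i))"
proof -
  have "(\<Oplus>i\<in>insert 0 (Suc ` {..<n}). g i) = g 0 \<oplus> (\<Oplus>i\<in>Suc ` {..<n}. g i)"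
    using assms by (intro finsum_insert) auto
  moreover have "(\<Oplus>i\<in>Suc ` {..<n}. g i) = (\<Oplus>i\<in>{..<n}. g (Suc i))"
    using assms by (intro finsum_reindex) auto
  ultimately show ?thesis by (simp add: lessThan_Suc_eq_insert_0)
qed

text \<open>With leading coefficient 1 the recurrence expresses a shift by the \<open>n\<close>
  preceding ones, so strong induction leads back to the first \<open>n\<close>.\<close>

lemma recurrence_imp_shift_in_span:
  assumes f: "f \<in> UNIV \<rightarrow> carrier R" and q: "recurrence R f n q" "q 0 = \<one>"
  shows "(\<lambda>j. f (i + j)) \<in> shift_span R f n"
proof (induction i rule: less_induct)
  case (less i)
  note N = shift_span_closed[OF f, of n]
  have qc: "q i \<in> carrier R" if "i < Suc n" for i using q that by (simp add: recurrence_def)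
  have fc: "f i \<in> carrier R" for i using f by auto
  show ?case
  proof (cases "i < n")
    case True then show ?thesis by (rule shift_in_span[OF f])
  next
    case False
    have "(\<lambda>j. \<Oplus>s\<in>{..<n}. (\<ominus> q (Suc s)) \<otimes> f (i - Suc s + j)) \<in> shift_span R f n"
      using False qc by (intro vec_closed_finsum[OF N] less.IH) auto
    moreover have "(\<Oplus>s\<in>{..<n}. (\<ominus> q (Suc s)) \<otimes> f (i - Suc s + j)) = f (i + j)" for j
    proof -
      \<comment> \<open>The recurrence is taken at \<open>i - n + j\<close>, where its leading term
        is \<open>f (i + j)\<close>.\<close>
      have "\<zero> = (\<Oplus>s\<in>{..<Suc n}. q s \<otimes> f ((i - n + j) + n - s))"
        using q(1) by (simp add: recurrence_def)
      also have "\<dots> = f (i + j) \<oplus> (\<Oplus>s\<in>{..<n}. q (Suc s) \<otimes> f ((i - n + j) + n - Suc s))"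
        using qc fc q(2) False by (subst finsum_lessThan_Suc2) auto
      also have "(\<Oplus>s\<in>{..<n}. q (Suc s) \<otimes> f ((i - n + j) + n - Suc s)) =
          (\<Oplus>s\<in>{..<n}. q (Suc s) \<otimes> f (i - Suc s + j))"
        using qc fc False by (intro finsum_cong2) (auto intro!: arg_cong2[of _ _ _ _ "(\<otimes>)"] arg_cong[of _ _ f])
      finally have "f (i + j) \<oplus> (\<Oplus>s\<in>{..<n}. q (Suc s) \<otimes> f (i - Suc s + j)) = \<zero>" ..
      moreover have cl: "(\<Oplus>s\<in>{..<n}. q (Suc s) \<otimes> f (i - Suc s + j)) \<in> carrier R"
        using qc fc by (intro finsum_closed) auto
      ultimately have "f (i + j) = (\<ominus> \<one>) \<otimes> (\<Oplus>s\<in>{..<n}. q (Suc s) \<otimes> f (i - Suc s + j))"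
        using fc sum_zero_eq_neg by (simp add: l_minus)
      also have "\<dots> = (\<Oplus>s\<in>{..<n}. (\<ominus> \<one>) \<otimes> (q (Suc s) \<otimes> f (i - Suc s + j)))"
        using qc fc by (intro finsum_rdistr) auto
      also have "\<dots> = (\<Oplus>s\<in>{..<n}. (\<ominus> q (Suc s)) \<otimes> f (i - Suc s + j))"
        using qc fc by (intro finsum_cong2) (auto simp: l_minus)
      finally show ?thesis ..
    qed
    ultimately show ?thesis by simp
  qed
qed

lemma shift_in_span_imp_recurrence:
  assumes f: "f \<in> UNIV \<rightarrow> carrier R" and m: "(\<lambda>j. f (m + j)) \<in> shift_span R f m"
  shows "\<exists>q. recurrence R f m q \<and> q 0 = \<one>"
proof -
  have fc: "f i \<in> carrier R" for i using f by auto
  obtain c where c: "\<And>i. c i \<in> carrier R" "\<And>j. f (m + j) = (\<Oplus>k\<in>{..<m}. c k \<otimes> f (k + j))"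
    using m by (auto simp: shift_span_def fun_eq_iff)
  \<comment> \<open>The relation for the shift by \<open>m\<close> counts upwards and a recurrence
    counts downwards, hence the reversed index.\<close>
  define q where "q = (\<lambda>i. if i = 0 then \<one> else \<ominus> c (m - i))"
  have "(\<Oplus>i\<in>{..<Suc m}. q i \<otimes> f (j + m - i)) = \<zero>" for j
  proof -
    have "(\<Oplus>i\<in>{..<Suc m}. q i \<otimes> f (j + m - i)) =
        f (m + j) \<oplus> (\<Oplus>i\<in>{..<m}. (\<ominus> c (m - Suc i)) \<otimes> f (j + m - Suc i))"
      using c fc by (subst finsum_lessThan_Suc2) (auto simp: q_def add.commute)
    also have "(\<Oplus>i\<in>{..<m}. (\<ominus> c (m - Suc i)) \<otimes> f (j + m - Suc i)) =
        (\<Oplus>i\<in>{..<m}. (\<lambda>k. (\<ominus> c k) \<otimes> f (k + j)) (m - Suc i))"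
      using c fc by (intro finsum_cong2) (auto intro!: arg_cong2[of _ _ _ _ "(\<otimes>)"] arg_cong[of _ _ f])
    also have "\<dots> = (\<Oplus>k\<in>{..<m}. (\<ominus> c k) \<otimes> f (k + j))"
      using c fc by (intro finsum_lessThan_rev) auto
    also have "\<dots> = (\<Oplus>k\<in>{..<m}. (\<ominus> \<one>) \<otimes> (c k \<otimes> f (k + j)))"
      using c fc by (intro finsum_cong2) (auto simp: l_minus)
    also have "\<dots> = (\<ominus> \<one>) \<otimes> f (m + j)"
      unfolding c(2)[of j] using c fc by (intro finsum_rdistr[symmetric]) auto
    finally show ?thesis using fc by (simp add: l_minus r_neg)
  qed
  moreover have "q 0 = \<one>" "\<And>i. q i \<in> carrier R" using c by (auto simp: q_def)
  ultimately show ?thesis by (auto simp: recurrence_def)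
qed

text \<open>All rows of the Hankel matrix lie in the span of the first \<open>n\<close>, so
  \<open>det_in_low_rank\<close> applies to every minor of size \<open>n + 1\<close>.\<close>

theorem W_rat_subset_W_J: "carrier (W_rat R) \<subseteq> carrier (W_J R)"
proof
  fix f assume f: "f \<in> carrier (W_rat R)"
  then have fw: "f \<in> witt_set R" using W_rat_witt_set by blast
  then have fU: "f \<in> UNIV \<rightarrow> carrier R" by (rule witt_setD)
  obtain n q where q: "recurrence R f n q" "q 0 = \<one>" using f rational_iff_recurrence[OF fw] by blast
  have "\<exists>c. c \<in> UNIV \<rightarrow> carrier R \<and> (\<forall>j. f (i + j) = (\<Oplus>k\<in>{..<n}. c k \<otimes> f (k + j)))" for i
    using recurrence_imp_shift_in_span[OF fU q, of i] by (auto simp: shift_span_def fun_eq_iff)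
  then obtain c where c: "\<And>i. c i \<in> UNIV \<rightarrow> carrier R"
    "\<And>i j. f (i + j) = (\<Oplus>k\<in>{..<n}. c i k \<otimes> f (k + j))" by metis
  have "minors_vanish R (Suc n) (hankel f)"
  proof (rule minors_vanishI)
    fix r s :: "nat \<Rightarrow> nat"
    have "det_in R (Suc n) (\<lambda>i j. \<Oplus>k\<in>{..<n}. c (r i) k \<otimes> f (k + s j)) = \<zero>"
      using c(1) fU by (intro det_in_low_rank) auto
    then show "det_in R (Suc n) (\<lambda>i j. f (r i + s j)) = \<zero>" by (simp flip: c(2))
  qed
  \<comment> \<open>The order of the recurrence may be 0, but the bound in \<open>W_J\<close> must
    be positive; hence one size more.\<close>
  then have "minors_vanish R (Suc n + 1) (hankel f)" using minors_vanish_mono[OF fU] by simp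
  then show "f \<in> carrier (W_J R)" using fw by (auto simp: W_J_def intro!: exI[of _ "Suc n"])
qed

end

section \<open>Hankel matrices of finite rank over a Noetherian domain\<close>

lemma (in "domain") W_J_subset_W_rat:
  assumes noeth: "noetherian_ring R"
  shows "carrier (W_J R) \<subseteq> carrier (W_rat R)"
proof
  fix f assume f: "f \<in> carrier (W_J R)"
  then have fw: "f \<in> witt_set R" using W_J_witt_set by blast
  then have fU: "f \<in> UNIV \<rightarrow> carrier R" by (rule witt_setD)
  have fc: "f i \<in> carrier R" for i using fU by auto
  have "\<exists>m. minors_vanish R m (hankel f)" using f by (auto simp: W_J_def)
  then obtain m where m: "minors_vanish R m (hankel f)"
    and least: "\<And>k. k < m \<Longrightarrow> \<not> minors_vanish R k (hankel f)"
    using exists_least_iff[of "\<lambda>m. minors_vanish R m (hankel f)"] by blast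
  \<comment> \<open>The empty minor is 1, which is nonzero in a domain. So \<open>m = r + 1\<close>,
    where \<open>r\<close> is the rank.\<close>
  have "m \<noteq> 0"
  proof
    assume "m = 0"
    then have "det_in R 0 (\<lambda>i j. f (i + j)) = \<zero>"
      using minors_vanish_imp_all[OF fU m, of id id] by simp
    moreover have "det_in R 0 (\<lambda>i j. f (i + j)) = \<one>"
      by (subst det_in_eq) (auto simp: mat_in_def sgn_in_def)
    ultimately show False by simp
  qed
  then obtain r where r: "m = Suc r" using not0_implies_Suc by blast
  then obtain I J :: "nat \<Rightarrow> nat" where D: "det_in R r (\<lambda>i j. f (I i + J j)) \<noteq> \<zero>"
    using least[of r] minors_vanishI[of r f] by auto
  \<comment> \<open>Cofactors along the last row of the bordered minor with columns
    \<open>J 0\<close>, ..., \<open>J (r - 1)\<close>, \<open>j\<close>. They do not depend on the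
    row added at the bottom.\<close>
  define F where "F = (\<lambda>j s. det_in R (Suc r) ((\<lambda>a b. f (I a + (J(r := j)) b))(r := unit_row s)))"
  have mat: "mat_in (Suc r) (\<lambda>a b. f (I' a + J' b))" for I' J' :: "nat \<Rightarrow> nat"
    using fc by (simp add: mat_in_def)
  have Fc: "F j s \<in> carrier R" for j s
    unfolding F_def by (intro det_in_closed mat_in_update[OF mat]) simp
  \<comment> \<open>The cofactor of the added column is the chosen nonzero minor, whatever
    \<open>j\<close> is.\<close>
  have FD: "F j r = det_in R r (\<lambda>a b. f (I a + J b))" for j
  proof -
    have "F j r = det_in R r (\<lambda>a b. f (I a + (J(r := j)) b))"
      unfolding F_def by (rule det_in_unit_last_row[OF mat])
    also have "\<dots> = det_in R r (\<lambda>a b. f (I a + J b))"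
      by (rule det_in_cong) (auto simp: mat_in_def fc)
    finally show ?thesis .
  qed
  \<comment> \<open>The bordered minor with added row \<open>i\<close> vanishes. Expanded, it is a
    linear relation between the values at \<open>r + 1\<close> columns, with the same coefficients
    for every shift of \<open>f\<close>.\<close>
  have rel: "(\<Oplus>s\<in>{..<Suc r}. f (i + (J(r := j)) s) \<otimes> F j s) = \<zero>" for i j
  proof -
    let ?M = "\<lambda>a b. f ((I(r := i)) a + (J(r := j)) b)"
    have upd: "?M(r := unit_row s) = (\<lambda>a b. f (I a + (J(r := j)) b))(r := unit_row s)" for s
      by (auto simp: fun_eq_iff)
    have "\<zero> = det_in R (Suc r) ?M" using minors_vanish_imp_all[OF fU m, of "I(r := i)" "J(r := j)"] r by simp
    also have "\<dots> = (\<Oplus>s\<in>{..<Suc r}. ?M r s \<otimes> det_in R (Suc r) (?M(r := unit_row s)))"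
      by (rule det_in_expand_row[OF mat]) simp
    also have "\<dots> = (\<Oplus>s\<in>{..<Suc r}. f (i + (J(r := j)) s) \<otimes> F j s)"
      unfolding upd F_def[symmetric] using fc Fc by (intro finsum_cong2) (auto simp: F_def)
    finally show ?thesis ..
  qed
  \<comment> \<open>Cramer's rule: a combination of shifts of \<open>f\<close> is determined by its values at \<open>J 0, \<dots>, J (r - 1)\<close>.\<close>
  have determined: "v j = \<zero>"
    if v: "v \<in> shift_span R f n" and vJ: "\<And>s. s < r \<Longrightarrow> v (J s) = \<zero>" for v j n
  proof -
    let ?N = "{v \<in> UNIV \<rightarrow> carrier R. (\<Oplus>s\<in>{..<Suc r}. v ((J(r := j)) s) \<otimes> F j s) = \<zero>}"
    have "vec_closed R ?N" by (rule vec_closed_kernel) (auto simp: Fc)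
    then have "shift_span R f n \<subseteq> ?N" using rel fc by (intro shift_span_minimal) auto
    then have vN: "v \<in> ?N" using v by blast
    then have vc: "v i \<in> carrier R" for i by auto
    have "(\<Oplus>s\<in>{..<Suc r}. v ((J(r := j)) s) \<otimes> F j s) = (\<Oplus>s\<in>{r}. v ((J(r := j)) s) \<otimes> F j s)"
      using vc Fc vJ by (intro add.finprod_mono_neutral_cong_right) auto
    then have "v j \<otimes> F j r = \<zero>" using vN vc Fc by simp
    then show ?thesis using D FD Fc vc integral by metis
  qed
  \<comment> \<open>Values at the columns \<open>J s\<close>: by \<open>determined\<close> this
    embeds the module generated by all shifts into \<open>R^r\<close>.\<close>
  define res where "res = (\<lambda>v s. if s < r then v (J s) else \<zero> :: 'a)"
  have res_closed: "vec_closed R (res ` N)" if N: "vec_closed R N" for N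
    unfolding vec_closed_def
  proof (intro conjI ballI)
    show "res ` N \<subseteq> UNIV \<rightarrow> carrier R" using vec_closedD(1)[OF N] by (auto simp: res_def)
    have "res (\<lambda>_. \<zero>) = (\<lambda>_. \<zero>)" by (auto simp: res_def)
    then show "(\<lambda>_. \<zero>) \<in> res ` N" using vec_closedD(2)[OF N] by (metis image_eqI)
  next
    fix v w assume "v \<in> res ` N" "w \<in> res ` N"
    then obtain v' w' where vw: "v' \<in> N" "w' \<in> N" "v = res v'" "w = res w'" by blast
    then have "(\<lambda>i. v i \<oplus> w i) = res (\<lambda>i. v' i \<oplus> w' i)" by (auto simp: res_def)
    then show "(\<lambda>i. v i \<oplus> w i) \<in> res ` N" using vec_closedD(3)[OF N] vw by blast
  next
    fix a v assume a: "a \<in> carrier R" "v \<in> res ` N"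
    then obtain v' where v: "v' \<in> N" "v = res v'" by blast
    then have "(\<lambda>i. a \<otimes> v i) = res (\<lambda>i. a \<otimes> v' i)" using a by (auto simp: res_def)
    then show "(\<lambda>i. a \<otimes> v i) \<in> res ` N" using vec_closedD(4)[OF N] v a by blast
  qed
  note sc = shift_span_closed[OF fU]
  let ?U = "\<Union>n. shift_span R f n"
  have "vec_closed R ?U"
    unfolding vec_closed_def
  proof (intro conjI ballI)
    show "?U \<subseteq> UNIV \<rightarrow> carrier R" using vec_closedD(1)[OF sc] by auto
    show "(\<lambda>_. \<zero>) \<in> ?U" using vec_closedD(2)[OF sc] by blast
  next
    fix v w assume "v \<in> ?U" "w \<in> ?U"
    then obtain a b where "v \<in> shift_span R f a" "w \<in> shift_span R f b" by blast
    then have "v \<in> shift_span R f (max a b)" "w \<in> shift_span R f (max a b)"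
      using shift_span_mono[OF fU, of a "max a b"] shift_span_mono[OF fU, of b "max a b"] by auto
    then show "(\<lambda>i. v i \<oplus> w i) \<in> ?U" using vec_closedD(3)[OF sc] by blast
  next
    fix a v assume "a \<in> carrier R" "v \<in> ?U"
    then show "(\<lambda>i. a \<otimes> v i) \<in> ?U" using vec_closedD(4)[OF sc] by blast
  qed
  then have U: "vec_closed R (res ` ?U)" by (rule res_closed)
  obtain G where G: "finite G" "G \<subseteq> res ` ?U" "\<And>N'. vec_closed R N' \<Longrightarrow> G \<subseteq> N' \<Longrightarrow> res ` ?U \<subseteq> N'"
    using vec_closed_finitely_generated[OF noeth U, of r] by (force simp: res_def)
  \<comment> \<open>The spans increase with \<open>n\<close>, so finitely many generators lie in one
    of them.\<close>
  have "\<exists>n. G \<subseteq> res ` shift_span R f n" using G(1,2)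
  proof (induction G rule: finite_induct)
    case (insert g G)
    then obtain a b where "G \<subseteq> res ` shift_span R f a" "g \<in> res ` shift_span R f b" by auto
    then have "insert g G \<subseteq> res ` shift_span R f (max a b)"
      using shift_span_mono[OF fU, of a "max a b"] shift_span_mono[OF fU, of b "max a b"] by auto
    then show ?case by blast
  qed simp
  then obtain n where n: "G \<subseteq> res ` shift_span R f n" by blast
  \<comment> \<open>The shift by \<open>n\<close> has the same restriction as some \<open>v\<close>
    in the span of the first \<open>n\<close> shifts; applied to the difference,
    \<open>determined\<close> makes the two equal.\<close>
  have "(\<lambda>j. f (n + j)) \<in> ?U" using shift_in_span[OF fU, of n "Suc n"] by blast
  then have "res (\<lambda>j. f (n + j)) \<in> res ` shift_span R f n" using G(3)[OF res_closed[OF sc] n] by blast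
  then obtain v where v: "v \<in> shift_span R f n" "res (\<lambda>j. f (n + j)) = res v" by blast
  have "v \<in> shift_span R f (Suc n)" using v shift_span_mono[OF fU, of n "Suc n"] by auto
  then have d: "(\<lambda>j. f (n + j) \<ominus> v j) \<in> shift_span R f (Suc n)"
    by (intro vec_closed_minus[OF sc] shift_in_span[OF fU]) auto
  have vc: "v j \<in> carrier R" for j using vec_closedD(1)[OF sc v(1)] .
  have eqJ: "f (n + J s) = v (J s)" if "s < r" for s
    using fun_cong[OF v(2), of s] that by (simp add: res_def)
  have "f (n + j) \<ominus> v j = \<zero>" for j
    by (rule determined[OF d]) (use eqJ vc in \<open>simp add: a_minus_def r_neg\<close>)
  then have "f (n + j) = v j" for j using fc vc by (metis r_right_minus_eq)
  then have "(\<lambda>j. f (n + j)) \<in> shift_span R f n" using v(1) by simp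
  then show "f \<in> carrier (W_rat R)"
    using shift_in_span_imp_recurrence[OF fU] rational_iff_recurrence[OF fw] by blast
qed

section \<open>Functoriality of \<open>W_rat\<close> and \<open>W_J\<close>\<close>

context ring_hom_cring
begin

lemma witt_map_W_rat:
  assumes "f \<in> carrier (W_rat R)" shows "witt_map h f \<in> carrier (W_rat S)"
proof -
  have f: "f \<in> witt_set R" using assms R.W_rat_witt_set by blast
  then have fc: "f i \<in> carrier R" for i by (auto simp: witt_set_def)
  obtain n q where q: "recurrence R f n q" "q 0 = \<one>"
    using assms R.rational_iff_recurrence[OF f] by blast
  have qc: "q i \<in> carrier R" if "i < Suc n" for i using q that by (simp add: recurrence_def)
  have "(\<Oplus>\<^bsub>S\<^esub>i\<in>{..<Suc n}. h (q i) \<otimes>\<^bsub>S\<^esub> h (f (k + n - i))) = \<zero>\<^bsub>S\<^esub>" for k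
  proof -
    have "h (\<Oplus>i\<in>{..<Suc n}. q i \<otimes> f (k + n - i)) =
      (\<Oplus>\<^bsub>S\<^esub>i\<in>{..<Suc n}. (h \<circ> (\<lambda>i. q i \<otimes> f (k + n - i))) i)"
      using qc fc by (intro hom_finsum) auto
    also have "\<dots> = (\<Oplus>\<^bsub>S\<^esub>i\<in>{..<Suc n}. h (q i) \<otimes>\<^bsub>S\<^esub> h (f (k + n - i)))"
      using qc fc by (intro S.finsum_cong2) auto
    finally show ?thesis using q by (simp add: recurrence_def)
  qed
  then have "recurrence S (witt_map h f) n (h \<circ> q)" using qc by (simp add: recurrence_def witt_map_def)
  moreover have "(h \<circ> q) 0 = \<one>\<^bsub>S\<^esub>" using q by simp
  ultimately show ?thesis using S.rational_iff_recurrence[OF witt_map_closed[OF f]] by blast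
qed

lemma witt_map_W_J:
  assumes "f \<in> carrier (W_J R)" shows "witt_map h f \<in> carrier (W_J S)"
proof -
  have f: "f \<in> witt_set R" using assms R.W_J_witt_set by blast
  then have fU: "f \<in> UNIV \<rightarrow> carrier R" by (auto simp: witt_set_def)
  obtain n where n: "n \<ge> 1" "minors_vanish R (n + 1) (hankel f)" using assms by (auto simp: W_J_def)
  have "minors_vanish S (n + 1) (hankel (witt_map h f))"
  proof (rule S.minors_vanishI)
    fix r c :: "nat \<Rightarrow> nat"
    have "h (det_in R (n + 1) (\<lambda>i j. f (r i + c j))) = det_in S (n + 1) (\<lambda>i j. h (f (r i + c j)))"
      by (rule hom_det_in) (use fU in \<open>auto simp: R.mat_in_def\<close>)
    then show "det_in S (n + 1) (\<lambda>i j. witt_map h f (r i + c j)) = \<zero>\<^bsub>S\<^esub>"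
      using R.minors_vanish_imp_all[OF fU n(2)] by (simp add: witt_map_def)
  qed
  then show ?thesis using n witt_map_closed[OF f] by (auto simp: W_J_def)
qed

end

section \<open>Tensor products\<close>

subsection \<open>Relations in a tensor product\<close>

locale tensor_pair =
  fixes R :: "('r, 'k) ring_scheme" and M :: "('r, 'm, 'x) module_scheme" and N :: "('r, 'n, 'y) module_scheme"
  assumes M: "Module.module R M" and N: "Module.module R N"
begin

abbreviation "FG \<equiv> free_Abelian_group (carrier M \<times> carrier N)"
abbreviation "TR \<equiv> tensor_rel R M N"

sublocale M: Module.module R M by (rule M)
sublocale N: Module.module R N by (rule N)

lemma tensor_rel_subgroup: "subgroup TR FG"
  unfolding tensor_rel_def
proof (rule group.generate_is_subgroup)
  have d3: "Poly_Mapping.keys (frag_of a - frag_of b - frag_of c) \<subseteq> {a, b, c}" for a b c :: "'m \<times> 'n"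
    using keys_diff[of "frag_of a - frag_of b" "frag_of c"] keys_diff[of "frag_of a" "frag_of b"]
    by (auto simp: keys_frag_of)
  have d2: "Poly_Mapping.keys (frag_of a - frag_of b) \<subseteq> {a, b}" for a b :: "'m \<times> 'n"
    using keys_diff[of "frag_of a" "frag_of b"] by (auto simp: keys_frag_of)
  show "{frag_of (x \<oplus>\<^bsub>M\<^esub> x', y) - frag_of (x, y) - frag_of (x', y) | x x' y.
         x \<in> carrier M \<and> x' \<in> carrier M \<and> y \<in> carrier N} \<union>
      {frag_of (x, y \<oplus>\<^bsub>N\<^esub> y') - frag_of (x, y) - frag_of (x, y') | x y y'.
         x \<in> carrier M \<and> y \<in> carrier N \<and> y' \<in> carrier N} \<union>
      {frag_of (r \<odot>\<^bsub>M\<^esub> x, y) - frag_of (x, r \<odot>\<^bsub>N\<^esub> y) | r x y.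
         r \<in> carrier R \<and> x \<in> carrier M \<and> y \<in> carrier N} \<subseteq> carrier FG"
    apply (clarsimp simp del: subset_iff)
    apply (intro conjI allI impI subsetI; clarsimp)
      apply (drule subsetD[OF d3], force)
     apply (drule subsetD[OF d3], force)
    apply (drule subsetD[OF d2], force)
    done
qed simp

lemma rel_keys: "p \<in> TR \<Longrightarrow> Poly_Mapping.keys p \<subseteq> carrier M \<times> carrier N"
  using subsetD[OF subgroup.subset[OF tensor_rel_subgroup]] by (simp only: carrier_free_Abelian_group_iff)

lemma rel_zero: "0 \<in> TR"
  using subgroup.one_closed[OF tensor_rel_subgroup] by simp

lemma rel_add: "p \<in> TR \<Longrightarrow> q \<in> TR \<Longrightarrow> p + q \<in> TR"
  using subgroup.m_closed[OF tensor_rel_subgroup] by simp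

lemma rel_uminus: "p \<in> TR \<Longrightarrow> - p \<in> TR"
  using subgroup.m_inv_closed[OF tensor_rel_subgroup, of p] rel_keys[of p] by simp

lemma rel_diff: "p \<in> TR \<Longrightarrow> q \<in> TR \<Longrightarrow> p - q \<in> TR"
  using rel_add[of p "- q"] rel_uminus[of q] by simp

lemma rel_sum: "(\<And>i. i \<in> I \<Longrightarrow> p i \<in> TR) \<Longrightarrow> sum p I \<in> TR"
  by (induction I rule: infinite_finite_induct) (auto intro: rel_zero rel_add)

lemma rel_add_left:
  "x \<in> carrier M \<Longrightarrow> x' \<in> carrier M \<Longrightarrow> y \<in> carrier N \<Longrightarrow>
     frag_of (x \<oplus>\<^bsub>M\<^esub> x', y) - frag_of (x, y) - frag_of (x', y) \<in> TR"
  unfolding tensor_rel_def by (rule generate.incl) blast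

lemma rel_add_right:
  "x \<in> carrier M \<Longrightarrow> y \<in> carrier N \<Longrightarrow> y' \<in> carrier N \<Longrightarrow>
     frag_of (x, y \<oplus>\<^bsub>N\<^esub> y') - frag_of (x, y) - frag_of (x, y') \<in> TR"
  unfolding tensor_rel_def by (rule generate.incl) blast

lemma rel_smult:
  "r \<in> carrier R \<Longrightarrow> x \<in> carrier M \<Longrightarrow> y \<in> carrier N \<Longrightarrow>
     frag_of (r \<odot>\<^bsub>M\<^esub> x, y) - frag_of (x, r \<odot>\<^bsub>N\<^esub> y) \<in> TR"
  unfolding tensor_rel_def by (rule generate.incl) blast

text \<open>Closure under differences covers both products and inverses in \<open>generate\<close>,
  so a map compatible with differences only has to be checked on the three kinds of
  relations.\<close>

lemma rel_induct [consumes 1, case_names zero diff add_left add_right smult]: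
  assumes "p \<in> TR" and zero: "P 0"
    and diff: "\<And>p q. p \<in> TR \<Longrightarrow> q \<in> TR \<Longrightarrow> P p \<Longrightarrow> P q \<Longrightarrow> P (p - q)"
    and "\<And>x x' y. x \<in> carrier M \<Longrightarrow> x' \<in> carrier M \<Longrightarrow> y \<in> carrier N \<Longrightarrow>
       P (frag_of (x \<oplus>\<^bsub>M\<^esub> x', y) - frag_of (x, y) - frag_of (x', y))"
    and "\<And>x y y'. x \<in> carrier M \<Longrightarrow> y \<in> carrier N \<Longrightarrow> y' \<in> carrier N \<Longrightarrow>
       P (frag_of (x, y \<oplus>\<^bsub>N\<^esub> y') - frag_of (x, y) - frag_of (x, y'))"
    and "\<And>r x y. r \<in> carrier R \<Longrightarrow> x \<in> carrier M \<Longrightarrow> y \<in> carrier N \<Longrightarrow>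
       P (frag_of (r \<odot>\<^bsub>M\<^esub> x, y) - frag_of (x, r \<odot>\<^bsub>N\<^esub> y))"
  shows "P p"
proof -
  define G where "G = {frag_of (x \<oplus>\<^bsub>M\<^esub> x', y) - frag_of (x, y) - frag_of (x', y) | x x' y.
         x \<in> carrier M \<and> x' \<in> carrier M \<and> y \<in> carrier N} \<union>
      {frag_of (x, y \<oplus>\<^bsub>N\<^esub> y') - frag_of (x, y) - frag_of (x, y') | x y y'.
         x \<in> carrier M \<and> y \<in> carrier N \<and> y' \<in> carrier N} \<union>
      {frag_of (r \<odot>\<^bsub>M\<^esub> x, y) - frag_of (x, r \<odot>\<^bsub>N\<^esub> y) | r x y.
         r \<in> carrier R \<and> x \<in> carrier M \<and> y \<in> carrier N}"
  have TR: "TR = generate FG G" unfolding G_def tensor_rel_def ..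
  have G: "P g" if "g \<in> G" for g
    using that unfolding G_def Un_iff mem_Collect_eq
  proof (elim disjE exE conjE)
    fix x x' y
    assume "g = frag_of (x \<oplus>\<^bsub>M\<^esub> x', y) - frag_of (x, y) - frag_of (x', y)"
      "x \<in> carrier M" "x' \<in> carrier M" "y \<in> carrier N"
    then show "P g" using assms(4)[of x x' y] by (simp only:)
  next
    fix x y y'
    assume "g = frag_of (x, y \<oplus>\<^bsub>N\<^esub> y') - frag_of (x, y) - frag_of (x, y')"
      "x \<in> carrier M" "y \<in> carrier N" "y' \<in> carrier N"
    then show "P g" using assms(5)[of x y y'] by (simp only:)
  next
    fix r x y
    assume "g = frag_of (r \<odot>\<^bsub>M\<^esub> x, y) - frag_of (x, r \<odot>\<^bsub>N\<^esub> y)"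
      "r \<in> carrier R" "x \<in> carrier M" "y \<in> carrier N"
    then show "P g" using assms(6)[of r x y] by (simp only:)
  qed
  have GT: "g \<in> TR" if "g \<in> G" for g unfolding TR using that by (rule generate.incl)
  have "p \<in> generate FG G" using assms(1) unfolding TR .
  then have "p \<in> TR \<and> P p"
  proof (induction p rule: generate.induct)
    case one
    show ?case using zero rel_zero by simp
  next
    case (incl p)
    then show ?case using G GT by blast
  next
    case (inv p)
    have t: "p \<in> TR" by (rule GT[OF inv])
    have "inv\<^bsub>FG\<^esub> p = 0 - p" using rel_keys[OF t] by simp
    then show ?case using t diff[OF rel_zero t zero G[OF inv]] rel_diff[OF rel_zero t] by simp
  next
    case (eng p q)
    have "P (0 - q)" "0 - q \<in> TR" using diff[OF rel_zero _ zero] rel_diff[OF rel_zero] eng by blast+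
    then have "P (p - (0 - q))" using diff eng by blast
    moreover have "p + q \<in> TR" using rel_add eng by blast
    ultimately show ?case by simp
  qed
  then show ?thesis by blast
qed

lemma coset_eq_iff:
  assumes "Poly_Mapping.keys p \<subseteq> carrier M \<times> carrier N" "Poly_Mapping.keys q \<subseteq> carrier M \<times> carrier N"
  shows "TR #>\<^bsub>FG\<^esub> p = TR #>\<^bsub>FG\<^esub> q \<longleftrightarrow> p - q \<in> TR"
proof -
  have c: "TR #>\<^bsub>FG\<^esub> p = {r + p | r. r \<in> TR}" for p by (auto simp: r_coset_def)
  show ?thesis
  proof
    assume "TR #>\<^bsub>FG\<^esub> p = TR #>\<^bsub>FG\<^esub> q"
    moreover have "0 + p \<in> TR #>\<^bsub>FG\<^esub> p" using rel_zero unfolding c by blast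
    ultimately obtain r where "r \<in> TR" "p = r + q" unfolding c by auto
    then show "p - q \<in> TR" by simp
  next
    assume pq: "p - q \<in> TR"
    show "TR #>\<^bsub>FG\<^esub> p = TR #>\<^bsub>FG\<^esub> q" unfolding c
    proof (intro equalityI subsetI; clarify)
      fix r assume "r \<in> TR"
      then show "\<exists>r'. r + p = r' + q \<and> r' \<in> TR" using rel_add[OF _ pq] by (intro exI[of _ "r + (p - q)"]) auto
      show "\<exists>r'. r + q = r' + p \<and> r' \<in> TR" using rel_diff[OF \<open>r \<in> TR\<close> pq] by (intro exI[of _ "r - (p - q)"]) auto
    qed
  qed
qed

lemma rel_finsum_right:
  assumes "finite I" "x \<in> carrier M" "\<And>i. i \<in> I \<Longrightarrow> y i \<in> carrier N"
  shows "frag_of (x, finsum N y I) - (\<Sum>i\<in>I. frag_of (x, y i)) \<in> TR"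
  using assms(1,3)
proof (induction I rule: finite_induct)
  case empty
  \<comment> \<open>Since \<open>0 + 0 = 0\<close>, this relation is the negative of the symbol with
    second entry zero.\<close>
  have "frag_of (x, \<zero>\<^bsub>N\<^esub> \<oplus>\<^bsub>N\<^esub> \<zero>\<^bsub>N\<^esub>) - frag_of (x, \<zero>\<^bsub>N\<^esub>) - frag_of (x, \<zero>\<^bsub>N\<^esub>) \<in> TR"
    by (rule rel_add_right[OF assms(2)]) auto
  then show ?case using rel_uminus by fastforce
next
  case (insert i I)
  have s: "finsum N y (insert i I) = y i \<oplus>\<^bsub>N\<^esub> finsum N y I"
    using insert by (intro N.finsum_insert) auto
  have "frag_of (x, y i \<oplus>\<^bsub>N\<^esub> finsum N y I) - frag_of (x, y i) - frag_of (x, finsum N y I) \<in> TR"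
    using insert by (intro rel_add_right[OF assms(2)] N.finsum_closed) auto
  from rel_add[OF this insert.IH] insert show ?case by (simp add: s algebra_simps)
qed

lemma rel_lincomb_left:
  assumes "finite I" "y \<in> carrier N" "\<And>i. i \<in> I \<Longrightarrow> x i \<in> carrier M" "\<And>i. i \<in> I \<Longrightarrow> c i \<in> carrier R"
  shows "frag_of (\<Oplus>\<^bsub>M\<^esub>i\<in>I. c i \<odot>\<^bsub>M\<^esub> x i, y) - (\<Sum>i\<in>I. frag_of (x i, c i \<odot>\<^bsub>N\<^esub> y)) \<in> TR"
  using assms(1,3,4)
proof (induction I rule: finite_induct)
  case empty
  have "frag_of (\<zero>\<^bsub>M\<^esub> \<oplus>\<^bsub>M\<^esub> \<zero>\<^bsub>M\<^esub>, y) - frag_of (\<zero>\<^bsub>M\<^esub>, y) - frag_of (\<zero>\<^bsub>M\<^esub>, y) \<in> TR"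
    by (rule rel_add_left[OF _ _ assms(2)]) auto
  then show ?case using rel_uminus by fastforce
next
  case (insert i I)
  let ?s = "\<Oplus>\<^bsub>M\<^esub>i\<in>I. c i \<odot>\<^bsub>M\<^esub> x i"
  have s: "(\<Oplus>\<^bsub>M\<^esub>i\<in>insert i I. c i \<odot>\<^bsub>M\<^esub> x i) = c i \<odot>\<^bsub>M\<^esub> x i \<oplus>\<^bsub>M\<^esub> ?s"
    using insert by (intro M.finsum_insert) auto
  have 1: "frag_of (c i \<odot>\<^bsub>M\<^esub> x i \<oplus>\<^bsub>M\<^esub> ?s, y) - frag_of (c i \<odot>\<^bsub>M\<^esub> x i, y) - frag_of (?s, y) \<in> TR"
    using insert by (intro rel_add_left[OF _ _ assms(2)] M.finsum_closed) auto
  have 2: "frag_of (c i \<odot>\<^bsub>M\<^esub> x i, y) - frag_of (x i, c i \<odot>\<^bsub>N\<^esub> y) \<in> TR"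
    using insert assms(2) by (intro rel_smult) auto
  from rel_add[OF rel_add[OF 1 2] insert.IH] insert show ?case by (simp add: s algebra_simps)
qed

end

subsection \<open>Induced maps\<close>

text \<open>Relations go to relations, so all representatives of a coset have images in one coset
  and \<open>the_elem\<close> in \<open>tensor_map\<close> is applied to a singleton.\<close>

lemma tensor_map_coset:
  assumes MN: "tensor_pair R M N" and MN': "tensor_pair R M' N" and f: "f \<in> linear_maps R M M'"
    and p: "Poly_Mapping.keys p \<subseteq> carrier M \<times> carrier N"
  shows "tensor_map R M' N f (tensor_rel R M N #>\<^bsub>free_Abelian_group (carrier M \<times> carrier N)\<^esub> p) =
    tensor_rel R M' N #>\<^bsub>free_Abelian_group (carrier M' \<times> carrier N)\<^esub>
      frag_extend (\<lambda>(x, y). frag_of (f x, y)) p"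
    and "Poly_Mapping.keys (frag_extend (\<lambda>(x, y). frag_of (f x, y)) p) \<subseteq> carrier M' \<times> carrier N"
proof -
  interpret T: tensor_pair R M N by fact
  interpret T': tensor_pair R M' N by fact
  let ?e = "frag_extend (\<lambda>(x, y). frag_of (f x, y))"
  have f1: "f x \<in> carrier M'" "f (x \<oplus>\<^bsub>M\<^esub> x') = f x \<oplus>\<^bsub>M'\<^esub> f x'"
    if "x \<in> carrier M" "x' \<in> carrier M" for x x'
    using f that by (auto simp: linear_maps_def hom_def)
  have f2: "f (r \<odot>\<^bsub>M\<^esub> x) = r \<odot>\<^bsub>M'\<^esub> f x" if "x \<in> carrier M" "r \<in> carrier R" for x r
    using f that by (auto simp: linear_maps_def)
  have rel: "?e c \<in> tensor_rel R M' N" if "c \<in> tensor_rel R M N" for c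
    using that
  proof (induction c rule: T.rel_induct)
    case zero then show ?case by (simp add: T'.rel_zero)
  next
    case (diff p q) then show ?case by (simp add: frag_extend_diff T'.rel_diff)
  next
    case (add_left x x' y) then show ?case
      using T'.rel_add_left[of "f x" "f x'" y] f1 by (simp add: frag_extend_diff)
  next
    case (add_right x y y') then show ?case
      using T'.rel_add_right[of "f x" y y'] f1 by (simp add: frag_extend_diff)
  next
    case (smult r x y) then show ?case
      using T'.rel_smult[of r "f x" y] f1 f2 by (simp add: frag_extend_diff)
  qed
  have keys: "Poly_Mapping.keys (?e c) \<subseteq> carrier M' \<times> carrier N" if "Poly_Mapping.keys c \<subseteq> carrier M \<times> carrier N" for c
  proof
    fix z assume "z \<in> Poly_Mapping.keys (?e c)"
    then obtain x y where xy: "(x, y) \<in> Poly_Mapping.keys c" and z: "z = (f x, y)"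
      using subsetD[OF keys_frag_extend] by (fastforce simp: keys_frag_of)
    then have "x \<in> carrier M" "y \<in> carrier N" using that by auto
    then show "z \<in> carrier M' \<times> carrier N" using f1(1) z by simp
  qed
  then show "Poly_Mapping.keys (?e p) \<subseteq> carrier M' \<times> carrier N" using p .
  have "(\<lambda>c. T'.TR #>\<^bsub>T'.FG\<^esub> ?e c) ` (T.TR #>\<^bsub>T.FG\<^esub> p) = {T'.TR #>\<^bsub>T'.FG\<^esub> ?e p}"
  proof -
    have 1: "T'.TR #>\<^bsub>T'.FG\<^esub> ?e (r + p) = T'.TR #>\<^bsub>T'.FG\<^esub> ?e p" if r: "r \<in> T.TR" for r
      using rel[OF r] keys[OF p] keys[OF T.rel_keys[OF r]] keys_add[of "?e r" "?e p"]
      by (subst T'.coset_eq_iff) (auto simp: frag_extend_add)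
    have 2: "0 + p \<in> T.TR #>\<^bsub>T.FG\<^esub> p" using T.rel_zero by (auto simp: r_coset_def)
    show ?thesis
    proof (intro equalityI subsetI)
      fix z assume "z \<in> (\<lambda>c. T'.TR #>\<^bsub>T'.FG\<^esub> ?e c) ` (T.TR #>\<^bsub>T.FG\<^esub> p)"
      then obtain c where c: "c \<in> T.TR #>\<^bsub>T.FG\<^esub> p" "z = T'.TR #>\<^bsub>T'.FG\<^esub> ?e c" by (rule imageE)
      then obtain r where "r \<in> T.TR" "c = r + p" by (auto simp: r_coset_def)
      then show "z \<in> {T'.TR #>\<^bsub>T'.FG\<^esub> ?e p}" using 1 c(2) by simp
    next
      fix z assume "z \<in> {T'.TR #>\<^bsub>T'.FG\<^esub> ?e p}"
      then show "z \<in> (\<lambda>c. T'.TR #>\<^bsub>T'.FG\<^esub> ?e c) ` (T.TR #>\<^bsub>T.FG\<^esub> p)"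
        using image_eqI[OF _ 2, of z "\<lambda>c. T'.TR #>\<^bsub>T'.FG\<^esub> ?e c"] by simp
    qed
  qed
  then show "tensor_map R M' N f (T.TR #>\<^bsub>T.FG\<^esub> p) = T'.TR #>\<^bsub>T'.FG\<^esub> ?e p"
    by (simp add: tensor_map_def)
qed

lemma (in ring_hom_cring) scalars_along_module: "Module.module R (scalars_along h S)"
  by (rule moduleI)
    (auto simp: scalars_along_def R.is_cring S.m_assoc S.l_distr S.r_distr
      intro!: abelian_groupI S.a_comm S.a_assoc intro: S.l_neg)

lemma carrier_scalars_along [simp]:
  "carrier (scalars_along h B) = carrier B" "add (scalars_along h B) = add B"
  "ring.zero (scalars_along h B) = ring.zero B" "smult (scalars_along h B) = (\<lambda>r x. h r \<otimes>\<^bsub>B\<^esub> x)"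
  by (simp_all add: scalars_along_def)

lemma finsum_scalars_along [simp]: "finsum (scalars_along h B) = finsum B"
  by (intro ext) (simp add: finsum_def finprod_def)

text \<open>The universal property of the free abelian group, phrased with differences to fit
  \<open>rel_induct\<close>.\<close>

lemma (in cring) frag_hom:
  assumes f: "\<And>s. s \<in> S \<Longrightarrow> f s \<in> carrier R"
  shows "\<exists>\<Phi>. (\<forall>p. Poly_Mapping.keys p \<subseteq> S \<longrightarrow> \<Phi> p \<in> carrier R) \<and>
    (\<forall>p q. Poly_Mapping.keys p \<subseteq> S \<longrightarrow> Poly_Mapping.keys q \<subseteq> S \<longrightarrow> \<Phi> (p - q) = \<Phi> p \<ominus> \<Phi> q) \<and>
    (\<forall>s\<in>S. \<Phi> (frag_of s) = f s)"
proof -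
  have im: "f ` S \<subseteq> carrier (add_monoid R)" using f by auto
  obtain \<Phi> where \<Phi>: "\<Phi> \<in> hom (free_Abelian_group S) (add_monoid R)" "\<And>s. s \<in> S \<Longrightarrow> \<Phi> (frag_of s) = f s"
    using comm_group.free_Abelian_group_universal[OF a_comm_group im] by blast
  have c: "\<Phi> p \<in> carrier R" if "Poly_Mapping.keys p \<subseteq> S" for p
    using \<Phi>(1) that by (auto simp: hom_def)
  have "\<Phi> (p - q) = \<Phi> p \<ominus> \<Phi> q" if "Poly_Mapping.keys p \<subseteq> S" "Poly_Mapping.keys q \<subseteq> S" for p q
  proof -
    have k: "Poly_Mapping.keys (p - q) \<subseteq> S" using that keys_diff[of p q] by blast
    have "\<Phi> ((p - q) + q) = \<Phi> (p - q) \<oplus> \<Phi> q"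
      using hom_mult[OF \<Phi>(1), of "p - q" q] k that(2) by simp
    then show ?thesis using c[OF k] c[OF that(2)] by (simp add: a_minus_def a_assoc r_neg)
  qed
  then show ?thesis using c \<Phi>(2) by blast
qed

text \<open>A linear map \<open>g\<close> from \<open>M\<close> to \<open>S\<close> extends to the
  tensor product of \<open>M\<close> with \<open>S\<close>. For a coordinate of \<open>R^n\<close>
  the extension reads off the coordinate of a vector over \<open>S\<close>.\<close>

lemma (in ring_hom_cring) tensor_functional:
  assumes M: "Module.module R M" and g: "\<And>x. x \<in> carrier M \<Longrightarrow> g x \<in> carrier S"
    "\<And>x y. x \<in> carrier M \<Longrightarrow> y \<in> carrier M \<Longrightarrow> g (x \<oplus>\<^bsub>M\<^esub> y) = g x \<oplus>\<^bsub>S\<^esub> g y"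
    "\<And>r x. r \<in> carrier R \<Longrightarrow> x \<in> carrier M \<Longrightarrow> g (r \<odot>\<^bsub>M\<^esub> x) = h r \<otimes>\<^bsub>S\<^esub> g x"
  obtains \<Phi> where
    "\<And>p. Poly_Mapping.keys p \<subseteq> carrier M \<times> carrier S \<Longrightarrow> \<Phi> p \<in> carrier S"
    "\<And>p q. Poly_Mapping.keys p \<subseteq> carrier M \<times> carrier S \<Longrightarrow> Poly_Mapping.keys q \<subseteq> carrier M \<times> carrier S \<Longrightarrow> \<Phi> (p - q) = \<Phi> p \<ominus>\<^bsub>S\<^esub> \<Phi> q"
    "\<And>x y. x \<in> carrier M \<Longrightarrow> y \<in> carrier S \<Longrightarrow> \<Phi> (frag_of (x, y)) = g x \<otimes>\<^bsub>S\<^esub> y"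
    "\<And>p. p \<in> tensor_rel R M (scalars_along h S) \<Longrightarrow> \<Phi> p = \<zero>\<^bsub>S\<^esub>"
proof -
  interpret T: tensor_pair R M "scalars_along h S"
    by (intro tensor_pair.intro M scalars_along_module)
  have "(\<lambda>(x, y). g x \<otimes>\<^bsub>S\<^esub> y) p \<in> carrier S" if "p \<in> carrier M \<times> carrier S" for p
    using that g(1) by auto
  then have "\<exists>\<Phi>. (\<forall>p. Poly_Mapping.keys p \<subseteq> carrier M \<times> carrier S \<longrightarrow> \<Phi> p \<in> carrier S) \<and>
      (\<forall>p q. Poly_Mapping.keys p \<subseteq> carrier M \<times> carrier S \<longrightarrow> Poly_Mapping.keys q \<subseteq> carrier M \<times> carrier S \<longrightarrow>
        \<Phi> (p - q) = \<Phi> p \<ominus>\<^bsub>S\<^esub> \<Phi> q) \<and>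
      (\<forall>p\<in>carrier M \<times> carrier S. \<Phi> (frag_of p) = (\<lambda>(x, y). g x \<otimes>\<^bsub>S\<^esub> y) p)"
    by (rule S.frag_hom)
  then obtain \<Phi> where
    \<Phi>: "\<forall>p. Poly_Mapping.keys p \<subseteq> carrier M \<times> carrier S \<longrightarrow> \<Phi> p \<in> carrier S"
    "\<forall>p q. Poly_Mapping.keys p \<subseteq> carrier M \<times> carrier S \<longrightarrow> Poly_Mapping.keys q \<subseteq> carrier M \<times> carrier S \<longrightarrow>
      \<Phi> (p - q) = \<Phi> p \<ominus>\<^bsub>S\<^esub> \<Phi> q"
    and f': "\<forall>p\<in>carrier M \<times> carrier S. \<Phi> (frag_of p) = (\<lambda>(x, y). g x \<otimes>\<^bsub>S\<^esub> y) p"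
    by (elim exE conjE)
  note c = \<Phi>(1)[rule_format] and d = \<Phi>(2)[rule_format]
  have z: "\<Phi> 0 = \<zero>\<^bsub>S\<^esub>" using d[of 0 0] c[of 0] by (simp add: a_minus_def S.r_neg)
  have f: "\<Phi> (frag_of (x, y)) = g x \<otimes>\<^bsub>S\<^esub> y" if "x \<in> carrier M" "y \<in> carrier S" for x y
    using bspec[OF f', of "(x, y)"] that by simp
  have kd: "Poly_Mapping.keys (frag_of a - frag_of b) \<subseteq> carrier M \<times> carrier S"
    if "a \<in> carrier M \<times> carrier S" "b \<in> carrier M \<times> carrier S" for a b :: "_ \<times> _"
    using that keys_diff[of "frag_of a" "frag_of b"] by (auto simp: keys_frag_of)
  have "\<Phi> p = \<zero>\<^bsub>S\<^esub>" if "p \<in> tensor_rel R M (scalars_along h S)" for p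
    using that
  proof (induction p rule: T.rel_induct)
    case zero then show ?case by (rule z)
  next
    case (diff p q) then show ?case
      using d T.rel_keys[of p] T.rel_keys[of q] by (simp add: a_minus_def)
  next
    case (add_left x x' y) then show ?case
      using g by (simp add: d f kd keys_frag_of S.l_distr) (simp add: S.minus_eq S.a_ac S.r_neg S.r_neg2 S.r_neg1)
  next
    case (add_right x y y') then show ?case
      using g by (simp add: d f kd keys_frag_of S.r_distr) (simp add: S.minus_eq S.a_ac S.r_neg S.r_neg2 S.r_neg1)
  next
    case (smult r x y) then show ?case
      using g by (simp add: d f keys_frag_of S.m_ac S.minus_eq S.r_neg)
  qed
  then show ?thesis using that c d f by blast
qed

section \<open>Flatness and linear equations\<close>

text \<open>A sequence is wrapped into a singleton because the test modules in
  \<open>flat_module\<close> have sets of sequences as elements. The multiplicative fields are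
  fillers demanded by the record type.\<close>

definition seq_module :: "('a, 'm) ring_scheme \<Rightarrow> (nat \<Rightarrow> 'a) set \<Rightarrow> ('a, (nat \<Rightarrow> 'a) set) module" where
  "seq_module R N = \<lparr>carrier = (\<lambda>v. {v}) ` N, monoid.mult = (\<lambda>U V. U), one = {},
     ring.zero = {\<lambda>_. \<zero>\<^bsub>R\<^esub>}, add = (\<lambda>U V. {\<lambda>i. the_elem U i \<oplus>\<^bsub>R\<^esub> the_elem V i}),
     smult = (\<lambda>a U. {\<lambda>i. a \<otimes>\<^bsub>R\<^esub> the_elem U i})\<rparr>"

definition vecs :: "('a, 'm) ring_scheme \<Rightarrow> nat \<Rightarrow> (nat \<Rightarrow> 'a) set" where
  "vecs R n = {v \<in> UNIV \<rightarrow> carrier R. \<forall>i\<ge>n. v i = \<zero>\<^bsub>R\<^esub>}"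

lemma seq_module_simps [simp]:
  "carrier (seq_module R N) = (\<lambda>v. {v}) ` N"
  "\<zero>\<^bsub>seq_module R N\<^esub> = {\<lambda>_. \<zero>\<^bsub>R\<^esub>}"
  "{v} \<oplus>\<^bsub>seq_module R N\<^esub> {w} = {\<lambda>i. v i \<oplus>\<^bsub>R\<^esub> w i}"
  "a \<odot>\<^bsub>seq_module R N\<^esub> {v} = {\<lambda>i. a \<otimes>\<^bsub>R\<^esub> v i}"
  by (simp_all add: seq_module_def)

context cring
begin

lemma vec_closed_vecs: "vec_closed R (vecs R n)"
  by (auto simp: vec_closed_def vecs_def Pi_iff)

lemma seq_module:
  assumes N: "vec_closed R N"
  shows "Module.module R (seq_module R N)"
proof (rule moduleI)
  note D = vec_closedD[OF N]
  show "cring R" by (rule is_cring)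
  show "abelian_group (seq_module R N)"
  proof (rule abelian_groupI)
    fix U assume "U \<in> carrier (seq_module R N)"
    then obtain v where v: "v \<in> N" "U = {v}" by auto
    have "(\<lambda>i. \<ominus> \<one> \<otimes> v i) \<in> N" using D(4) v by simp
    moreover have "{\<lambda>i. \<ominus> \<one> \<otimes> v i} \<oplus>\<^bsub>seq_module R N\<^esub> U = \<zero>\<^bsub>seq_module R N\<^esub>"
      using v D(1) by (auto simp: l_minus l_neg)
    ultimately show "\<exists>V\<in>carrier (seq_module R N). V \<oplus>\<^bsub>seq_module R N\<^esub> U = \<zero>\<^bsub>seq_module R N\<^esub>"
      by auto
  qed (use D in \<open>auto simp: a_ac\<close>)
qed (use vec_closedD[OF N] in \<open>auto simp: l_distr r_distr m_assoc\<close>)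

lemma finsum_seq_module:
  assumes N: "vec_closed R N" and I: "finite I" and v: "\<And>i. i \<in> I \<Longrightarrow> v i \<in> N"
    and c: "\<And>i. i \<in> I \<Longrightarrow> c i \<in> carrier R"
  shows "(\<Oplus>\<^bsub>seq_module R N\<^esub>i\<in>I. c i \<odot>\<^bsub>seq_module R N\<^esub> {v i}) = {\<lambda>j. \<Oplus>i\<in>I. c i \<otimes> v i j}"
proof -
  interpret M: Module.module R "seq_module R N" by (rule seq_module[OF N])
  show ?thesis using I v c
  proof (induction I rule: finite_induct)
    case empty then show ?case by simp
  next
    case (insert i I)
    have "(\<Oplus>\<^bsub>seq_module R N\<^esub>i\<in>insert i I. c i \<odot>\<^bsub>seq_module R N\<^esub> {v i}) =
      c i \<odot>\<^bsub>seq_module R N\<^esub> {v i} \<oplus>\<^bsub>seq_module R N\<^esub> (\<Oplus>\<^bsub>seq_module R N\<^esub>i\<in>I. c i \<odot>\<^bsub>seq_module R N\<^esub> {v i})"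
      using insert vec_closedD(4)[OF N] by (intro M.finsum_insert) auto
    also have "\<dots> = {\<lambda>j. c i \<otimes> v i j \<oplus> (\<Oplus>i\<in>I. c i \<otimes> v i j)}" using insert by simp
    also have "\<dots> = {\<lambda>j. \<Oplus>i\<in>insert i I. c i \<otimes> v i j}"
      using insert vec_closedD(1)[OF N] by (subst finsum_insert) (auto simp: fun_eq_iff)
    finally show ?case .
  qed
qed

end

lemma (in cring) add_minus_cancel_left:
  "a \<in> carrier R \<Longrightarrow> b \<in> carrier R \<Longrightarrow> b \<oplus> (a \<ominus> b) = a"
  by (simp add: a_minus_def a_lcomm[of b a] r_neg)

text \<open>Exactness of the tensored sequence, pulled back to representatives in the free abelian
  groups, where elements can be computed with.\<close>

lemma exact_at_imp_lift:
  assumes flat: "flat_module R N"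
    and M1: "Module.module R (M1 :: ('r, (nat \<Rightarrow> 'r) set) module)"
    and M2: "Module.module R (M2 :: ('r, (nat \<Rightarrow> 'r) set) module)"
    and M3: "Module.module R (M3 :: ('r, (nat \<Rightarrow> 'r) set) module)"
    and f: "f \<in> linear_maps R M1 M2" and g: "g \<in> linear_maps R M2 M3"
    and ex: "f ` carrier M1 = a_kernel M2 M3 g"
    and p: "Poly_Mapping.keys p \<subseteq> carrier M2 \<times> carrier N"
    and gp: "frag_extend (\<lambda>(x, y). frag_of (g x, y)) p \<in> tensor_rel R M3 N"
  obtains p1 where "Poly_Mapping.keys p1 \<subseteq> carrier M1 \<times> carrier N"
    "Poly_Mapping.keys (frag_extend (\<lambda>(x, y). frag_of (f x, y)) p1) \<subseteq> carrier M2 \<times> carrier N"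
    "p - frag_extend (\<lambda>(x, y). frag_of (f x, y)) p1 \<in> tensor_rel R M2 N"
proof -
  have N: "Module.module R N" using flat by (simp add: flat_module_def)
  interpret T1: tensor_pair R M1 N by (intro tensor_pair.intro M1 N)
  interpret T2: tensor_pair R M2 N by (intro tensor_pair.intro M2 N)
  interpret T3: tensor_pair R M3 N by (intro tensor_pair.intro M3 N)
  note T = T1.tensor_pair_axioms T2.tensor_pair_axioms T3.tensor_pair_axioms
  have ex': "tensor_map R M2 N f ` carrier (tensor_group R M1 N) =
      kernel (tensor_group R M2 N) (tensor_group R M3 N) (tensor_map R M3 N g)"
    using flat M1 M2 M3 f g ex unfolding flat_module_def by blast
  have car: "carrier (tensor_group R M N) = {tensor_rel R M N #>\<^bsub>free_Abelian_group (carrier M \<times> carrier N)\<^esub> p | p.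
      Poly_Mapping.keys p \<subseteq> carrier M \<times> carrier N}" for M :: "('r, (nat \<Rightarrow> 'r) set) module"
    by (auto simp: tensor_group_def FactGroup_def RCOSETS_def)
  have one: "\<one>\<^bsub>tensor_group R M3 N\<^esub> = T3.TR" by (simp add: tensor_group_def FactGroup_def)
  have "tensor_map R M3 N g (T2.TR #>\<^bsub>T2.FG\<^esub> p) =
      T3.TR #>\<^bsub>T3.FG\<^esub> frag_extend (\<lambda>(x, y). frag_of (g x, y)) p"
    by (rule tensor_map_coset(1)[OF T(2,3) g p])
  also have "\<dots> = T3.TR #>\<^bsub>T3.FG\<^esub> 0"
    using gp tensor_map_coset(2)[OF T(2,3) g p] by (subst T3.coset_eq_iff) auto
  also have "\<dots> = T3.TR" by (auto simp: r_coset_def)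
  finally have "T2.TR #>\<^bsub>T2.FG\<^esub> p \<in> kernel (tensor_group R M2 N) (tensor_group R M3 N) (tensor_map R M3 N g)"
    using p by (auto simp: kernel_def one car)
  then obtain p1 where p1: "Poly_Mapping.keys p1 \<subseteq> carrier M1 \<times> carrier N"
    "T2.TR #>\<^bsub>T2.FG\<^esub> p = tensor_map R M2 N f (T1.TR #>\<^bsub>T1.FG\<^esub> p1)"
    unfolding ex'[symmetric] car by blast
  then have "T2.TR #>\<^bsub>T2.FG\<^esub> p = T2.TR #>\<^bsub>T2.FG\<^esub> frag_extend (\<lambda>(x, y). frag_of (f x, y)) p1"
    using tensor_map_coset(1)[OF T(1,2) f] by simp
  then have "p - frag_extend (\<lambda>(x, y). frag_of (f x, y)) p1 \<in> T2.TR"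
    using T2.coset_eq_iff[OF p tensor_map_coset(2)[OF T(1,2) f p1(1)]] by simp
  then show ?thesis using that p1 tensor_map_coset(2)[OF T(1,2) f p1(1)] by blast
qed

text \<open>
  The equational criterion for flatness, for the infinitely many linear equations over \<open>R\<close> satisfied
  by \<open>b \<in> S\<^sup>n\<close>: as \<open>R\<close> is Noetherian they amount to finitely many, and then \<open>b\<close> is an
  \<open>S\<close>-linear combination of solutions in \<open>R\<^sup>n\<close>.  The conclusion is tested on an ideal.
\<close>

theorem (in ring_hom_cring) flat_solution_in_ideal:
  assumes noeth: "noetherian_ring R" and flat: "flat_module R (scalars_along h S)"
    and Q: "ideal Q S" and b: "\<And>i. i < n \<Longrightarrow> b i \<in> carrier S" and l: "l < n"
    and sol: "\<And>u. u \<in> vecs R n \<Longrightarrow> (\<And>r. r \<in> UNIV \<rightarrow> carrier R \<Longrightarrow>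
        (\<Oplus>\<^bsub>S\<^esub>i\<in>{..<n}. h (r i) \<otimes>\<^bsub>S\<^esub> b i) = \<zero>\<^bsub>S\<^esub> \<Longrightarrow>
        (\<Oplus>i\<in>{..<n}. r i \<otimes> u i) = \<zero>) \<Longrightarrow> h (u l) \<in> Q"
  shows "b l \<in> Q"
proof -
  let ?N = "scalars_along h S"
  interpret Q: ideal Q S by (rule Q)
  \<comment> \<open>The relations over \<open>R\<close> between the \<open>b i\<close>, a submodule
    of \<open>R^n\<close>.\<close>
  define B where "B = {r \<in> vecs R n. (\<Oplus>\<^bsub>S\<^esub>i\<in>{..<n}. h (r i) \<otimes>\<^bsub>S\<^esub> b i) = \<zero>\<^bsub>S\<^esub>}"
  have B: "vec_closed R B"
  proof -
    define Z where "Z = {v \<in> UNIV \<rightarrow> carrier S. (\<Oplus>\<^bsub>S\<^esub>s\<in>{..<n}. v (id s) \<otimes>\<^bsub>S\<^esub> b s) = \<zero>\<^bsub>S\<^esub>}"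
    have K: "vec_closed S Z" unfolding Z_def by (rule S.vec_closed_kernel) (auto simp: b)
    have iff: "r \<in> B \<longleftrightarrow> r \<in> vecs R n \<and> h \<circ> r \<in> Z" for r
      by (auto simp: B_def vecs_def Z_def Pi_iff)
    note V = R.vec_closedD[OF R.vec_closed_vecs[of n]]
    show ?thesis unfolding vec_closed_def
    proof (intro conjI ballI)
      show "B \<subseteq> UNIV \<rightarrow> carrier R" by (auto simp: B_def vecs_def)
      have "h \<circ> (\<lambda>_. \<zero>) = (\<lambda>_. \<zero>\<^bsub>S\<^esub>)" by auto
      then have "h \<circ> (\<lambda>_. \<zero>) \<in> Z" by (rule ssubst) (rule S.vec_closedD(2)[OF K])
      then show "(\<lambda>_. \<zero>) \<in> B" unfolding iff using V(2) by blast
    next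
      fix v w assume "v \<in> B" "w \<in> B"
      then have vw: "v \<in> vecs R n" "w \<in> vecs R n" "h \<circ> v \<in> Z" "h \<circ> w \<in> Z" unfolding iff by simp_all
      have "h \<circ> (\<lambda>i. v i \<oplus> w i) = (\<lambda>i. (h \<circ> v) i \<oplus>\<^bsub>S\<^esub> (h \<circ> w) i)"
        using V(1)[OF vw(1)] V(1)[OF vw(2)] by (simp add: fun_eq_iff)
      then show "(\<lambda>i. v i \<oplus> w i) \<in> B"
        unfolding iff using V(3)[OF vw(1,2)] S.vec_closedD(3)[OF K vw(3,4)] by simp
    next
      fix a v assume a: "a \<in> carrier R" and "v \<in> B"
      then have v: "v \<in> vecs R n" "h \<circ> v \<in> Z" unfolding iff by simp_all
      have "h \<circ> (\<lambda>i. a \<otimes> v i) = (\<lambda>i. h a \<otimes>\<^bsub>S\<^esub> (h \<circ> v) i)"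
        using V(1)[OF v(1)] a by (simp add: fun_eq_iff)
      then show "(\<lambda>i. a \<otimes> v i) \<in> B"
        unfolding iff using V(4)[OF a v(1)] S.vec_closedD(4)[OF K hom_closed[OF a] v(2)] by simp
    qed
  qed
  obtain F where F: "finite F" "F \<subseteq> B" "\<And>N'. vec_closed R N' \<Longrightarrow> F \<subseteq> N' \<Longrightarrow> B \<subseteq> N'"
    using R.vec_closed_finitely_generated[OF noeth B, of n] by (auto simp: B_def vecs_def)
  \<comment> \<open>The generating relations become the rows of a matrix with \<open>m\<close>
    rows.\<close>
  obtain \<rho> and m :: nat where \<rho>: "F = \<rho> ` {..<m}"
    using F(1) by (metis finite_imp_nat_seg_image_inj_on lessThan_def)
  have \<rho>B: "\<rho> k \<in> B" if "k < m" for k using F(2) \<rho> that by blast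
  then have \<rho>c: "\<rho> k i \<in> carrier R" if "k < m" for k i using that R.vec_closedD(1)[OF B] by blast
  have \<rho>b: "(\<Oplus>\<^bsub>S\<^esub>i\<in>{..<n}. h (\<rho> k i) \<otimes>\<^bsub>S\<^esub> b i) = \<zero>\<^bsub>S\<^esub>" if "k < m" for k
    using \<rho>B[OF that] by (simp add: B_def)
  \<comment> \<open>The matrix as a map from \<open>R^n\<close> to \<open>R^m\<close>; the value
    zero from \<open>m\<close> on keeps it inside \<open>vecs R m\<close>.\<close>
  define g where "g = (\<lambda>v k. if k < m then \<Oplus>i\<in>{..<n}. v i \<otimes> \<rho> k i else \<zero>)"
  note V = R.vec_closedD[OF R.vec_closed_vecs]
  have gc: "g v k \<in> carrier R" if "v \<in> vecs R n" for v k
    using that V(1)[OF that] \<rho>c by (auto simp: g_def intro!: R.finsum_closed)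
  then have gv: "g v \<in> vecs R m" if "v \<in> vecs R n" for v using that by (auto simp: vecs_def g_def)
  have g_add: "g (\<lambda>i. v i \<oplus> w i) = (\<lambda>k. g v k \<oplus> g w k)" if "v \<in> vecs R n" "w \<in> vecs R n" for v w
  proof
    fix k show "g (\<lambda>i. v i \<oplus> w i) k = g v k \<oplus> g w k"
    proof (cases "k < m")
      case True
      have "(\<Oplus>i\<in>{..<n}. (v i \<oplus> w i) \<otimes> \<rho> k i) =
          (\<Oplus>i\<in>{..<n}. v i \<otimes> \<rho> k i \<oplus> w i \<otimes> \<rho> k i)"
        using V(1)[OF that(1)] V(1)[OF that(2)] \<rho>c[OF True] by (intro R.finsum_cong2) (auto simp: R.l_distr)
      also have "\<dots> = (\<Oplus>i\<in>{..<n}. v i \<otimes> \<rho> k i) \<oplus> (\<Oplus>i\<in>{..<n}. w i \<otimes> \<rho> k i)"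
        using V(1)[OF that(1)] V(1)[OF that(2)] \<rho>c[OF True] by (intro R.finsum_addf) auto
      finally show ?thesis using True by (simp add: g_def)
    qed (simp add: g_def)
  qed
  have g_smult: "g (\<lambda>i. a \<otimes> v i) = (\<lambda>k. a \<otimes> g v k)" if "v \<in> vecs R n" "a \<in> carrier R" for v a
  proof
    fix k show "g (\<lambda>i. a \<otimes> v i) k = a \<otimes> g v k"
    proof (cases "k < m")
      case True
      have "(\<Oplus>i\<in>{..<n}. (a \<otimes> v i) \<otimes> \<rho> k i) = (\<Oplus>i\<in>{..<n}. a \<otimes> (v i \<otimes> \<rho> k i))"
        using V(1)[OF that(1)] that(2) \<rho>c[OF True] by (intro R.finsum_cong2) (auto simp: R.m_assoc)
      also have "\<dots> = a \<otimes> (\<Oplus>i\<in>{..<n}. v i \<otimes> \<rho> k i)"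
        using V(1)[OF that(1)] that(2) \<rho>c[OF True] by (intro R.finsum_rdistr[symmetric]) auto
      finally show ?thesis using True by (simp add: g_def)
    qed (use that in \<open>simp add: g_def\<close>)
  qed
  \<comment> \<open>Solutions in \<open>R^n\<close> of the generating equations. As these generate
    \<open>B\<close>, such a solution satisfies all equations satisfied by \<open>b\<close>.\<close>
  define K where "K = {v \<in> vecs R n. g v = (\<lambda>_. \<zero>)}"
  have K: "vec_closed R K"
    using V g_add g_smult by (auto simp: vec_closed_def K_def) (auto simp: g_def fun_eq_iff \<rho>c)
  have KQ: "h (u l) \<in> Q" if u: "u \<in> K" for u
  proof (rule sol)
    show uv: "u \<in> vecs R n" using u by (simp add: K_def)
    fix r assume r: "r \<in> UNIV \<rightarrow> carrier R" "(\<Oplus>\<^bsub>S\<^esub>i\<in>{..<n}. h (r i) \<otimes>\<^bsub>S\<^esub> b i) = \<zero>\<^bsub>S\<^esub>"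
    let ?Z = "{v \<in> UNIV \<rightarrow> carrier R. (\<Oplus>s\<in>{..<n}. v (id s) \<otimes> u s) = \<zero>}"
    have Z: "vec_closed R ?Z" by (rule R.vec_closed_kernel) (auto simp: V(1)[OF uv])
    have "\<rho> k \<in> ?Z" if k: "k < m" for k
    proof -
      have "(\<Oplus>s\<in>{..<n}. \<rho> k (id s) \<otimes> u s) = g u k"
        using k \<rho>c[OF k] V(1)[OF uv] by (simp add: g_def) (intro R.finsum_cong2, auto simp: R.m_comm)
      then show ?thesis using u \<rho>c[OF k] by (simp add: K_def)
    qed
    then have "B \<subseteq> ?Z" using F(3)[OF Z] \<rho> by blast
    \<comment> \<open>The rows in \<open>sol\<close> are arbitrary sequences; cutting them off at
      \<open>n\<close> puts them into \<open>B\<close> without changing the sums.\<close>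
    moreover have "(\<lambda>i. if i < n then r i else \<zero>) \<in> B"
    proof -
      have "(\<Oplus>\<^bsub>S\<^esub>i\<in>{..<n}. h (if i < n then r i else \<zero>) \<otimes>\<^bsub>S\<^esub> b i) = (\<Oplus>\<^bsub>S\<^esub>i\<in>{..<n}. h (r i) \<otimes>\<^bsub>S\<^esub> b i)"
        using r b by (intro S.finsum_cong2) (auto simp: Pi_iff)
      then show ?thesis using r by (auto simp: B_def vecs_def)
    qed
    ultimately have "(\<Oplus>s\<in>{..<n}. (if s < n then r s else \<zero>) \<otimes> u s) = \<zero>" by auto
    moreover have "(\<Oplus>s\<in>{..<n}. (if s < n then r s else \<zero>) \<otimes> u s) = (\<Oplus>s\<in>{..<n}. r s \<otimes> u s)"
      using r V(1)[OF uv] by (intro R.finsum_cong2) (auto simp: Pi_iff)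
    ultimately show "(\<Oplus>s\<in>{..<n}. r s \<otimes> u s) = \<zero>" by simp
  qed
  let ?M1 = "seq_module R K" and ?M2 = "seq_module R (vecs R n)" and ?M3 = "seq_module R (vecs R m)"
  let ?g = "\<lambda>U. {g (the_elem U)}"
  have M: "Module.module R ?M1" "Module.module R ?M2" "Module.module R ?M3"
    by (intro R.seq_module K R.vec_closed_vecs)+
  interpret T2: tensor_pair R ?M2 ?N by (intro tensor_pair.intro M scalars_along_module)
  interpret T3: tensor_pair R ?M3 ?N by (intro tensor_pair.intro M scalars_along_module)
  have f: "id \<in> linear_maps R ?M1 ?M2"
    by (auto simp: linear_maps_def hom_def K_def)
  have gl: "?g \<in> linear_maps R ?M2 ?M3"
    by (auto simp: linear_maps_def hom_def gv g_add g_smult)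
  \<comment> \<open>Exactness of \<open>K \<rightarrow> R^n \<rightarrow> R^m\<close> in the middle,
    which flatness preserves under tensoring with \<open>S\<close>.\<close>
  have ex: "id ` carrier ?M1 = a_kernel ?M2 ?M3 ?g"
    by (auto simp: a_kernel_def kernel_def K_def)
  have uv: "R.unit_row i \<in> vecs R k" if "i < k" for i k using that by (auto simp: vecs_def R.unit_row_def)
  \<comment> \<open>The vector \<open>b\<close> as an element of \<open>R^n \<otimes> S\<close>, the
    sum of the \<open>e_i \<otimes> b i\<close> over the standard basis.\<close>
  define p where "p = (\<Sum>i<n. frag_of ({R.unit_row i}, b i))"
  have p_keys: "Poly_Mapping.keys p \<subseteq> carrier ?M2 \<times> carrier ?N"
  proof -
    have "p \<in> carrier (free_Abelian_group (carrier ?M2 \<times> carrier ?N))"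
      unfolding p_def by (rule sum_closed_free_Abelian_group) (use uv b in auto)
    then show ?thesis by (simp only: carrier_free_Abelian_group_iff)
  qed
  \<comment> \<open>The image of \<open>p\<close> is the sum of all
    \<open>\<rho> k i e_k \<otimes> b i\<close>. Moving the scalars to the right and summing over
    \<open>i\<close> turns it into a sum of terms \<open>e_k \<otimes> 0\<close>.\<close>
  have "frag_extend (\<lambda>(x, y). frag_of (?g x, y)) p \<in> tensor_rel R ?M3 ?N"
  proof -
    have ext: "frag_extend (\<lambda>(x, y). frag_of (?g x, y)) p = (\<Sum>i<n. frag_of ({g (R.unit_row i)}, b i))"
      by (simp add: p_def frag_extend_sum)
    have gu: "{g (R.unit_row i)} = (\<Oplus>\<^bsub>?M3\<^esub>k\<in>{..<m}. \<rho> k i \<odot>\<^bsub>?M3\<^esub> {R.unit_row k})" if i: "i < n" for i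
    proof -
      have "g (R.unit_row i) j = (\<Oplus>k\<in>{..<m}. \<rho> k i \<otimes> R.unit_row k j)" for j
      proof (cases "j < m")
        case True
        have "g (R.unit_row i) j = (\<Oplus>s\<in>{..<n}. if i = s then \<rho> j s else \<zero>)"
          using True \<rho>c[OF True] by (simp add: g_def) (intro R.finsum_cong2, auto simp: R.unit_row_def)
        also have "\<dots> = \<rho> j i" using i \<rho>c[OF True] by (intro R.add.finprod_singleton) auto
        also have "\<dots> = (\<Oplus>k\<in>{..<m}. if j = k then \<rho> k i else \<zero>)"
          using True \<rho>c by (intro R.add.finprod_singleton[symmetric]) auto
        also have "\<dots> = (\<Oplus>k\<in>{..<m}. \<rho> k i \<otimes> R.unit_row k j)"
          using \<rho>c by (intro R.finsum_cong2) (auto simp: R.unit_row_def)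
        finally show ?thesis .
      next
        case False
        have "(\<Oplus>k\<in>{..<m}. \<rho> k i \<otimes> R.unit_row k j) = (\<Oplus>k\<in>{..<m}. \<zero>)"
          using False \<rho>c by (intro R.finsum_cong2) (auto simp: R.unit_row_def)
        then show ?thesis using False by (simp add: g_def)
      qed
      moreover have "(\<Oplus>\<^bsub>?M3\<^esub>k\<in>{..<m}. \<rho> k i \<odot>\<^bsub>?M3\<^esub> {R.unit_row k}) = {\<lambda>j. \<Oplus>k\<in>{..<m}. \<rho> k i \<otimes> R.unit_row k j}"
        using uv \<rho>c by (intro R.finsum_seq_module R.vec_closed_vecs) auto
      ultimately show ?thesis by auto
    qed
    have 1: "(\<Sum>i<n. frag_of ({g (R.unit_row i)}, b i) -
        (\<Sum>k<m. frag_of ({R.unit_row k}, h (\<rho> k i) \<otimes>\<^bsub>S\<^esub> b i))) \<in> tensor_rel R ?M3 ?N"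
    proof (rule T3.rel_sum)
      fix i assume i: "i \<in> {..<n}"
      have "frag_of (\<Oplus>\<^bsub>?M3\<^esub>k\<in>{..<m}. \<rho> k i \<odot>\<^bsub>?M3\<^esub> {R.unit_row k}, b i) -
          (\<Sum>k\<in>{..<m}. frag_of ({R.unit_row k}, \<rho> k i \<odot>\<^bsub>?N\<^esub> b i)) \<in> tensor_rel R ?M3 ?N"
        using uv \<rho>c b i by (intro T3.rel_lincomb_left) auto
      then show "frag_of ({g (R.unit_row i)}, b i) -
        (\<Sum>k<m. frag_of ({R.unit_row k}, h (\<rho> k i) \<otimes>\<^bsub>S\<^esub> b i)) \<in> tensor_rel R ?M3 ?N"
        using gu i by simp
    qed
    have 2: "(\<Sum>k<m. - (frag_of ({R.unit_row k}, \<zero>\<^bsub>S\<^esub>) -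
        (\<Sum>i<n. frag_of ({R.unit_row k}, h (\<rho> k i) \<otimes>\<^bsub>S\<^esub> b i)))) \<in> tensor_rel R ?M3 ?N"
    proof (rule T3.rel_sum, rule T3.rel_uminus)
      fix k assume k: "k \<in> {..<m}"
      have "frag_of ({R.unit_row k}, finsum ?N (\<lambda>i. h (\<rho> k i) \<otimes>\<^bsub>S\<^esub> b i) {..<n}) -
        (\<Sum>i\<in>{..<n}. frag_of ({R.unit_row k}, h (\<rho> k i) \<otimes>\<^bsub>S\<^esub> b i)) \<in> tensor_rel R ?M3 ?N"
        using uv \<rho>c b k by (intro T3.rel_finsum_right) auto
      then show "frag_of ({R.unit_row k}, \<zero>\<^bsub>S\<^esub>) -
        (\<Sum>i<n. frag_of ({R.unit_row k}, h (\<rho> k i) \<otimes>\<^bsub>S\<^esub> b i)) \<in> tensor_rel R ?M3 ?N"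
        using \<rho>b k by simp
    qed
    have 3: "(\<Sum>k<m. frag_of ({R.unit_row k}, \<zero>\<^bsub>S\<^esub>)) \<in> tensor_rel R ?M3 ?N"
    proof (rule T3.rel_sum)
      fix k assume k: "k \<in> {..<m}"
      have "frag_of ({R.unit_row k}, finsum ?N (\<lambda>i. \<zero>\<^bsub>S\<^esub>) ({} :: nat set)) -
        (\<Sum>i\<in>({} :: nat set). frag_of ({R.unit_row k}, \<zero>\<^bsub>S\<^esub>)) \<in> tensor_rel R ?M3 ?N"
        using uv k by (intro T3.rel_finsum_right) auto
      then show "frag_of ({R.unit_row k}, \<zero>\<^bsub>S\<^esub>) \<in> tensor_rel R ?M3 ?N" by simp
    qed
    have "(\<Sum>i<n. \<Sum>k<m. frag_of ({R.unit_row k}, h (\<rho> k i) \<otimes>\<^bsub>S\<^esub> b i)) =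
      (\<Sum>k<m. \<Sum>i<n. frag_of ({R.unit_row k}, h (\<rho> k i) \<otimes>\<^bsub>S\<^esub> b i))" by (rule sum.swap)
    with T3.rel_add[OF T3.rel_add[OF 1 2] 3] show ?thesis
      unfolding ext by (simp add: sum_subtractf sum_negf)
  qed
  then obtain p1 where p1: "Poly_Mapping.keys p1 \<subseteq> carrier ?M1 \<times> carrier ?N"
    "Poly_Mapping.keys (frag_extend (\<lambda>(x, y). frag_of (id x, y)) p1) \<subseteq> carrier ?M2 \<times> carrier ?N"
    "p - frag_extend (\<lambda>(x, y). frag_of (id x, y)) p1 \<in> tensor_rel R ?M2 ?N"
    using exact_at_imp_lift[OF flat M f gl ex p_keys] by blast
  have id: "frag_extend (\<lambda>(x, y). frag_of (id x, y)) p1 = p1"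
    using frag_expansion[of p1] by (simp add: case_prod_unfold)
  note p1' = p1[unfolded id]
  \<comment> \<open>The coordinate \<open>l\<close>, extended to a map from
    \<open>R^n \<otimes> S\<close> to \<open>S\<close>; it sends \<open>p\<close> to
    \<open>b l\<close>.\<close>
  obtain \<Phi> where \<Phi>: "\<And>p. Poly_Mapping.keys p \<subseteq> carrier ?M2 \<times> carrier S \<Longrightarrow> \<Phi> p \<in> carrier S"
    "\<And>p q. Poly_Mapping.keys p \<subseteq> carrier ?M2 \<times> carrier S \<Longrightarrow> Poly_Mapping.keys q \<subseteq> carrier ?M2 \<times> carrier S \<Longrightarrow>
       \<Phi> (p - q) = \<Phi> p \<ominus>\<^bsub>S\<^esub> \<Phi> q"
    "\<And>x y. x \<in> carrier ?M2 \<Longrightarrow> y \<in> carrier S \<Longrightarrow> \<Phi> (frag_of (x, y)) = h (the_elem x l) \<otimes>\<^bsub>S\<^esub> y"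
    "\<And>p. p \<in> tensor_rel R ?M2 ?N \<Longrightarrow> \<Phi> p = \<zero>\<^bsub>S\<^esub>"
    apply (rule tensor_functional[OF M(2), of "\<lambda>U. h (the_elem U l)"])
    subgoal using V(1) by auto
    subgoal using V(1) by auto
    subgoal using V(1) by auto
    subgoal premises prems for \<Phi> by (rule that[of \<Phi>]) (fact prems)+
    done
  \<comment> \<open>A symbol with first entry \<open>u\<close> in \<open>K\<close> is sent to a
    multiple of \<open>h (u l)\<close>, so the image of \<open>K \<otimes> S\<close> lies in
    \<open>Q\<close>.\<close>
  have \<Phi>Q: "\<Phi> q \<in> Q" if "Poly_Mapping.keys q \<subseteq> carrier ?M1 \<times> carrier S" for q
    using that
  proof (induction q rule: free_Abelian_group_induct[consumes 1, case_names 1 2 3])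
    case 1
    then show ?case using \<Phi>(4)[OF T2.rel_zero] by simp
  next
    case (2 x y)
    have "K \<subseteq> vecs R n" by (auto simp: K_def)
    then have "carrier ?M1 \<subseteq> carrier ?M2" by auto
    with 2 have "\<Phi> (x - y) = \<Phi> x \<ominus>\<^bsub>S\<^esub> \<Phi> y" by (intro \<Phi>(2)) blast+
    then show ?case using 2 by (simp add: a_minus_def)
  next
    case (3 a)
    then obtain u y where a: "a = ({u}, y)" "u \<in> K" "y \<in> carrier S" by auto
    then have "\<Phi> (frag_of a) = h (u l) \<otimes>\<^bsub>S\<^esub> y" by (subst a(1), subst \<Phi>(3)) (auto simp: K_def)
    then show ?case using KQ a Q.I_r_closed by simp
  qed
  have "\<Phi> p = \<Phi> p1 \<oplus>\<^bsub>S\<^esub> \<Phi> (p - p1)"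
    using \<Phi>(1)[of p] \<Phi>(1)[of p1] \<Phi>(2)[of p p1] p_keys p1'(2)
    by (simp add: S.add_minus_cancel_left)
  then have eq1: "\<Phi> p = \<Phi> p1" using \<Phi>(4)[OF p1'(3)] \<Phi>(1)[of p1] p1'(2) by simp
  have "\<Phi> (\<Sum>i\<in>I. frag_of ({R.unit_row i}, b i)) = (\<Oplus>\<^bsub>S\<^esub>i\<in>I. h (R.unit_row i l) \<otimes>\<^bsub>S\<^esub> b i)"
    if "I \<subseteq> {..<n}" for I
  proof -
    have "finite I" using that finite_subset by blast
    then show ?thesis using that
    proof (induction I rule: finite_induct)
      case empty then show ?case using \<Phi>(4)[OF T2.rel_zero] by simp
    next
      case (insert i I)
      let ?s = "\<Sum>i\<in>I. frag_of ({R.unit_row i}, b i)" and ?x = "frag_of ({R.unit_row i}, b i)"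
      have "(\<Sum>j\<in>insert i I. frag_of ({R.unit_row j}, b j)) \<in> carrier (free_Abelian_group (carrier ?M2 \<times> carrier S))"
        by (rule sum_closed_free_Abelian_group) (use insert uv b in auto)
      then have "?s + ?x \<in> carrier (free_Abelian_group (carrier ?M2 \<times> carrier S))"
        using insert by (simp only: sum.insert add.commute not_False_eq_True if_False)
      moreover have "?x \<in> carrier (free_Abelian_group (carrier ?M2 \<times> carrier S))"
        using insert uv b by auto
      ultimately have k: "Poly_Mapping.keys (?s + ?x) \<subseteq> carrier ?M2 \<times> carrier S" "Poly_Mapping.keys ?x \<subseteq> carrier ?M2 \<times> carrier S"
        by (simp_all only: carrier_free_Abelian_group_iff)
      have "\<Phi> ?s = \<Phi> (?s + ?x) \<ominus>\<^bsub>S\<^esub> \<Phi> ?x" using \<Phi>(2)[OF k] by simp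
      then have "\<Phi> (?s + ?x) = \<Phi> ?x \<oplus>\<^bsub>S\<^esub> \<Phi> ?s"
        using S.add_minus_cancel_left[OF \<Phi>(1)[OF k(1)] \<Phi>(1)[OF k(2)]] by simp
      moreover have "\<Phi> ?x = h (R.unit_row i l) \<otimes>\<^bsub>S\<^esub> b i" using insert uv b by (subst \<Phi>(3)) auto
      moreover have "(\<Oplus>\<^bsub>S\<^esub>i\<in>insert i I. h (R.unit_row i l) \<otimes>\<^bsub>S\<^esub> b i) =
        h (R.unit_row i l) \<otimes>\<^bsub>S\<^esub> b i \<oplus>\<^bsub>S\<^esub> (\<Oplus>\<^bsub>S\<^esub>i\<in>I. h (R.unit_row i l) \<otimes>\<^bsub>S\<^esub> b i)"
        using insert b by (intro S.finsum_insert) auto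
      ultimately show ?case using insert by (simp add: add.commute)
    qed
  qed
  then have "\<Phi> p = (\<Oplus>\<^bsub>S\<^esub>i\<in>{..<n}. h (R.unit_row i l) \<otimes>\<^bsub>S\<^esub> b i)" by (simp add: p_def)
  also have "\<dots> = (\<Oplus>\<^bsub>S\<^esub>i\<in>{..<n}. if l = i then b i else \<zero>\<^bsub>S\<^esub>)"
    using b by (intro S.finsum_cong2) (auto simp: R.unit_row_def)
  also have "\<dots> = b l" using l b by (intro S.add.finprod_singleton) auto
  finally have "\<Phi> p = b l" .
  then show ?thesis using eq1 \<Phi>Q[of p1] p1'(1) by simp
qed

section \<open>The tensor product of two algebras\<close>

lemma frag_cmul_diff_distrib2: "frag_cmul c (a - b) = frag_cmul c a - frag_cmul c b"
  using frag_cmul_distrib2[of c "a - b" b] by simp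

lemma frag_extend_fun_diff:
  "frag_extend (\<lambda>i. f i - g i) p = frag_extend f p - frag_extend g p"
  by (simp add: frag_extend_def frag_cmul_diff_distrib2 sum_subtractf)

locale tensor_algebras =
  B: ring_hom_cring A B h + C: ring_hom_cring A C k
  for A :: "'r ring" (structure) and B :: "'b ring" and h and C :: "'c ring" and k
begin

text \<open>The multiplication of \<open>pair_monoid_ring B C\<close> freed from its record, so that
  identities can be checked on symbols \<open>(x, y)\<close> by \<open>pairs_induct\<close>.\<close>

definition pmul :: "('b \<times> 'c \<Rightarrow>\<^sub>0 int) \<Rightarrow> ('b \<times> 'c \<Rightarrow>\<^sub>0 int) \<Rightarrow> ('b \<times> 'c \<Rightarrow>\<^sub>0 int)" where
  "pmul p q = frag_extend (\<lambda>(x, y). frag_extend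
               (\<lambda>(x', y'). frag_of (x \<otimes>\<^bsub>B\<^esub> x', y \<otimes>\<^bsub>C\<^esub> y')) q) p"

definition pairs :: "('b \<times> 'c) set" where
  "pairs = carrier B \<times> carrier C"

lemma pmul_of: "pmul (frag_of (x, y)) (frag_of (x', y')) = frag_of (x \<otimes>\<^bsub>B\<^esub> x', y \<otimes>\<^bsub>C\<^esub> y')"
  by (simp add: pmul_def)

lemma pmul_diff_left: "pmul (p - p') q = pmul p q - pmul p' q"
  by (simp add: pmul_def frag_extend_diff)

lemma pmul_diff_right: "pmul p (q - q') = pmul p q - pmul p q'"
  by (simp add: pmul_def frag_extend_diff case_prod_unfold frag_extend_fun_diff)

lemma pmul_zero [simp]: "pmul 0 q = 0" "pmul p 0 = 0"
  using pmul_diff_left[of 0 0 q] pmul_diff_right[of p 0 0] by simp_all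

lemma keys_diff_subset:
  "Poly_Mapping.keys p \<subseteq> S \<Longrightarrow> Poly_Mapping.keys q \<subseteq> S \<Longrightarrow> Poly_Mapping.keys (p - q) \<subseteq> S"
  using keys_diff[of p q] by blast

lemma pairs_induct [consumes 1, case_names zero diff of]:
  assumes "Poly_Mapping.keys p \<subseteq> pairs" "P 0"
    "\<And>p q. Poly_Mapping.keys p \<subseteq> pairs \<Longrightarrow> Poly_Mapping.keys q \<subseteq> pairs \<Longrightarrow> P p \<Longrightarrow> P q \<Longrightarrow> P (p - q)"
    "\<And>x y. x \<in> carrier B \<Longrightarrow> y \<in> carrier C \<Longrightarrow> P (frag_of (x, y))"
  shows "P p"
  using assms(1)
proof (rule free_Abelian_group_induct)
  fix a assume "a \<in> pairs"
  then show "P (frag_of a)" using assms(4)[of "fst a" "snd a"] by (auto simp: pairs_def)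
qed (use assms in blast)+

lemma pmul_keys:
  assumes "Poly_Mapping.keys p \<subseteq> pairs" "Poly_Mapping.keys q \<subseteq> pairs"
  shows "Poly_Mapping.keys (pmul p q) \<subseteq> pairs"
  using assms(1)
proof (induction p rule: pairs_induct)
  case (diff p p') then show ?case unfolding pmul_diff_left by (intro keys_diff_subset)
next
  case (of x y)
  show ?case using assms(2)
  proof (induction q rule: pairs_induct)
    case (diff q q') then show ?case unfolding pmul_diff_right by (intro keys_diff_subset)
  next
    case (of x' y') then show ?case using \<open>x \<in> carrier B\<close> \<open>y \<in> carrier C\<close>
      by (simp add: pmul_of keys_frag_of pairs_def)
  qed simp
qed simp

lemma pmul_comm:
  assumes "Poly_Mapping.keys p \<subseteq> pairs" "Poly_Mapping.keys q \<subseteq> pairs"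
  shows "pmul p q = pmul q p"
  using assms(1)
proof (induction p rule: pairs_induct)
  case (diff p p') then show ?case by (simp add: pmul_diff_left pmul_diff_right)
next
  case (of x y)
  show ?case using assms(2)
  proof (induction q rule: pairs_induct)
    case (diff q q') then show ?case by (simp add: pmul_diff_left pmul_diff_right)
  next
    case (of x' y') then show ?case using \<open>x \<in> carrier B\<close> \<open>y \<in> carrier C\<close>
      by (simp add: pmul_of B.S.m_comm C.S.m_comm)
  qed simp
qed simp

lemma pmul_assoc:
  assumes "Poly_Mapping.keys p \<subseteq> pairs" "Poly_Mapping.keys q \<subseteq> pairs" "Poly_Mapping.keys r \<subseteq> pairs"
  shows "pmul (pmul p q) r = pmul p (pmul q r)"
  using assms(1)
proof (induction p rule: pairs_induct)
  case (diff p p') then show ?case by (simp add: pmul_diff_left)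
next
  case (of x y)
  note xy = this
  show ?case using assms(2)
  proof (induction q rule: pairs_induct)
    case (diff q q') then show ?case by (simp add: pmul_diff_left pmul_diff_right)
  next
    case (of x' y')
    note xy' = this
    show ?case using assms(3)
    proof (induction r rule: pairs_induct)
      case (diff r r') then show ?case by (simp add: pmul_diff_right)
    next
      case (of x'' y'') then show ?case using xy xy'
        by (simp add: pmul_of B.S.m_assoc C.S.m_assoc)
    qed simp
  qed simp
qed simp

lemma pmul_one:
  assumes "Poly_Mapping.keys p \<subseteq> pairs"
  shows "pmul (frag_of (\<one>\<^bsub>B\<^esub>, \<one>\<^bsub>C\<^esub>)) p = p"
  using assms by (induction p rule: pairs_induct) (simp_all add: pmul_diff_right pmul_of)

abbreviation "PR \<equiv> pair_monoid_ring B C"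
abbreviation "TI \<equiv> tensor_rel A (scalars_along h B) (scalars_along k C)"
abbreviation "TB \<equiv> tensor_ring A h B k C"

sublocale T: tensor_pair A "scalars_along h B" "scalars_along k C"
  by (intro tensor_pair.intro B.scalars_along_module C.scalars_along_module)

lemma PR_simps [simp]:
  "p \<in> carrier PR \<longleftrightarrow> Poly_Mapping.keys p \<subseteq> pairs" "p \<otimes>\<^bsub>PR\<^esub> q = pmul p q"
  "\<one>\<^bsub>PR\<^esub> = frag_of (\<one>\<^bsub>B\<^esub>, \<one>\<^bsub>C\<^esub>)" "\<zero>\<^bsub>PR\<^esub> = 0" "p \<oplus>\<^bsub>PR\<^esub> q = p + q"
  by (simp_all add: pair_monoid_ring_def pairs_def pmul_def)

lemma cring_PR: "cring PR"
proof (rule cringI)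
  have add: "Poly_Mapping.keys (p + q) \<subseteq> pairs"
    if "Poly_Mapping.keys p \<subseteq> pairs" "Poly_Mapping.keys q \<subseteq> pairs" for p q
    using that keys_add[of p q] by blast
  show "abelian_group PR"
  proof (rule abelian_groupI)
    fix p assume "p \<in> carrier PR"
    then show "\<exists>q\<in>carrier PR. q \<oplus>\<^bsub>PR\<^esub> p = \<zero>\<^bsub>PR\<^esub>"
      by (intro bexI[of _ "- p"]) auto
  qed (auto simp: add algebra_simps)
  show "comm_monoid PR"
  proof (rule comm_monoidI)
    fix p q assume "p \<in> carrier PR" "q \<in> carrier PR"
    then show "p \<otimes>\<^bsub>PR\<^esub> q = q \<otimes>\<^bsub>PR\<^esub> p" using pmul_comm by simp
  qed (simp_all add: pmul_keys pmul_assoc pmul_one, simp add: keys_frag_of pairs_def)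
  fix p q r assume *: "p \<in> carrier PR" "q \<in> carrier PR" "r \<in> carrier PR"
  \<comment> \<open>\<open>pmul\<close> is known to respect differences, so the sum is written as
    \<open>p - (0 - q)\<close>.\<close>
  have "pmul (p - (0 - q)) r = pmul p r - (0 - pmul q r)" unfolding pmul_diff_left by simp
  then show "(p \<oplus>\<^bsub>PR\<^esub> q) \<otimes>\<^bsub>PR\<^esub> r = p \<otimes>\<^bsub>PR\<^esub> r \<oplus>\<^bsub>PR\<^esub> q \<otimes>\<^bsub>PR\<^esub> r" by simp
qed

text \<open>The product of a defining relation with a symbol \<open>(u, v)\<close> is again a
  defining relation of the same kind; both arguments are reduced to this case by induction.\<close>

lemma TI_mult:
  assumes "r \<in> TI" "Poly_Mapping.keys p \<subseteq> pairs"
  shows "pmul r p \<in> TI"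
  using assms(1)
proof (induction r rule: T.rel_induct)
  case zero then show ?case by (simp add: T.rel_zero)
next
  case (diff r r') then show ?case unfolding pmul_diff_left by (intro T.rel_diff)
next
  case (add_left x x' y)
  show ?case using assms(2)
  proof (induction p rule: pairs_induct)
    case zero then show ?case by (simp add: T.rel_zero)
  next
    case (diff p p') then show ?case unfolding pmul_diff_right by (intro T.rel_diff)
  next
    case (of u v)
    then show ?case
      using T.rel_add_left[of "x \<otimes>\<^bsub>B\<^esub> u" "x' \<otimes>\<^bsub>B\<^esub> u" "y \<otimes>\<^bsub>C\<^esub> v"] add_left
      by (simp add: pmul_diff_left pmul_of B.S.l_distr)
  qed
next
  case (add_right x y y')
  show ?case using assms(2)
  proof (induction p rule: pairs_induct)
    case zero then show ?case by (simp add: T.rel_zero)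
  next
    case (diff p p') then show ?case unfolding pmul_diff_right by (intro T.rel_diff)
  next
    case (of u v)
    then show ?case
      using T.rel_add_right[of "x \<otimes>\<^bsub>B\<^esub> u" "y \<otimes>\<^bsub>C\<^esub> v" "y' \<otimes>\<^bsub>C\<^esub> v"] add_right
      by (simp add: pmul_diff_left pmul_of C.S.l_distr)
  qed
next
  case (smult a x y)
  show ?case using assms(2)
  proof (induction p rule: pairs_induct)
    case zero then show ?case by (simp add: T.rel_zero)
  next
    case (diff p p') then show ?case unfolding pmul_diff_right by (intro T.rel_diff)
  next
    case (of u v)
    then show ?case
      using T.rel_smult[of a "x \<otimes>\<^bsub>B\<^esub> u" "y \<otimes>\<^bsub>C\<^esub> v"] smult
      by (simp add: pmul_diff_left pmul_of B.S.m_assoc C.S.m_assoc)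
  qed
qed

lemma TI_keys: "r \<in> TI \<Longrightarrow> Poly_Mapping.keys r \<subseteq> pairs"
  using T.rel_keys[of r] by (simp add: pairs_def)

lemma ideal_TI: "ideal TI PR"
proof -
  interpret P: cring PR by (rule cring_PR)
  show ?thesis
  proof (rule idealI[OF P.ring_axioms])
    show "subgroup TI (add_monoid PR)"
    proof (rule P.add.subgroupI)
      show "TI \<subseteq> carrier PR" using TI_keys by auto
      show "TI \<noteq> {}" using T.rel_zero by blast
    next
      fix p assume p: "p \<in> TI"
      have "\<ominus>\<^bsub>PR\<^esub> p = - p" using TI_keys[OF p] by (intro P.minus_equality) auto
      then show "\<ominus>\<^bsub>PR\<^esub> p \<in> TI" using T.rel_uminus[OF p] by simp
    qed (simp add: T.rel_add)
    fix r p assume "r \<in> TI" "p \<in> carrier PR"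
    then show "r \<otimes>\<^bsub>PR\<^esub> p \<in> TI" "p \<otimes>\<^bsub>PR\<^esub> r \<in> TI"
      using TI_mult[of r p] pmul_comm[of p r] TI_keys[of r] by simp_all
  qed
qed

lemma cring_TB: "cring TB"
  unfolding tensor_ring_def using ideal.quotient_is_cring[OF ideal_TI cring_PR] .

abbreviation "te \<equiv> tensor_elem A h B k C"

lemma coset_PR: "TI +>\<^bsub>PR\<^esub> p = TI #>\<^bsub>T.FG\<^esub> p"
  by (simp add: a_r_coset_def' r_coset_def)

lemma te_coset: "te x y = TI #>\<^bsub>T.FG\<^esub> frag_of (x, y)"
  by (simp add: tensor_elem_def coset_PR)

lemma te_eq_iff:
  assumes "x \<in> carrier B" "y \<in> carrier C" "x' \<in> carrier B" "y' \<in> carrier C"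
  shows "te x y = te x' y' \<longleftrightarrow> frag_of (x, y) - frag_of (x', y') \<in> TI"
  unfolding te_coset using assms by (intro T.coset_eq_iff) (auto simp: keys_frag_of)

lemma te_closed: "x \<in> carrier B \<Longrightarrow> y \<in> carrier C \<Longrightarrow> te x y \<in> carrier TB"
  using ring_hom_closed[OF ideal.rcos_ring_hom[OF ideal_TI]]
  by (simp add: tensor_elem_def tensor_ring_def keys_frag_of pairs_def)

lemma te_mult:
  assumes "x \<in> carrier B" "y \<in> carrier C" "x' \<in> carrier B" "y' \<in> carrier C"
  shows "te (x \<otimes>\<^bsub>B\<^esub> x') (y \<otimes>\<^bsub>C\<^esub> y') = te x y \<otimes>\<^bsub>TB\<^esub> te x' y'"
  using ring_hom_mult[OF ideal.rcos_ring_hom[OF ideal_TI], of "frag_of (x, y)" "frag_of (x', y')"] assms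
  by (simp add: tensor_elem_def tensor_ring_def keys_frag_of pairs_def pmul_of)

lemma te_plus:
  assumes "x \<in> carrier B" "y \<in> carrier C" "x' \<in> carrier B" "y' \<in> carrier C"
  shows "te x y \<oplus>\<^bsub>TB\<^esub> te x' y' = TI #>\<^bsub>T.FG\<^esub> (frag_of (x, y) + frag_of (x', y'))"
  using ring_hom_add[OF ideal.rcos_ring_hom[OF ideal_TI], of "frag_of (x, y)" "frag_of (x', y')"] assms
  by (simp add: tensor_elem_def tensor_ring_def keys_frag_of pairs_def coset_PR)

lemma te_one: "te \<one>\<^bsub>B\<^esub> \<one>\<^bsub>C\<^esub> = \<one>\<^bsub>TB\<^esub>"
  using ring_hom_one[OF ideal.rcos_ring_hom[OF ideal_TI]]
  by (simp add: tensor_elem_def tensor_ring_def)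

lemma keys_two:
  "a \<in> S \<Longrightarrow> b \<in> S \<Longrightarrow> Poly_Mapping.keys (frag_of a + frag_of b) \<subseteq> S"
  using keys_add[of "frag_of a" "frag_of b"] by (auto simp: keys_frag_of)

lemma left_hom: "(\<lambda>x. te x \<one>\<^bsub>C\<^esub>) \<in> ring_hom B TB"
proof (rule ring_hom_memI)
  fix x x' assume x: "x \<in> carrier B" "x' \<in> carrier B"
  show "te (x \<otimes>\<^bsub>B\<^esub> x') \<one>\<^bsub>C\<^esub> = te x \<one>\<^bsub>C\<^esub> \<otimes>\<^bsub>TB\<^esub> te x' \<one>\<^bsub>C\<^esub>"
    using te_mult[of x "\<one>\<^bsub>C\<^esub>" x' "\<one>\<^bsub>C\<^esub>"] x by simp
  show "te (x \<oplus>\<^bsub>B\<^esub> x') \<one>\<^bsub>C\<^esub> = te x \<one>\<^bsub>C\<^esub> \<oplus>\<^bsub>TB\<^esub> te x' \<one>\<^bsub>C\<^esub>"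
    unfolding te_plus[OF x(1) C.S.one_closed x(2) C.S.one_closed]
    unfolding te_coset
    using T.rel_add_left[of x x' "\<one>\<^bsub>C\<^esub>"] x
    by (subst T.coset_eq_iff) (simp_all add: keys_two keys_frag_of diff_diff_eq)
qed (use te_closed te_one in auto)

lemma right_hom: "(\<lambda>y. te \<one>\<^bsub>B\<^esub> y) \<in> ring_hom C TB"
proof (rule ring_hom_memI)
  fix x x' assume x: "x \<in> carrier C" "x' \<in> carrier C"
  show "te \<one>\<^bsub>B\<^esub> (x \<otimes>\<^bsub>C\<^esub> x') = te \<one>\<^bsub>B\<^esub> x \<otimes>\<^bsub>TB\<^esub> te \<one>\<^bsub>B\<^esub> x'"
    using te_mult[of "\<one>\<^bsub>B\<^esub>" x "\<one>\<^bsub>B\<^esub>" x'] x by simp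
  show "te \<one>\<^bsub>B\<^esub> (x \<oplus>\<^bsub>C\<^esub> x') = te \<one>\<^bsub>B\<^esub> x \<oplus>\<^bsub>TB\<^esub> te \<one>\<^bsub>B\<^esub> x'"
    unfolding te_plus[OF B.S.one_closed x(1) B.S.one_closed x(2)]
    unfolding te_coset
    using T.rel_add_right[of "\<one>\<^bsub>B\<^esub>" x x'] x
    by (subst T.coset_eq_iff) (simp_all add: keys_two keys_frag_of diff_diff_eq)
qed (use te_closed te_one in auto)

text \<open>This is why elements coming from \<open>A\<close> form matching families.\<close>

lemma te_scalar:
  assumes "a \<in> carrier A"
  shows "te (h a) \<one>\<^bsub>C\<^esub> = te \<one>\<^bsub>B\<^esub> (k a)"
  using T.rel_smult[of a "\<one>\<^bsub>B\<^esub>" "\<one>\<^bsub>C\<^esub>"] assms by (subst te_eq_iff) auto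

subsection \<open>Equalities in a tensor product with a flat algebra\<close>

text \<open>
  \<open>formal_sum \<kappa> v\<close> says that \<open>\<kappa>\<close>, an element of the free \<open>A\<close>-module on the set \<open>B\<close>, is mapped
  to \<open>v\<close> in \<open>B\<close>.
\<close>

definition formal_sum :: "('b \<Rightarrow> 'r) \<Rightarrow> 'b \<Rightarrow> bool" where
  "formal_sum \<kappa> v \<longleftrightarrow> \<kappa> \<in> UNIV \<rightarrow> carrier A \<and> (\<exists>S. finite S \<and> S \<subseteq> carrier B \<and>
     (\<forall>x. x \<notin> S \<longrightarrow> \<kappa> x = \<zero>) \<and> v = (\<Oplus>\<^bsub>B\<^esub>x\<in>S. h (\<kappa> x) \<otimes>\<^bsub>B\<^esub> x))"

text \<open>The support may be enlarged, so that two formal sums can be added over a common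
  one.\<close>

lemma formal_sum_on:
  assumes "formal_sum \<kappa> v"
  shows "\<exists>S. finite S \<and> S \<subseteq> carrier B \<and>
    (\<forall>S'. finite S' \<longrightarrow> S \<subseteq> S' \<longrightarrow> S' \<subseteq> carrier B \<longrightarrow> v = (\<Oplus>\<^bsub>B\<^esub>x\<in>S'. h (\<kappa> x) \<otimes>\<^bsub>B\<^esub> x)) \<and>
    (\<forall>x. x \<notin> S \<longrightarrow> \<kappa> x = \<zero>)"
proof -
  obtain S where S: "finite S" "S \<subseteq> carrier B" "\<And>x. x \<notin> S \<Longrightarrow> \<kappa> x = \<zero>"
    "v = (\<Oplus>\<^bsub>B\<^esub>x\<in>S. h (\<kappa> x) \<otimes>\<^bsub>B\<^esub> x)" "\<And>x. \<kappa> x \<in> carrier A"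
    using assms by (auto simp: formal_sum_def)
  have "v = (\<Oplus>\<^bsub>B\<^esub>x\<in>S'. h (\<kappa> x) \<otimes>\<^bsub>B\<^esub> x)" if "finite S'" "S \<subseteq> S'" "S' \<subseteq> carrier B" for S'
    unfolding S(4) using S(1-3,5) that
    by (intro B.S.add.finprod_mono_neutral_cong_left) auto
  then show ?thesis using S(1-3) by blast
qed

lemma formal_sum_closed: "formal_sum \<kappa> v \<Longrightarrow> \<kappa> x \<in> carrier A"
  by (auto simp: formal_sum_def)

lemma formal_sum_combine:
  assumes 1: "formal_sum \<kappa> v" and 2: "formal_sum \<kappa>' v'" and a: "a \<in> carrier A"
  shows "formal_sum (\<lambda>x. a \<otimes> \<kappa> x \<oplus> \<kappa>' x) (h a \<otimes>\<^bsub>B\<^esub> v \<oplus>\<^bsub>B\<^esub> v')"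
proof -
  obtain S where S: "finite S" "S \<subseteq> carrier B"
    "\<forall>S'. finite S' \<longrightarrow> S \<subseteq> S' \<longrightarrow> S' \<subseteq> carrier B \<longrightarrow> v = (\<Oplus>\<^bsub>B\<^esub>x\<in>S'. h (\<kappa> x) \<otimes>\<^bsub>B\<^esub> x)"
    "\<forall>x. x \<notin> S \<longrightarrow> \<kappa> x = \<zero>"
    using formal_sum_on[OF 1] by (elim exE conjE)
  obtain S' where S': "finite S'" "S' \<subseteq> carrier B"
    "\<forall>S. finite S \<longrightarrow> S' \<subseteq> S \<longrightarrow> S \<subseteq> carrier B \<longrightarrow> v' = (\<Oplus>\<^bsub>B\<^esub>x\<in>S. h (\<kappa>' x) \<otimes>\<^bsub>B\<^esub> x)"
    "\<forall>x. x \<notin> S' \<longrightarrow> \<kappa>' x = \<zero>"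
    using formal_sum_on[OF 2] by (elim exE conjE)
  note c = formal_sum_closed[OF 1] formal_sum_closed[OF 2]
  let ?U = "S \<union> S'"
  have xB: "x \<in> carrier B" if "x \<in> ?U" for x using that S(2) S'(2) by blast
  have v: "v = (\<Oplus>\<^bsub>B\<^esub>x\<in>?U. h (\<kappa> x) \<otimes>\<^bsub>B\<^esub> x)" by (rule S(3)[rule_format]) (use S S' in auto)
  have v': "v' = (\<Oplus>\<^bsub>B\<^esub>x\<in>?U. h (\<kappa>' x) \<otimes>\<^bsub>B\<^esub> x)" by (rule S'(3)[rule_format]) (use S S' in auto)
  have "(\<Oplus>\<^bsub>B\<^esub>x\<in>?U. h (a \<otimes> \<kappa> x \<oplus> \<kappa>' x) \<otimes>\<^bsub>B\<^esub> x) =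
      (\<Oplus>\<^bsub>B\<^esub>x\<in>?U. h a \<otimes>\<^bsub>B\<^esub> (h (\<kappa> x) \<otimes>\<^bsub>B\<^esub> x) \<oplus>\<^bsub>B\<^esub> h (\<kappa>' x) \<otimes>\<^bsub>B\<^esub> x)"
    using xB c a by (intro B.S.finsum_cong2) (simp_all add: B.S.l_distr B.S.m_assoc)
  also have "\<dots> = (\<Oplus>\<^bsub>B\<^esub>x\<in>?U. h a \<otimes>\<^bsub>B\<^esub> (h (\<kappa> x) \<otimes>\<^bsub>B\<^esub> x)) \<oplus>\<^bsub>B\<^esub> (\<Oplus>\<^bsub>B\<^esub>x\<in>?U. h (\<kappa>' x) \<otimes>\<^bsub>B\<^esub> x)"
    using xB c a by (intro B.S.finsum_addf) auto
  also have "(\<Oplus>\<^bsub>B\<^esub>x\<in>?U. h a \<otimes>\<^bsub>B\<^esub> (h (\<kappa> x) \<otimes>\<^bsub>B\<^esub> x)) = h a \<otimes>\<^bsub>B\<^esub> v"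
    unfolding v using xB c a S S' by (intro B.S.finsum_rdistr[symmetric]) auto
  finally have sum: "h a \<otimes>\<^bsub>B\<^esub> v \<oplus>\<^bsub>B\<^esub> v' = (\<Oplus>\<^bsub>B\<^esub>x\<in>?U. h (a \<otimes> \<kappa> x \<oplus> \<kappa>' x) \<otimes>\<^bsub>B\<^esub> x)"
    using v' by simp
  have U: "finite ?U" "?U \<subseteq> carrier B" using S(1,2) S'(1,2) by auto
  have outside: "a \<otimes> \<kappa> x \<oplus> \<kappa>' x = \<zero>" if "x \<notin> ?U" for x using that S(4) S'(4) a by simp
  show ?thesis unfolding formal_sum_def
  proof (intro conjI exI)
    show "(\<lambda>x. a \<otimes> \<kappa> x \<oplus> \<kappa>' x) \<in> UNIV \<rightarrow> carrier A" using c a by auto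
    show "\<forall>x. x \<notin> ?U \<longrightarrow> a \<otimes> \<kappa> x \<oplus> \<kappa>' x = \<zero>" using outside by blast
  qed (rule U sum)+
qed

lemma formal_sum_single:
  assumes "x \<in> carrier B"
  shows "formal_sum (\<lambda>t. if t = x then \<one> else \<zero>) x"
  unfolding formal_sum_def using assms by (intro conjI exI[of _ "{x}"]) auto

lemma formal_sum_zero: "formal_sum (\<lambda>_. \<zero>) \<zero>\<^bsub>B\<^esub>"
  unfolding formal_sum_def by (intro conjI exI[of _ "{}"]) auto

lemma formal_sum_at:
  assumes "formal_sum \<kappa> v" "\<And>x. x \<noteq> y \<Longrightarrow> \<kappa> x = \<zero>" "y \<in> carrier B"
  shows "v = h (\<kappa> y) \<otimes>\<^bsub>B\<^esub> y"
proof -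
  obtain S where S: "finite S" "S \<subseteq> carrier B"
    "\<forall>S'. finite S' \<longrightarrow> S \<subseteq> S' \<longrightarrow> S' \<subseteq> carrier B \<longrightarrow> v = (\<Oplus>\<^bsub>B\<^esub>x\<in>S'. h (\<kappa> x) \<otimes>\<^bsub>B\<^esub> x)"
    using formal_sum_on[OF assms(1)] by (elim exE conjE)
  have "v = (\<Oplus>\<^bsub>B\<^esub>x\<in>insert y S. h (\<kappa> x) \<otimes>\<^bsub>B\<^esub> x)" using S(1,2) assms(3) by (intro S(3)[rule_format]) auto
  also have "\<dots> = (\<Oplus>\<^bsub>B\<^esub>x\<in>{y}. h (\<kappa> x) \<otimes>\<^bsub>B\<^esub> x)"
    using S(1,2) assms(2,3) formal_sum_closed[OF assms(1)]
    by (intro B.S.add.finprod_mono_neutral_cong_right) auto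
  finally show ?thesis using assms(3) formal_sum_closed[OF assms(1)] by simp
qed

end

lemma (in cring) finsum_append:
  fixes m n :: nat
  assumes "\<And>i. i < m + n \<Longrightarrow> g i \<in> carrier R"
  shows "(\<Oplus>i\<in>{..<m + n}. g i) = (\<Oplus>i\<in>{..<m}. g i) \<oplus> (\<Oplus>i\<in>{..<n}. g (m + i))"
  using assms
proof (induction n)
  case 0 then show ?case by simp
next
  case (Suc n)
  have c: "(\<Oplus>i\<in>{..<m}. g i) \<in> carrier R" "(\<Oplus>i\<in>{..<n}. g (m + i)) \<in> carrier R"
    using Suc.prems by (intro finsum_closed; auto)+
  have "(\<Oplus>i\<in>insert (m + n) {..<m + n}. g i) = g (m + n) \<oplus> (\<Oplus>i\<in>{..<m + n}. g i)"
    using Suc.prems by (intro finsum_insert) auto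
  moreover have "(\<Oplus>i\<in>insert n {..<n}. g (m + i)) = g (m + n) \<oplus> (\<Oplus>i\<in>{..<n}. g (m + i))"
    using Suc.prems by (intro finsum_insert) auto
  moreover have "(\<Oplus>i\<in>{..<m + n}. g i) = (\<Oplus>i\<in>{..<m}. g i) \<oplus> (\<Oplus>i\<in>{..<n}. g (m + i))"
    using Suc by auto
  ultimately show ?case using c Suc.prems[of "m + n"] by (simp add: lessThan_Suc a_ac)
qed

context tensor_algebras
begin

text \<open>
  Under the assumption, \<open>y \<otimes> 1\<close> vanishes in \<open>(B / V) \<otimes> C\<close>.  The finitely many relations
  witnessing \<open>y \<otimes> 1 = 1 \<otimes> z\<close> form a system of linear equations over \<open>A\<close> with a solution in
  \<open>C\<close>; its solutions in \<open>A\<close> yield elements \<open>c\<close> with \<open>c y \<in> V\<close>.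
\<close>

theorem te_eq_imp:
  assumes noeth: "noetherian_ring A" and flat: "flat_module A (scalars_along k C)"
    and y: "y \<in> carrier B" and z: "z \<in> carrier C" and eq: "te y \<one>\<^bsub>C\<^esub> = te \<one>\<^bsub>B\<^esub> z"
    and V: "V \<subseteq> carrier B" "\<zero>\<^bsub>B\<^esub> \<in> V" "\<And>v w. v \<in> V \<Longrightarrow> w \<in> V \<Longrightarrow> v \<oplus>\<^bsub>B\<^esub> w \<in> V"
      "\<And>a v. a \<in> carrier A \<Longrightarrow> v \<in> V \<Longrightarrow> h a \<otimes>\<^bsub>B\<^esub> v \<in> V"
    and Vz: "\<one>\<^bsub>B\<^esub> \<in> V \<or> z = \<zero>\<^bsub>C\<^esub>"
    and Q: "ideal Q C" and sol: "\<And>c. c \<in> carrier A \<Longrightarrow> h c \<otimes>\<^bsub>B\<^esub> y \<in> V \<Longrightarrow> k c \<in> Q"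
  shows "\<one>\<^bsub>C\<^esub> \<in> Q"
proof -
  \<comment> \<open>\<open>\<Phi> t\<close> collects the second entries of all symbols with first
    entry \<open>t\<close>. Together these maps lead to the free \<open>C\<close>-module on the set
    \<open>B\<close>, where additivity in \<open>C\<close> holds but no relation between elements of
    \<open>B\<close> does.\<close>
  have "\<exists>\<Phi>. (\<forall>p. Poly_Mapping.keys p \<subseteq> pairs \<longrightarrow> \<Phi> p \<in> carrier C) \<and>
      (\<forall>p q. Poly_Mapping.keys p \<subseteq> pairs \<longrightarrow> Poly_Mapping.keys q \<subseteq> pairs \<longrightarrow> \<Phi> (p - q) = \<Phi> p \<ominus>\<^bsub>C\<^esub> \<Phi> q) \<and>
      (\<forall>s\<in>pairs. \<Phi> (frag_of s) = (if fst s = t then snd s else \<zero>\<^bsub>C\<^esub>))" for t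
  proof -
    have "(if fst s = t then snd s else \<zero>\<^bsub>C\<^esub>) \<in> carrier C" if "s \<in> pairs" for s
      using that by (auto simp: pairs_def)
    then show ?thesis by (rule C.S.frag_hom)
  qed
  then have "\<exists>\<Phi>. \<forall>t. (\<forall>p. Poly_Mapping.keys p \<subseteq> pairs \<longrightarrow> \<Phi> t p \<in> carrier C) \<and>
      (\<forall>p q. Poly_Mapping.keys p \<subseteq> pairs \<longrightarrow> Poly_Mapping.keys q \<subseteq> pairs \<longrightarrow> \<Phi> t (p - q) = \<Phi> t p \<ominus>\<^bsub>C\<^esub> \<Phi> t q) \<and>
      (\<forall>s\<in>pairs. \<Phi> t (frag_of s) = (if fst s = t then snd s else \<zero>\<^bsub>C\<^esub>))" by (rule choice[OF allI])
  then obtain \<Phi> where \<Phi>: "\<forall>t. (\<forall>p. Poly_Mapping.keys p \<subseteq> pairs \<longrightarrow> \<Phi> t p \<in> carrier C) \<and>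
      (\<forall>p q. Poly_Mapping.keys p \<subseteq> pairs \<longrightarrow> Poly_Mapping.keys q \<subseteq> pairs \<longrightarrow> \<Phi> t (p - q) = \<Phi> t p \<ominus>\<^bsub>C\<^esub> \<Phi> t q) \<and>
      (\<forall>s\<in>pairs. \<Phi> t (frag_of s) = (if fst s = t then snd s else \<zero>\<^bsub>C\<^esub>))" ..
  have \<Phi>_closed: "\<Phi> t p \<in> carrier C" if "Poly_Mapping.keys p \<subseteq> pairs" for t p
    using \<Phi>[rule_format, of t] that by simp
  have \<Phi>_diff: "\<Phi> t (p - q) = \<Phi> t p \<ominus>\<^bsub>C\<^esub> \<Phi> t q"
    if "Poly_Mapping.keys p \<subseteq> pairs" "Poly_Mapping.keys q \<subseteq> pairs" for t p q
    using \<Phi>[rule_format, of t] that by simp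
  have \<Phi>_of': "\<Phi> t (frag_of s) = (if fst s = t then snd s else \<zero>\<^bsub>C\<^esub>)" if "s \<in> pairs" for t s
    using \<Phi>[rule_format, of t] that by simp
  have \<Phi>_of: "\<Phi> t (frag_of (x, c)) = (if x = t then c else \<zero>\<^bsub>C\<^esub>)" if "x \<in> carrier B" "c \<in> carrier C" for t x c
    using \<Phi>_of'[of "(x, c)" t] that by (simp add: pairs_def)
  have \<Phi>_zero: "\<Phi> t 0 = \<zero>\<^bsub>C\<^esub>" for t
    using \<Phi>_diff[of 0 0 t] \<Phi>_closed[of 0 t] by (simp add: a_minus_def C.S.r_neg)
  have kd: "Poly_Mapping.keys (frag_of a - frag_of b) \<subseteq> pairs" if "a \<in> pairs" "b \<in> pairs" for a b
    using that by (intro keys_diff_subset) (auto simp: keys_frag_of)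

  have \<Phi>_diff3: "\<Phi> t (frag_of a - frag_of b - frag_of c) =
      (\<Phi> t (frag_of a) \<ominus>\<^bsub>C\<^esub> \<Phi> t (frag_of b)) \<ominus>\<^bsub>C\<^esub> \<Phi> t (frag_of c)"
    if "a \<in> pairs" "b \<in> pairs" "c \<in> pairs" for t a b c
    using \<Phi>_diff[OF kd[OF that(1,2)], of "frag_of c" t] \<Phi>_diff[of "frag_of a" "frag_of b" t] that
    by (simp add: keys_frag_of)
  \<comment> \<open>The kernel of the map from the free \<open>A\<close>-module on the set
    \<open>B\<close> to \<open>B / V\<close>.\<close>
  define W where "W = {\<kappa>. \<exists>v\<in>V. formal_sum \<kappa> v}"
  have W_closed: "\<kappa> t \<in> carrier A" if "\<kappa> \<in> W" for \<kappa> t using that formal_sum_closed by (auto simp: W_def)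
  have W_zero: "(\<lambda>_. \<zero>) \<in> W" using formal_sum_zero V(2) by (auto simp: W_def)
  have W_comb: "(\<lambda>t. a \<otimes> \<kappa> t \<oplus> \<kappa>' t) \<in> W" if "\<kappa> \<in> W" "\<kappa>' \<in> W" "a \<in> carrier A" for a \<kappa> \<kappa>'
  proof -
    obtain v v' where "v \<in> V" "formal_sum \<kappa> v" "v' \<in> V" "formal_sum \<kappa>' v'"
      using \<open>\<kappa> \<in> W\<close> \<open>\<kappa>' \<in> W\<close> by (auto simp: W_def)
    then have "h a \<otimes>\<^bsub>B\<^esub> v \<oplus>\<^bsub>B\<^esub> v' \<in> V"
      "formal_sum (\<lambda>t. a \<otimes> \<kappa> t \<oplus> \<kappa>' t) (h a \<otimes>\<^bsub>B\<^esub> v \<oplus>\<^bsub>B\<^esub> v')"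
      using V(3)[OF V(4)] formal_sum_combine \<open>a \<in> carrier A\<close> by simp_all
    then show ?thesis unfolding W_def by (intro CollectI bexI)
  qed
  \<comment> \<open>A certificate that \<open>p\<close> vanishes in
    \<open>(B / V) \<otimes> C\<close>: its coefficients are those of a finite sum of terms
    \<open>\<kappa> l \<otimes> d l\<close> with \<open>\<kappa> l\<close> in
    \<open>W\<close>.\<close>
  define cert where "cert = (\<lambda>p. \<exists>(n :: nat) \<kappa> d. (\<forall>l<n. \<kappa> l \<in> W \<and> d l \<in> carrier C) \<and>
    (\<forall>t. \<Phi> t p = (\<Oplus>\<^bsub>C\<^esub>l\<in>{..<n}. k (\<kappa> l t) \<otimes>\<^bsub>C\<^esub> d l)))"
  have cert_zero: "cert p" if "\<And>t. \<Phi> t p = \<zero>\<^bsub>C\<^esub>" for p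
    unfolding cert_def using that by (intro exI[of _ 0]) auto
  have cert_one: "cert p" if "\<kappa> \<in> W" "d \<in> carrier C" "\<And>t. \<Phi> t p = k (\<kappa> t) \<otimes>\<^bsub>C\<^esub> d" for p \<kappa> d
    unfolding cert_def using that W_closed[OF that(1)]
    by (intro exI[of _ "1 :: nat"] exI[of _ "\<lambda>_. \<kappa>"] exI[of _ "\<lambda>_. d"]) (auto simp: lessThan_Suc)
  have cert_diff: "cert (p - q)" if "cert p" "cert q" "Poly_Mapping.keys p \<subseteq> pairs" "Poly_Mapping.keys q \<subseteq> pairs" for p q
  proof -
    obtain m :: nat and \<kappa> d where 1: "\<And>l. l < m \<Longrightarrow> \<kappa> l \<in> W" "\<And>l. l < m \<Longrightarrow> d l \<in> carrier C"
      "\<And>t. \<Phi> t p = (\<Oplus>\<^bsub>C\<^esub>l\<in>{..<m}. k (\<kappa> l t) \<otimes>\<^bsub>C\<^esub> d l)" using \<open>cert p\<close> by (auto simp: cert_def)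
    obtain n :: nat and \<kappa>' d' where 2: "\<And>l. l < n \<Longrightarrow> \<kappa>' l \<in> W" "\<And>l. l < n \<Longrightarrow> d' l \<in> carrier C"
      "\<And>t. \<Phi> t q = (\<Oplus>\<^bsub>C\<^esub>l\<in>{..<n}. k (\<kappa>' l t) \<otimes>\<^bsub>C\<^esub> d' l)" using \<open>cert q\<close> by (auto simp: cert_def)
    define \<kappa>'' where "\<kappa>'' = (\<lambda>l. if l < m then \<kappa> l else \<kappa>' (l - m))"
    define d'' where "d'' = (\<lambda>l. if l < m then d l else \<ominus>\<^bsub>C\<^esub> d' (l - m))"
    have m: "\<kappa>'' l \<in> W" "d'' l \<in> carrier C" if "l < m + n" for l
      using 1(1,2) 2(1)[of "l - m"] 2(2)[of "l - m"] that by (auto simp: \<kappa>''_def d''_def)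
    have "\<Phi> t (p - q) = (\<Oplus>\<^bsub>C\<^esub>l\<in>{..<m + n}. k (\<kappa>'' l t) \<otimes>\<^bsub>C\<^esub> d'' l)" for t
    proof -
      have "(\<Oplus>\<^bsub>C\<^esub>l\<in>{..<m + n}. k (\<kappa>'' l t) \<otimes>\<^bsub>C\<^esub> d'' l) =
        (\<Oplus>\<^bsub>C\<^esub>l\<in>{..<m}. k (\<kappa>'' l t) \<otimes>\<^bsub>C\<^esub> d'' l) \<oplus>\<^bsub>C\<^esub> (\<Oplus>\<^bsub>C\<^esub>l\<in>{..<n}. k (\<kappa>'' (m + l) t) \<otimes>\<^bsub>C\<^esub> d'' (m + l))"
        using m W_closed by (intro C.S.finsum_append) auto
      also have "(\<Oplus>\<^bsub>C\<^esub>l\<in>{..<m}. k (\<kappa>'' l t) \<otimes>\<^bsub>C\<^esub> d'' l) = \<Phi> t p"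
        unfolding 1(3) using 1 W_closed by (intro C.S.finsum_cong2) (auto simp: \<kappa>''_def d''_def)
      also have "(\<Oplus>\<^bsub>C\<^esub>l\<in>{..<n}. k (\<kappa>'' (m + l) t) \<otimes>\<^bsub>C\<^esub> d'' (m + l)) =
          (\<Oplus>\<^bsub>C\<^esub>l\<in>{..<n}. \<ominus>\<^bsub>C\<^esub> \<one>\<^bsub>C\<^esub> \<otimes>\<^bsub>C\<^esub> (k (\<kappa>' l t) \<otimes>\<^bsub>C\<^esub> d' l))"
        using 2 W_closed by (intro C.S.finsum_cong2) (auto simp: \<kappa>''_def d''_def C.S.l_minus C.S.r_minus)
      also have "\<dots> = \<ominus>\<^bsub>C\<^esub> \<one>\<^bsub>C\<^esub> \<otimes>\<^bsub>C\<^esub> \<Phi> t q"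
        unfolding 2(3) using 2 W_closed by (intro C.S.finsum_rdistr[symmetric]) auto
      finally show ?thesis
        using \<Phi>_diff[OF that(3,4), of t] \<Phi>_closed[OF that(4), of t] by (simp add: a_minus_def C.S.l_minus)
    qed
    then show ?thesis unfolding cert_def using m by blast
  qed
  let ?e = "\<lambda>x t. if t = x then \<one> else \<zero>"
  \<comment> \<open>Additivity in the first entry and exchange of scalars yield formal sums of value
    0, which lie in \<open>W\<close>; additivity in the second entry is invisible to the
    \<open>\<Phi> t\<close>.\<close>
  have cert_rel: "cert r" if "r \<in> TI" for r
    using that
  proof (induction r rule: T.rel_induct)
    case zero show ?case by (rule cert_zero) (rule \<Phi>_zero)
  next
    case (diff p q) then show ?case using cert_diff TI_keys by blast
  next
    case (add_left x x' c)
    then have *: "x \<in> carrier B" "x' \<in> carrier B" "c \<in> carrier C" "x \<oplus>\<^bsub>B\<^esub> x' \<in> carrier B" by auto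
    let ?\<kappa> = "\<lambda>t. \<ominus> \<one> \<otimes> ?e x t \<oplus> (\<ominus> \<one> \<otimes> ?e x' t \<oplus> ?e (x \<oplus>\<^bsub>B\<^esub> x') t)"
    let ?v = "h (\<ominus> \<one>) \<otimes>\<^bsub>B\<^esub> x \<oplus>\<^bsub>B\<^esub> (h (\<ominus> \<one>) \<otimes>\<^bsub>B\<^esub> x' \<oplus>\<^bsub>B\<^esub> (x \<oplus>\<^bsub>B\<^esub> x'))"
    have "formal_sum ?\<kappa> ?v" by (intro formal_sum_combine formal_sum_single *) auto
    moreover have "?v = \<zero>\<^bsub>B\<^esub>" using * by (simp add: B.S.l_minus B.S.a_lcomm[of "\<ominus>\<^bsub>B\<^esub> x'"] B.S.l_neg)
    ultimately have "?\<kappa> \<in> W" using V(2) by (auto simp: W_def)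
    then have "cert (frag_of (x \<oplus>\<^bsub>B\<^esub> x', c) - frag_of (x, c) - frag_of (x', c))"
    proof (rule cert_one[OF _ *(3)])
      fix t
      have "\<Phi> t (frag_of (x \<oplus>\<^bsub>B\<^esub> x', c) - frag_of (x, c) - frag_of (x', c)) =
        (\<Phi> t (frag_of (x \<oplus>\<^bsub>B\<^esub> x', c)) \<ominus>\<^bsub>C\<^esub> \<Phi> t (frag_of (x, c))) \<ominus>\<^bsub>C\<^esub> \<Phi> t (frag_of (x', c))"
        by (rule \<Phi>_diff3) (use * in \<open>auto simp: pairs_def\<close>)
      then show "\<Phi> t (frag_of (x \<oplus>\<^bsub>B\<^esub> x', c) - frag_of (x, c) - frag_of (x', c)) = k (?\<kappa> t) \<otimes>\<^bsub>C\<^esub> c"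
        using * by (simp add: \<Phi>_of eq_commute[of t]) (auto simp: a_minus_def C.S.l_minus C.S.l_distr C.S.a_ac)
    qed
    then show ?case by simp
  next
    case (add_right x c c')
    then have *: "x \<in> carrier B" "c \<in> carrier C" "c' \<in> carrier C" "c \<oplus>\<^bsub>C\<^esub> c' \<in> carrier C" by auto
    have "cert (frag_of (x, c \<oplus>\<^bsub>C\<^esub> c') - frag_of (x, c) - frag_of (x, c'))"
    proof (rule cert_zero)
      fix t
      have "\<Phi> t (frag_of (x, c \<oplus>\<^bsub>C\<^esub> c') - frag_of (x, c) - frag_of (x, c')) =
        (\<Phi> t (frag_of (x, c \<oplus>\<^bsub>C\<^esub> c')) \<ominus>\<^bsub>C\<^esub> \<Phi> t (frag_of (x, c))) \<ominus>\<^bsub>C\<^esub> \<Phi> t (frag_of (x, c'))"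
        by (rule \<Phi>_diff3) (use * in \<open>auto simp: pairs_def\<close>)
      then show "\<Phi> t (frag_of (x, c \<oplus>\<^bsub>C\<^esub> c') - frag_of (x, c) - frag_of (x, c')) = \<zero>\<^bsub>C\<^esub>"
        using * by (simp add: \<Phi>_of) (auto simp: a_minus_def C.S.a_ac C.S.r_neg C.S.r_neg1 C.S.r_neg2)
    qed
    then show ?case by simp
  next
    case (smult a x c)
    then have *: "a \<in> carrier A" "x \<in> carrier B" "c \<in> carrier C" "h a \<otimes>\<^bsub>B\<^esub> x \<in> carrier B" "k a \<otimes>\<^bsub>C\<^esub> c \<in> carrier C" by auto
    let ?\<kappa> = "\<lambda>t. \<ominus> a \<otimes> ?e x t \<oplus> ?e (h a \<otimes>\<^bsub>B\<^esub> x) t"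
    have "formal_sum ?\<kappa> (h (\<ominus> a) \<otimes>\<^bsub>B\<^esub> x \<oplus>\<^bsub>B\<^esub> h a \<otimes>\<^bsub>B\<^esub> x)"
      using * by (intro formal_sum_combine formal_sum_single) auto
    moreover have "h (\<ominus> a) \<otimes>\<^bsub>B\<^esub> x \<oplus>\<^bsub>B\<^esub> h a \<otimes>\<^bsub>B\<^esub> x = \<zero>\<^bsub>B\<^esub>"
      using * by (simp add: B.S.l_minus B.S.l_neg)
    ultimately have "?\<kappa> \<in> W" using V(2) by (auto simp: W_def)
    then have "cert (frag_of (h a \<otimes>\<^bsub>B\<^esub> x, c) - frag_of (x, k a \<otimes>\<^bsub>C\<^esub> c))"
    proof (rule cert_one[OF _ *(3)])
      fix t
      have "\<Phi> t (frag_of (h a \<otimes>\<^bsub>B\<^esub> x, c) - frag_of (x, k a \<otimes>\<^bsub>C\<^esub> c)) =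
        \<Phi> t (frag_of (h a \<otimes>\<^bsub>B\<^esub> x, c)) \<ominus>\<^bsub>C\<^esub> \<Phi> t (frag_of (x, k a \<otimes>\<^bsub>C\<^esub> c))"
        using * by (intro \<Phi>_diff) (auto simp: keys_frag_of pairs_def)
      then show "\<Phi> t (frag_of (h a \<otimes>\<^bsub>B\<^esub> x, c) - frag_of (x, k a \<otimes>\<^bsub>C\<^esub> c)) = k (?\<kappa> t) \<otimes>\<^bsub>C\<^esub> c"
        using * by (simp add: \<Phi>_of eq_commute[of t]) (auto simp: a_minus_def C.S.l_minus C.S.l_distr C.S.a_ac)
    qed
    then show ?case by simp
  qed
  have y1: "Poly_Mapping.keys (frag_of (y, \<one>\<^bsub>C\<^esub>)) \<subseteq> pairs" "Poly_Mapping.keys (frag_of (\<one>\<^bsub>B\<^esub>, z)) \<subseteq> pairs"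
    using y z by (auto simp: keys_frag_of pairs_def)
  have r: "frag_of (y, \<one>\<^bsub>C\<^esub>) - frag_of (\<one>\<^bsub>B\<^esub>, z) \<in> TI" using eq y z te_eq_iff by simp
  \<comment> \<open>If 1 lies in \<open>V\<close>, the formal sum consisting of 1 alone belongs to
    \<open>W\<close> and accounts for \<open>1 \<otimes> z\<close>.\<close>
  have cert_z: "cert (frag_of (\<one>\<^bsub>B\<^esub>, z))"
  proof (cases "z = \<zero>\<^bsub>C\<^esub>")
    case True
    then show ?thesis by (intro cert_zero) (simp add: \<Phi>_of)
  next
    case False
    then have "?e \<one>\<^bsub>B\<^esub> \<in> W" using Vz formal_sum_single[of "\<one>\<^bsub>B\<^esub>"] by (auto simp: W_def)
    then show ?thesis by (rule cert_one[OF _ z]) (use z in \<open>simp add: \<Phi>_of eq_commute\<close>)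
  qed
  have "cert 0" by (rule cert_zero) (rule \<Phi>_zero)
  then have "cert (0 - frag_of (\<one>\<^bsub>B\<^esub>, z))" by (rule cert_diff[OF _ cert_z _ y1(2)]) simp
  moreover have "Poly_Mapping.keys (0 - frag_of (\<one>\<^bsub>B\<^esub>, z)) \<subseteq> pairs" by (rule keys_diff_subset[OF _ y1(2)]) simp
  ultimately have "cert ((frag_of (y, \<one>\<^bsub>C\<^esub>) - frag_of (\<one>\<^bsub>B\<^esub>, z)) - (0 - frag_of (\<one>\<^bsub>B\<^esub>, z)))"
    by (rule cert_diff[OF cert_rel[OF r] _ TI_keys[OF r]])
  then have "cert (frag_of (y, \<one>\<^bsub>C\<^esub>))" by simp
  then obtain n :: nat and \<kappa> d where n: "\<And>l. l < n \<Longrightarrow> \<kappa> l \<in> W" "\<And>l. l < n \<Longrightarrow> d l \<in> carrier C"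
    "\<And>t. \<Phi> t (frag_of (y, \<one>\<^bsub>C\<^esub>)) = (\<Oplus>\<^bsub>C\<^esub>l\<in>{..<n}. k (\<kappa> l t) \<otimes>\<^bsub>C\<^esub> d l)" by (auto simp: cert_def)
  have nc: "\<kappa> l t \<in> carrier A" if "l < n" for l t using W_closed n(1) that by blast
  \<comment> \<open>The unknowns are the \<open>d l\<close> and, in last place, the constant 1. For
    each \<open>t\<close> the certificate of \<open>y \<otimes> 1\<close> is a linear equation over
    \<open>A\<close> between them: the sum of the \<open>\<kappa> l t d l\<close> is 1 for
    \<open>t = y\<close> and 0 otherwise.\<close>
  define b where "b = (\<lambda>l. if l < n then d l else \<one>\<^bsub>C\<^esub>)"
  have "b n \<in> Q"
  proof (rule C.flat_solution_in_ideal[OF noeth flat Q])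
    show "b l \<in> carrier C" if "l < Suc n" for l using n(2) by (auto simp: b_def)
    show "n < Suc n" by simp
    fix u assume u: "u \<in> vecs A (Suc n)"
      and row: "\<And>r. r \<in> UNIV \<rightarrow> carrier A \<Longrightarrow> (\<Oplus>\<^bsub>C\<^esub>i\<in>{..<Suc n}. k (r i) \<otimes>\<^bsub>C\<^esub> b i) = \<zero>\<^bsub>C\<^esub> \<Longrightarrow>
        (\<Oplus>i\<in>{..<Suc n}. r i \<otimes> u i) = \<zero>"
    have uc: "u i \<in> carrier A" for i using u by (auto simp: vecs_def)
    \<comment> \<open>For a solution \<open>u\<close> over \<open>A\<close> the same combination of
      the \<open>\<kappa> i\<close> stays in \<open>W\<close>, and by the equations it is
      \<open>u n\<close> times the basis element \<open>y\<close>. Hence its value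
      \<open>h (u n) y\<close> lies in \<open>V\<close>.\<close>
    define \<kappa>' where "\<kappa>' = (\<lambda>m t. \<Oplus>i\<in>{..<m}. u i \<otimes> \<kappa> i t)"
    have "\<kappa>' m \<in> W" if "m \<le> n" for m
      using that
    proof (induction m)
      case 0 then show ?case using W_zero by (simp add: \<kappa>'_def)
    next
      case (Suc m)
      have "\<kappa>' (Suc m) = (\<lambda>t. u m \<otimes> \<kappa> m t \<oplus> \<kappa>' m t)"
        unfolding \<kappa>'_def lessThan_Suc using Suc.prems uc nc by (intro ext B.R.finsum_insert) auto
      then show ?case using W_comb[OF n(1) _ uc] Suc by simp
    qed
    then have "\<kappa>' n \<in> W" by simp
    then obtain v where v: "v \<in> V" "formal_sum (\<kappa>' n) v" by (auto simp: W_def)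
    have val: "\<kappa>' n t = (if t = y then u n else \<zero>)" for t
    proof -
      \<comment> \<open>The coefficients of the equation belonging to \<open>t\<close>, with -1 at
        the constant when \<open>t = y\<close>.\<close>
      define r where "r = (\<lambda>i. if i < n then \<kappa> i t else if t = y then \<ominus> \<one> else \<zero>)"
      have rc: "r i \<in> carrier A" for i using nc by (auto simp: r_def)
      have "(\<Oplus>\<^bsub>C\<^esub>i\<in>{..<Suc n}. k (r i) \<otimes>\<^bsub>C\<^esub> b i) = k (r n) \<otimes>\<^bsub>C\<^esub> b n \<oplus>\<^bsub>C\<^esub> (\<Oplus>\<^bsub>C\<^esub>i\<in>{..<n}. k (r i) \<otimes>\<^bsub>C\<^esub> b i)"
        unfolding lessThan_Suc using rc n(2) by (intro C.S.finsum_insert) (auto simp: b_def)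
      also have "(\<Oplus>\<^bsub>C\<^esub>i\<in>{..<n}. k (r i) \<otimes>\<^bsub>C\<^esub> b i) = \<Phi> t (frag_of (y, \<one>\<^bsub>C\<^esub>))"
        unfolding n(3) using nc n(2) by (intro C.S.finsum_cong2) (auto simp: r_def b_def)
      also have "k (r n) \<otimes>\<^bsub>C\<^esub> b n \<oplus>\<^bsub>C\<^esub> \<Phi> t (frag_of (y, \<one>\<^bsub>C\<^esub>)) = \<zero>\<^bsub>C\<^esub>"
        using y by (auto simp: \<Phi>_of r_def b_def C.S.l_neg)
      finally have "(\<Oplus>i\<in>{..<Suc n}. r i \<otimes> u i) = \<zero>" using row rc by blast
      moreover have "(\<Oplus>i\<in>{..<Suc n}. r i \<otimes> u i) = r n \<otimes> u n \<oplus> (\<Oplus>i\<in>{..<n}. r i \<otimes> u i)"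
        unfolding lessThan_Suc using rc uc by (intro B.R.finsum_insert) auto
      moreover have "(\<Oplus>i\<in>{..<n}. r i \<otimes> u i) = \<kappa>' n t"
        unfolding \<kappa>'_def using uc nc by (intro B.R.finsum_cong2) (auto simp: r_def B.R.m_comm)
      ultimately have z: "r n \<otimes> u n \<oplus> \<kappa>' n t = \<zero>" by simp
      have c: "\<kappa>' n t \<in> carrier A" using formal_sum_closed[OF v(2)] .
      have "\<kappa>' n t = \<ominus> (r n \<otimes> u n)"
        using B.R.sum_zero_eq_neg[of "\<kappa>' n t" "r n \<otimes> u n"] z c rc uc by (simp add: B.R.a_comm)
      then show ?thesis using uc by (auto simp: r_def B.R.l_minus)
    qed
    have "v = h (\<kappa>' n y) \<otimes>\<^bsub>B\<^esub> y" by (rule formal_sum_at[OF v(2) _ y]) (simp add: val)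
    then have "h (u n) \<otimes>\<^bsub>B\<^esub> y \<in> V" using v(1) val[of y] by simp
    then show "k (u n) \<in> Q" by (rule sol[OF uc])
  qed
  then show ?thesis by (simp add: b_def)
qed

end

section \<open>Descent along flat coverings\<close>

context cring
begin

lemma idealI_mult:
  assumes "J \<subseteq> carrier R" "\<zero> \<in> J" "\<And>a b. a \<in> J \<Longrightarrow> b \<in> J \<Longrightarrow> a \<oplus> b \<in> J"
    "\<And>a x. a \<in> J \<Longrightarrow> x \<in> carrier R \<Longrightarrow> x \<otimes> a \<in> J"
  shows "ideal J R"
proof (rule idealI[OF ring_axioms])
  show "subgroup J (add_monoid R)"
  proof (rule add.subgroupI)
    fix a assume a: "a \<in> J"
    have "\<ominus> \<one> \<otimes> a \<in> J" using assms(4)[OF a] by simp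
    then show "\<ominus> a \<in> J" using assms(1) a by (simp add: l_minus subset_iff)
  qed (use assms in auto)
  fix a x assume a: "a \<in> J" "x \<in> carrier R"
  show "x \<otimes> a \<in> J" by (rule assms(4)[OF a])
  then show "a \<otimes> x \<in> J" using assms(1) a by (simp add: m_comm subset_iff)
qed

lemma annihilator_ideal:
  assumes "a \<in> carrier R"
  shows "ideal {x \<in> carrier R. a \<otimes> x = \<zero>} R"
  using assms by (intro idealI_mult) (auto simp: r_distr m_lcomm)

text \<open>An ideal maximal among those containing \<open>J\<close> but not 1 is a maximal ideal.
  Zorn's lemma applies because over a Noetherian ring a nonempty chain of ideals contains its
  union.\<close>

lemma exists_prime_containing:
  assumes noeth: "noetherian_ring R" and J: "ideal J R" and proper: "\<one> \<notin> J"
  shows "\<exists>P. primeideal P R \<and> J \<subseteq> P"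
proof -
  let ?S = "{P. ideal P R \<and> J \<subseteq> P \<and> \<one> \<notin> P}"
  have "\<exists>M\<in>?S. \<forall>P\<in>?S. M \<subseteq> P \<longrightarrow> P = M"
  proof (rule subset_Zorn_nonempty)
    show "?S \<noteq> {}" using J proper by blast
    fix C assume C: "C \<noteq> {}" "subset.chain ?S C"
    then have "subset.chain {I. ideal I R} C" unfolding subset_chain_def by blast
    then have "\<Union>C \<in> C" using noetherian_ring.ideal_chain_is_trivial[OF noeth C(1)] by blast
    then show "\<Union>C \<in> ?S" using C(2) unfolding subset_chain_def by blast
  qed
  then obtain M where "M \<in> ?S" and max: "\<forall>P\<in>?S. M \<subseteq> P \<longrightarrow> P = M" by (elim bexE)
  then have M: "ideal M R" "J \<subseteq> M" "\<one> \<notin> M" by simp_all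
  have "maximalideal M R"
  proof (rule maximalidealI[OF M(1)])
    show "carrier R \<noteq> M" using M(3) by blast
    fix P assume P: "ideal P R" "M \<subseteq> P"
    show "P = M \<or> P = carrier R"
    proof (cases "\<one> \<in> P")
      case True then show ?thesis using ideal.one_imp_carrier[OF P(1)] by blast
    next
      case False
      then have "P \<in> ?S" using P M(2) by simp
      then show ?thesis using bspec[OF max] P(2) by simp
    qed
  qed
  then show ?thesis using maximalideal_prime M(2) by blast
qed

lemma recurrence_extend:
  assumes f: "f \<in> UNIV \<rightarrow> carrier R" and q: "recurrence R f m q" and mn: "m \<le> n"
  shows "\<exists>q'. recurrence R f n q' \<and> q' 0 = q 0"
  using mn
proof (induction n rule: dec_induct)
  case base then show ?case using q by blast
next
  case (step n)
  then obtain q' where q': "recurrence R f n q'" "q' 0 = q 0" by blast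
  have "recurrence R f (Suc n) (q'(Suc n := \<zero>))" by (rule recurrence_Suc[OF f q'(1)])
  moreover have "(q'(Suc n := \<zero>)) 0 = q 0" using q'(2) by simp
  ultimately show ?case by blast
qed

text \<open>Modulo \<open>J\<close> the minors of size \<open>m\<close> vanish, and
  \<open>minors_vanish_mono\<close> in the quotient ring handles the larger ones.\<close>

lemma minors_in_ideal_mono:
  fixes r s :: "nat \<Rightarrow> nat"
  assumes f: "f \<in> UNIV \<rightarrow> carrier R" and J: "ideal J R"
    and m: "\<And>r s :: nat \<Rightarrow> nat. det_in R m (\<lambda>i j. f (r i + s j)) \<in> J" and mn: "m \<le> n"
  shows "det_in R n (\<lambda>i j. f (r i + s j)) \<in> J"
proof -
  interpret J: ideal J R by (rule J)
  interpret h: ring_hom_cring R "R Quot J" "(+>) J" by (rule J.rcos_ring_hom_cring[OF is_cring])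
  have mat: "mat_in n (\<lambda>i j. f (r i + s j))" for n and r s :: "nat \<Rightarrow> nat"
    using f by (auto simp: mat_in_def)
  have zero: "J +> x = \<zero>\<^bsub>R Quot J\<^esub> \<longleftrightarrow> x \<in> J" if "x \<in> carrier R" for x
  proof -
    have z: "\<zero>\<^bsub>R Quot J\<^esub> = J" by (simp only: FactRing_def ring.simps)
    show ?thesis unfolding z
    proof
      assume "J +> x = J"
      then show "x \<in> J" using J.a_rcos_self[OF that] by simp
    next
      assume "x \<in> J"
      then show "J +> x = J" by (rule J.a_rcos_const)
    qed
  qed
  have hdet: "J +> det_in R n (\<lambda>i j. f (r i + s j)) =
      det_in (R Quot J) n (\<lambda>i j. ((+>) J \<circ> f) (r i + s j))" for n r s
    using h.hom_det_in[OF mat[of n r s]] by simp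
  have fJ: "(+>) J \<circ> f \<in> UNIV \<rightarrow> carrier (R Quot J)" using f h.hom_closed by (auto simp: Pi_iff)
  have "minors_vanish (R Quot J) m (hankel ((+>) J \<circ> f))"
    by (rule h.S.minors_vanishI) (use hdet[symmetric] zero m det_in_closed[OF mat] in simp)
  then have "minors_vanish (R Quot J) n (hankel ((+>) J \<circ> f))"
    by (rule h.S.minors_vanish_mono[OF fJ _ mn])
  then have "J +> det_in R n (\<lambda>i j. f (r i + s j)) = \<zero>\<^bsub>R Quot J\<^esub>"
    unfolding hdet by (rule h.S.minors_vanish_imp_all[OF fJ])
  then show ?thesis using zero det_in_closed[OF mat] by blast
qed

text \<open>The elements killed by some member of the multiplicative set \<open>S\<close> form the
  kernel of localisation at \<open>S\<close>. This ideal is finitely generated, and a product of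
  annihilators of its generators kills all of it.\<close>

lemma noetherian_common_annihilator:
  assumes noeth: "noetherian_ring R"
    and S: "\<one> \<in> S" "\<And>a b. a \<in> S \<Longrightarrow> b \<in> S \<Longrightarrow> a \<otimes> b \<in> S" "S \<subseteq> carrier R"
  shows "\<exists>u\<in>S. \<forall>x\<in>carrier R. (\<exists>c\<in>S. c \<otimes> x = \<zero>) \<longrightarrow> u \<otimes> x = \<zero>"
proof -
  let ?Z = "{x \<in> carrier R. \<exists>c\<in>S. c \<otimes> x = \<zero>}"
  have "ideal ?Z R"
  proof (rule idealI_mult)
    show "\<zero> \<in> ?Z" using S(1) by (auto intro: bexI[of _ "\<one>"])
  next
    fix a b assume "a \<in> ?Z" "b \<in> ?Z"
    then obtain c d where cd: "a \<in> carrier R" "b \<in> carrier R" "c \<in> S" "d \<in> S" "c \<otimes> a = \<zero>" "d \<otimes> b = \<zero>" by blast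
    then have cR: "c \<in> carrier R" "d \<in> carrier R" using S by auto
    have "(c \<otimes> d) \<otimes> (a \<oplus> b) = d \<otimes> (c \<otimes> a) \<oplus> c \<otimes> (d \<otimes> b)"
      using cd(1,2) cR by (simp add: r_distr m_ac)
    then have "(c \<otimes> d) \<otimes> (a \<oplus> b) = \<zero>" using cd cR by simp
    then show "a \<oplus> b \<in> ?Z" using cd S(2)[of c d] by blast
  next
    fix a x assume "a \<in> ?Z" "x \<in> carrier R"
    then obtain c where c: "a \<in> carrier R" "c \<in> S" "c \<otimes> a = \<zero>" by blast
    then have "c \<in> carrier R" using S by auto
    then have "c \<otimes> (x \<otimes> a) = \<zero>" using c \<open>x \<in> carrier R\<close> m_lcomm[of c x a] by simp
    then show "x \<otimes> a \<in> ?Z" using c \<open>x \<in> carrier R\<close> by blast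
  qed blast
  then have "\<exists>G\<subseteq>carrier R. finite G \<and> ?Z = Idl G" by (rule noetherian_ring.finetely_gen[OF noeth])
  then obtain G where G: "G \<subseteq> carrier R" "finite G" "?Z = Idl G" by (elim exE conjE)
  have "G \<subseteq> ?Z" unfolding G(3) by (rule genideal_self[OF G(1)])
  with G(2) have "\<exists>u\<in>S. \<forall>x\<in>G. u \<otimes> x = \<zero>"
  proof (induction G rule: finite_induct)
    case empty then show ?case using S by blast
  next
    case (insert g G)
    then have "\<exists>u\<in>S. \<forall>x\<in>G. u \<otimes> x = \<zero>" by simp
    then obtain u where u1: "u \<in> S" "\<forall>x\<in>G. u \<otimes> x = \<zero>" by (elim bexE)
    have "\<exists>c\<in>S. c \<otimes> g = \<zero>" using insert.prems by simp
    then obtain c where "c \<in> S" "c \<otimes> g = \<zero>" by (elim bexE)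
    with u1 have u: "u \<in> S" "\<forall>x\<in>G. u \<otimes> x = \<zero>" "c \<in> S" "c \<otimes> g = \<zero>" by simp_all
    then have cR: "c \<in> carrier R" "u \<in> carrier R" using S by auto
    have g: "g \<in> carrier R" "G \<subseteq> carrier R" using insert.prems by auto
    have "(c \<otimes> u) \<otimes> x = \<zero>" if "x \<in> insert g G" for x
    proof (cases "x = g")
      case True
      then have "(c \<otimes> u) \<otimes> x = u \<otimes> (c \<otimes> g)" using cR g by (simp add: m_ac)
      then show ?thesis using u cR by simp
    next
      case False
      then have x: "x \<in> G" "x \<in> carrier R" using that g by auto
      then have "(c \<otimes> u) \<otimes> x = c \<otimes> (u \<otimes> x)" using cR by (simp add: m_assoc)
      then show ?thesis using u x cR by simp
    qed
    then show ?case using S(2)[of c u] u by blast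
  qed
  then obtain u where u: "u \<in> S" "\<And>x. x \<in> G \<Longrightarrow> u \<otimes> x = \<zero>" by blast
  have uR: "u \<in> carrier R" using u S by blast
  have "Idl G \<subseteq> {x \<in> carrier R. u \<otimes> x = \<zero>}"
    using annihilator_ideal[OF uR] u G(1) by (intro genideal_minimal) auto
  then have "\<forall>x\<in>?Z. u \<otimes> x = \<zero>" unfolding G(3) by blast
  then show ?thesis using u(1) by blast
qed

end

text \<open>The case of one unknown: the linear equations satisfied by \<open>b\<close> are its
  annihilators in \<open>R\<close>.\<close>

lemma (in ring_hom_cring) flat_element_in_ideal:
  assumes noeth: "noetherian_ring R" and flat: "flat_module R (scalars_along h S)"
    and Q: "ideal Q S" and b: "b \<in> carrier S"
    and sol: "\<And>u. u \<in> carrier R \<Longrightarrow>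
      (\<And>r. r \<in> carrier R \<Longrightarrow> h r \<otimes>\<^bsub>S\<^esub> b = \<zero>\<^bsub>S\<^esub> \<Longrightarrow> r \<otimes> u = \<zero>) \<Longrightarrow> h u \<in> Q"
  shows "b \<in> Q"
proof (rule flat_solution_in_ideal[OF noeth flat Q, where n=1 and l=0 and b="\<lambda>_. b"])
  fix u assume u: "u \<in> vecs R 1"
    and rows: "\<And>r. r \<in> UNIV \<rightarrow> carrier R \<Longrightarrow> (\<Oplus>\<^bsub>S\<^esub>i\<in>{..<1}. h (r i) \<otimes>\<^bsub>S\<^esub> b) = \<zero>\<^bsub>S\<^esub> \<Longrightarrow>
      (\<Oplus>i\<in>{..<1}. r i \<otimes> u i) = \<zero>"
  have uc: "u 0 \<in> carrier R" using u by (auto simp: vecs_def)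
  show "h (u 0) \<in> Q"
  proof (rule sol[OF uc])
    fix r assume r: "r \<in> carrier R" "h r \<otimes>\<^bsub>S\<^esub> b = \<zero>\<^bsub>S\<^esub>"
    show "r \<otimes> u 0 = \<zero>" using rows[of "\<lambda>_. r"] r b uc by (simp add: lessThan_Suc)
  qed
qed (use b in auto)

section \<open>Flat coverings of a Noetherian ring\<close>

locale flat_covering =
  A: cring A for A :: "'a ring" (structure) +
  fixes I :: "'i set" and B :: "'i \<Rightarrow> 'b ring" and h :: "'i \<Rightarrow> 'a \<Rightarrow> 'b"
  assumes noeth: "noetherian_ring A"
    and cringB: "i \<in> I \<Longrightarrow> cring (B i)"
    and hom: "i \<in> I \<Longrightarrow> h i \<in> ring_hom A (B i)"
    and flat: "i \<in> I \<Longrightarrow> flat_module A (scalars_along (h i) (B i))"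
    and surj: "Spec A \<subseteq> (\<Union>i\<in>I. spec_map A (h i) ` Spec (B i))"
begin

lemma hom_cring: "i \<in> I \<Longrightarrow> ring_hom_cring A (B i) (h i)"
  using hom cringB A.is_cring by (simp add: ring_hom_cring_def ring_hom_cring_axioms_def)

text \<open>A prime containing \<open>J\<close> would be the contraction of a prime \<open>Q\<close>
  of some member. Asking for \<open>1 \<in> Q\<close>, which is absurd, matches the form in which
  the flatness criteria deliver their conclusion.\<close>

lemma unit_ideal:
  assumes J: "ideal J A"
    and loc: "\<And>i Q. i \<in> I \<Longrightarrow> primeideal Q (B i) \<Longrightarrow> (\<And>c. c \<in> J \<Longrightarrow> h i c \<in> Q) \<Longrightarrow> \<one>\<^bsub>B i\<^esub> \<in> Q"
  shows "\<one> \<in> J"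
proof (rule ccontr)
  assume "\<one> \<notin> J"
  then obtain P where P: "primeideal P A" "J \<subseteq> P" using A.exists_prime_containing[OF noeth J] by blast
  then have "P \<in> Spec A" by (simp add: Spec_def)
  then obtain i Q where i: "i \<in> I" "Q \<in> Spec (B i)" "P = spec_map A (h i) Q" using surj by blast
  then have Q: "primeideal Q (B i)" by (simp add: Spec_def)
  have "h i c \<in> Q" if "c \<in> J" for c using that P(2) i(3) by (auto simp: spec_map_def)
  then have "\<one>\<^bsub>B i\<^esub> \<in> Q" by (rule loc[OF i(1) Q])
  then have "carrier (B i) = Q" using ideal.one_imp_carrier[OF primeideal.axioms(1)[OF Q]] by simp
  then show False using primeideal.I_notcarr[OF Q] by simp
qed

text \<open>In each member 1 satisfies the equation \<open>a x = 0\<close>, so the annihilator of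
  \<open>a\<close> is the unit ideal.\<close>

lemma jointly_injective:
  assumes a: "a \<in> carrier A" and 0: "\<And>i. i \<in> I \<Longrightarrow> h i a = \<zero>\<^bsub>B i\<^esub>"
  shows "a = \<zero>"
proof -
  let ?J = "{x \<in> carrier A. a \<otimes> x = \<zero>}"
  have "\<one> \<in> ?J"
  proof (rule unit_ideal[OF A.annihilator_ideal[OF a]])
    fix i Q assume i: "i \<in> I" and Q: "primeideal Q (B i)" and J: "\<And>c. c \<in> ?J \<Longrightarrow> h i c \<in> Q"
    interpret h: ring_hom_cring A "B i" "h i" by (rule hom_cring[OF i])
    show "\<one>\<^bsub>B i\<^esub> \<in> Q"
    proof (rule h.flat_element_in_ideal[OF noeth flat[OF i] primeideal.axioms(1)[OF Q]])
      fix u assume u: "u \<in> carrier A"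
        and rows: "\<And>r. r \<in> carrier A \<Longrightarrow> h i r \<otimes>\<^bsub>B i\<^esub> \<one>\<^bsub>B i\<^esub> = \<zero>\<^bsub>B i\<^esub> \<Longrightarrow> r \<otimes> u = \<zero>"
      have "a \<otimes> u = \<zero>" using rows[OF a] 0[OF i] by simp
      then show "h i u \<in> Q" using J u by simp
    qed simp
  qed
  then show ?thesis using a by simp
qed

lemma jointly_injective_eq:
  assumes "a \<in> carrier A" "b \<in> carrier A" "\<And>i. i \<in> I \<Longrightarrow> h i a = h i b"
  shows "a = b"
proof -
  have "h i (a \<ominus> b) = \<zero>\<^bsub>B i\<^esub>" if i: "i \<in> I" for i
  proof -
    interpret h: ring_hom_cring A "B i" "h i" by (rule hom_cring[OF i])
    show ?thesis using assms(1,2) assms(3)[OF i] by (simp add: a_minus_def h.S.r_neg)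
  qed
  then have "a \<ominus> b = \<zero>" using assms by (intro jointly_injective) auto
  then show ?thesis using assms by simp
qed

lemma tensor_algebras: "i \<in> I \<Longrightarrow> j \<in> I \<Longrightarrow> tensor_algebras A (B i) (h i) (B j) (h j)"
  by (intro tensor_algebras.intro hom_cring)

lemma glue:
  assumes y: "\<And>i. i \<in> I \<Longrightarrow> y i \<in> carrier (B i)"
    and comp: "\<And>i j. i \<in> I \<Longrightarrow> j \<in> I \<Longrightarrow>
      tensor_elem A (h i) (B i) (h j) (B j) (y i) \<one>\<^bsub>B j\<^esub> = tensor_elem A (h i) (B i) (h j) (B j) \<one>\<^bsub>B i\<^esub> (y j)"
  shows "\<exists>a\<in>carrier A. \<forall>i\<in>I. h i a = y i"
proof -
  \<comment> \<open>Common denominators: one \<open>c\<close> and one \<open>a\<close> for all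
    members.\<close>
  let ?J = "{c \<in> carrier A. \<exists>a\<in>carrier A. \<forall>i\<in>I. h i c \<otimes>\<^bsub>B i\<^esub> y i = h i a}"
  have "ideal ?J A"
  proof (rule A.idealI_mult)
    have "h i \<zero> \<otimes>\<^bsub>B i\<^esub> y i = h i \<zero>" if i: "i \<in> I" for i
    proof -
      interpret h: ring_hom_cring A "B i" "h i" by (rule hom_cring[OF i])
      show ?thesis using y[OF i] by simp
    qed
    then show "\<zero> \<in> ?J" by blast
  next
    fix c d assume "c \<in> ?J" "d \<in> ?J"
    then obtain a b where ab: "c \<in> carrier A" "d \<in> carrier A" "a \<in> carrier A" "b \<in> carrier A"
      "\<And>i. i \<in> I \<Longrightarrow> h i c \<otimes>\<^bsub>B i\<^esub> y i = h i a" "\<And>i. i \<in> I \<Longrightarrow> h i d \<otimes>\<^bsub>B i\<^esub> y i = h i b" by blast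
    have "h i (c \<oplus> d) \<otimes>\<^bsub>B i\<^esub> y i = h i (a \<oplus> b)" if i: "i \<in> I" for i
    proof -
      interpret h: ring_hom_cring A "B i" "h i" by (rule hom_cring[OF i])
      show ?thesis using y[OF i] ab by (simp add: h.S.l_distr i)
    qed
    then show "c \<oplus> d \<in> ?J" using ab(1-4) by blast
  next
    fix c x assume "c \<in> ?J" and x: "x \<in> carrier A"
    then obtain a where a: "c \<in> carrier A" "a \<in> carrier A" "\<And>i. i \<in> I \<Longrightarrow> h i c \<otimes>\<^bsub>B i\<^esub> y i = h i a" by blast
    have "h i (x \<otimes> c) \<otimes>\<^bsub>B i\<^esub> y i = h i (x \<otimes> a)" if i: "i \<in> I" for i
    proof -
      interpret h: ring_hom_cring A "B i" "h i" by (rule hom_cring[OF i])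
      show ?thesis using y[OF i] a x by (simp add: h.S.m_assoc i)
    qed
    then show "x \<otimes> c \<in> ?J" using a(1,2) x by blast
  qed blast
  then have "\<one> \<in> ?J"
  proof (rule unit_ideal)
    fix i Q assume i: "i \<in> I" and Q: "primeideal Q (B i)" and JQ: "\<And>c. c \<in> ?J \<Longrightarrow> h i c \<in> Q"
    interpret Q: primeideal Q "B i" by (rule Q)
    interpret hi: ring_hom_cring A "B i" "h i" by (rule hom_cring[OF i])
    show "\<one>\<^bsub>B i\<^esub> \<in> Q"
    proof (rule ccontr)
      assume one: "\<one>\<^bsub>B i\<^esub> \<notin> Q"
      \<comment> \<open>A denominator for \<open>y i\<close> alone, from the matching condition of
        \<open>i\<close> with itself and with the image of \<open>A\<close> as
        \<open>V\<close>.\<close>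
      have "\<exists>c0\<in>carrier A. \<exists>a0\<in>carrier A. h i c0 \<notin> Q \<and> h i c0 \<otimes>\<^bsub>B i\<^esub> y i = h i a0"
      proof (rule ccontr)
        assume neg: "\<not> (\<exists>c0\<in>carrier A. \<exists>a0\<in>carrier A. h i c0 \<notin> Q \<and> h i c0 \<otimes>\<^bsub>B i\<^esub> y i = h i a0)"
        interpret T: tensor_algebras A "B i" "h i" "B i" "h i" by (rule tensor_algebras[OF i i])
        have "\<one>\<^bsub>B i\<^esub> \<in> Q"
        proof (rule T.te_eq_imp[OF noeth flat[OF i] y[OF i] y[OF i] comp[OF i i], where V = "h i ` carrier A"])
          show "h i ` carrier A \<subseteq> carrier (B i)" by auto
          show "\<zero>\<^bsub>B i\<^esub> \<in> h i ` carrier A" using hi.hom_zero by (metis A.zero_closed imageI)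
          show "\<one>\<^bsub>B i\<^esub> \<in> h i ` carrier A \<or> y i = \<zero>\<^bsub>B i\<^esub>" using hi.hom_one by (metis A.one_closed imageI)
          show "ideal Q (B i)" by (rule Q.is_ideal)
        next
          fix v w assume "v \<in> h i ` carrier A" "w \<in> h i ` carrier A"
          then obtain a b where "a \<in> carrier A" "b \<in> carrier A" "v = h i a" "w = h i b" by blast
          then show "v \<oplus>\<^bsub>B i\<^esub> w \<in> h i ` carrier A" by (intro image_eqI[of _ _ "a \<oplus> b"]) auto
        next
          fix a v assume "a \<in> carrier A" "v \<in> h i ` carrier A"
          then obtain b where "a \<in> carrier A" "b \<in> carrier A" "v = h i b" by blast
          then show "h i a \<otimes>\<^bsub>B i\<^esub> v \<in> h i ` carrier A" by (intro image_eqI[of _ _ "a \<otimes> b"]) auto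
        next
          fix c assume "c \<in> carrier A" "h i c \<otimes>\<^bsub>B i\<^esub> y i \<in> h i ` carrier A"
          then show "h i c \<in> Q" using neg by blast
        qed
        then show False using one by simp
      qed
      then obtain c0 a0 where c0: "c0 \<in> carrier A" "a0 \<in> carrier A" "h i c0 \<notin> Q" "h i c0 \<otimes>\<^bsub>B i\<^esub> y i = h i a0"
        by blast
      \<comment> \<open>The error of the fraction \<open>a0 / c0\<close> at the member
        \<open>j\<close>; it vanishes for \<open>j = i\<close>.\<close>
      define w where "w = (\<lambda>j. h j c0 \<otimes>\<^bsub>B j\<^esub> y j \<ominus>\<^bsub>B j\<^esub> h j a0)"
      have w: "w j \<in> carrier (B j)" if j: "j \<in> I" for j
      proof -
        interpret hj: ring_hom_cring A "B j" "h j" by (rule hom_cring[OF j])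
        show ?thesis using y[OF j] c0 by (simp add: w_def)
      qed
      let ?S = "{c \<in> carrier A. h i c \<notin> Q}"
      \<comment> \<open>In \<open>B j \<otimes> B i\<close> the matching condition turns
        \<open>w j \<otimes> 1\<close> into \<open>1 \<otimes> 0\<close>. With \<open>V = 0\<close>
        this gives a \<open>c\<close> that kills \<open>w j\<close> and is not mapped into
        \<open>Q\<close>, but it still depends on \<open>j\<close>.\<close>
      have killed: "\<exists>c\<in>?S. h j c \<otimes>\<^bsub>B j\<^esub> w j = \<zero>\<^bsub>B j\<^esub>" if j: "j \<in> I" for j
      proof (rule ccontr)
        assume neg: "\<not> (\<exists>c\<in>?S. h j c \<otimes>\<^bsub>B j\<^esub> w j = \<zero>\<^bsub>B j\<^esub>)"
        interpret hj: ring_hom_cring A "B j" "h j" by (rule hom_cring[OF j])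
        interpret T: tensor_algebras A "B j" "h j" "B i" "h i" by (rule tensor_algebras[OF j i])
        let ?l = "\<lambda>x. T.te x \<one>\<^bsub>B i\<^esub>" and ?r = "\<lambda>x. T.te \<one>\<^bsub>B j\<^esub> x"
        interpret l: ring_hom_cring "B j" T.TB ?l
          using T.left_hom T.cring_TB cringB[OF j] by (simp add: ring_hom_cring_def ring_hom_cring_axioms_def)
        interpret r: ring_hom_cring "B i" T.TB ?r
          using T.right_hom T.cring_TB cringB[OF i] by (simp add: ring_hom_cring_def ring_hom_cring_axioms_def)
        have wi: "h i c0 \<otimes>\<^bsub>B i\<^esub> y i \<ominus>\<^bsub>B i\<^esub> h i a0 = \<zero>\<^bsub>B i\<^esub>" unfolding c0(4) using c0 by simp
        have "?l (w j) = ?l (h j c0) \<otimes>\<^bsub>T.TB\<^esub> ?l (y j) \<ominus>\<^bsub>T.TB\<^esub> ?l (h j a0)"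
          unfolding w_def a_minus_def using c0(1,2) y[OF j] by simp
        also have "\<dots> = ?r (h i c0) \<otimes>\<^bsub>T.TB\<^esub> ?r (y i) \<ominus>\<^bsub>T.TB\<^esub> ?r (h i a0)"
          using T.te_scalar c0 comp[OF j i] by simp
        also have "\<dots> = ?r (h i c0 \<otimes>\<^bsub>B i\<^esub> y i \<ominus>\<^bsub>B i\<^esub> h i a0)"
          unfolding a_minus_def using c0(1,2) y[OF i] by simp
        finally have eq: "?l (w j) = ?r \<zero>\<^bsub>B i\<^esub>" unfolding wi .
        have "\<one>\<^bsub>B i\<^esub> \<in> Q"
        proof (rule T.te_eq_imp[OF noeth flat[OF i] w[OF j] _ eq, where V = "{\<zero>\<^bsub>B j\<^esub>}"])
          show "ideal Q (B i)" by (rule Q.is_ideal)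
          fix c assume "c \<in> carrier A" "h j c \<otimes>\<^bsub>B j\<^esub> w j \<in> {\<zero>\<^bsub>B j\<^esub>}"
          then show "h i c \<in> Q" using neg by blast
        qed auto
        then show False using one by simp
      qed
      \<comment> \<open>One \<open>u\<close> for all \<open>j\<close>: any element of
        \<open>A\<close> killed by some member of \<open>?S\<close> is killed by
        \<open>u\<close>.\<close>
      have "\<exists>u\<in>?S. \<forall>x\<in>carrier A. (\<exists>c\<in>?S. c \<otimes> x = \<zero>) \<longrightarrow> u \<otimes> x = \<zero>"
      proof (rule A.noetherian_common_annihilator[OF noeth])
        show "\<one> \<in> ?S" using one by simp
        fix a b assume "a \<in> ?S" "b \<in> ?S"
        then show "a \<otimes> b \<in> ?S" using Q.I_prime[of "h i a" "h i b"] by auto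
      qed blast
      then obtain u where u: "u \<in> carrier A" "h i u \<notin> Q"
        "\<And>x c. x \<in> carrier A \<Longrightarrow> c \<in> ?S \<Longrightarrow> c \<otimes> x = \<zero> \<Longrightarrow> u \<otimes> x = \<zero>" by blast
      have "h j (u \<otimes> c0) \<otimes>\<^bsub>B j\<^esub> y j = h j (u \<otimes> a0)" if j: "j \<in> I" for j
      proof -
        interpret hj: ring_hom_cring A "B j" "h j" by (rule hom_cring[OF j])
        obtain c where c: "c \<in> ?S" "h j c \<otimes>\<^bsub>B j\<^esub> w j = \<zero>\<^bsub>B j\<^esub>" using killed[OF j] by blast
        have hu: "h j u \<in> carrier (B j)" using u by simp
        \<comment> \<open>Flatness transports this to \<open>B j\<close>: a solution
          \<open>x\<close> over \<open>A\<close> of the equations of \<open>w j\<close> is killed by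
          \<open>c\<close>, hence by \<open>u\<close>.\<close>
        have "w j \<in> {x \<in> carrier (B j). h j u \<otimes>\<^bsub>B j\<^esub> x = \<zero>\<^bsub>B j\<^esub>}"
        proof (rule hj.flat_element_in_ideal[OF noeth flat[OF j] hj.S.annihilator_ideal[OF hu] w[OF j]])
          fix x assume x: "x \<in> carrier A"
            and rows: "\<And>r. r \<in> carrier A \<Longrightarrow> h j r \<otimes>\<^bsub>B j\<^esub> w j = \<zero>\<^bsub>B j\<^esub> \<Longrightarrow> r \<otimes> x = \<zero>"
          have "c \<otimes> x = \<zero>" using rows[OF _ c(2)] c(1) by simp
          then have "u \<otimes> x = \<zero>" by (rule u(3)[OF x c(1)])
          then have "h j u \<otimes>\<^bsub>B j\<^esub> h j x = h j \<zero>" using u(1) x hj.hom_mult by metis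
          then show "h j x \<in> {x \<in> carrier (B j). h j u \<otimes>\<^bsub>B j\<^esub> x = \<zero>\<^bsub>B j\<^esub>}" using x by simp
        qed
        then have "h j u \<otimes>\<^bsub>B j\<^esub> (h j c0 \<otimes>\<^bsub>B j\<^esub> y j) \<ominus>\<^bsub>B j\<^esub> h j u \<otimes>\<^bsub>B j\<^esub> h j a0 = \<zero>\<^bsub>B j\<^esub>"
          using hu y[OF j] c0 by (simp add: w_def a_minus_def hj.S.r_distr hj.S.r_minus)
        then have "h j u \<otimes>\<^bsub>B j\<^esub> (h j c0 \<otimes>\<^bsub>B j\<^esub> y j) = h j u \<otimes>\<^bsub>B j\<^esub> h j a0"
          using hu y[OF j] c0 by (subst (asm) hj.S.r_right_minus_eq) auto
        then show ?thesis using u(1) c0 y[OF j] by (simp add: hj.S.m_assoc)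
      qed
      then have "u \<otimes> c0 \<in> ?J" using u(1) c0(1,2) A.m_closed by blast
      then have "h i u \<otimes>\<^bsub>B i\<^esub> h i c0 \<in> Q" using JQ[of "u \<otimes> c0"] u(1) c0(1) by simp
      then show False using Q.I_prime[of "h i u" "h i c0"] u c0 by simp
    qed
  qed
  then obtain a where a: "a \<in> carrier A" "\<And>i. i \<in> I \<Longrightarrow> h i \<one> \<otimes>\<^bsub>B i\<^esub> y i = h i a" by blast
  have "h i a = y i" if i: "i \<in> I" for i
  proof -
    interpret h: ring_hom_cring A "B i" "h i" by (rule hom_cring[OF i])
    show ?thesis using a(2)[OF i] y[OF i] by simp
  qed
  then show ?thesis using a(1) by blast
qed

section \<open>Descent of the two finiteness conditions\<close>

lemma W_J_descent:
  assumes f: "f \<in> witt_set A" and loc: "\<And>i. i \<in> I \<Longrightarrow> witt_map (h i) f \<in> carrier (W_J (B i))"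
  shows "f \<in> carrier (W_J A)"
proof -
  have fU: "f \<in> UNIV \<rightarrow> carrier A" by (rule A.witt_setD[OF f])
  have mat: "A.mat_in n (\<lambda>i j. f (r i + s j))" for n and r s :: "nat \<Rightarrow> nat"
    using fU by (auto simp: A.mat_in_def)
  note det_closed = A.det_in_closed[OF mat]
  let ?D = "\<lambda>n r s. det_in A n (\<lambda>i j. f (r i + s j))"
  \<comment> \<open>Elements killing all minors of some size. Two of them can be added because sizes
    can be raised to a common one.\<close>
  let ?J = "{c \<in> carrier A. \<exists>n. \<forall>r s. c \<otimes> ?D n r s = \<zero>}"
  have mono: "c \<otimes> ?D n r s = \<zero>"
    if c: "c \<in> carrier A" "\<And>r s. c \<otimes> ?D m r s = \<zero>" "m \<le> n" for c m n r s
  proof -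
    have "?D n r s \<in> {x \<in> carrier A. c \<otimes> x = \<zero>}"
      by (rule A.minors_in_ideal_mono[OF fU A.annihilator_ideal[OF c(1)] _ c(3)]) (use c(2) det_closed in simp)
    then show ?thesis by simp
  qed
  have "ideal ?J A"
  proof (rule A.idealI_mult)
    show "\<zero> \<in> ?J" using det_closed by simp
  next
    fix c d assume "c \<in> ?J" "d \<in> ?J"
    then obtain m n where mn: "c \<in> carrier A" "d \<in> carrier A" "\<And>r s. c \<otimes> ?D m r s = \<zero>"
      "\<And>r s. d \<otimes> ?D n r s = \<zero>" by blast
    have "(c \<oplus> d) \<otimes> ?D (max m n) r s = \<zero>" for r s
      using mono[OF mn(1,3), of "max m n" r s] mono[OF mn(2,4), of "max m n" r s] mn(1,2) det_closed
      by (simp add: A.l_distr)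
    then show "c \<oplus> d \<in> ?J" using mn(1,2) by blast
  next
    fix c x assume "c \<in> ?J" and x: "x \<in> carrier A"
    then obtain m where m: "c \<in> carrier A" "\<And>r s. c \<otimes> ?D m r s = \<zero>" by blast
    have "(x \<otimes> c) \<otimes> ?D m r s = \<zero>" for r s
      using m x det_closed by (simp add: A.m_assoc)
    then show "x \<otimes> c \<in> ?J" using m(1) x by blast
  qed blast
  then have "\<one> \<in> ?J"
  proof (rule unit_ideal)
    fix i Q assume i: "i \<in> I" and Q: "primeideal Q (B i)" and JQ: "\<And>c. c \<in> ?J \<Longrightarrow> h i c \<in> Q"
    interpret h: ring_hom_cring A "B i" "h i" by (rule hom_cring[OF i])
    obtain n where n: "minors_vanish (B i) (n + 1) (hankel (witt_map (h i) f))"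
      using loc[OF i] by (auto simp: W_J_def)
    have hU: "witt_map (h i) f \<in> UNIV \<rightarrow> carrier (B i)" using fU by (auto simp: witt_map_def Pi_iff)
    have hD: "h i (?D (n + 1) r s) = \<zero>\<^bsub>B i\<^esub>" for r s
      using h.hom_det_in[OF mat[of "n + 1" r s]] h.S.minors_vanish_imp_all[OF hU n, of r s]
      by (simp add: witt_map_def)
    show "\<one>\<^bsub>B i\<^esub> \<in> Q"
    \<comment> \<open>The minors of \<open>f\<close> are coefficients of equations satisfied by 1 in
      \<open>B i\<close>; an element of \<open>A\<close> satisfying these equations kills the
      minors.\<close>
    proof (rule h.flat_element_in_ideal[OF noeth flat[OF i] primeideal.axioms(1)[OF Q]])
      fix u assume u: "u \<in> carrier A"
        and rows: "\<And>r. r \<in> carrier A \<Longrightarrow> h i r \<otimes>\<^bsub>B i\<^esub> \<one>\<^bsub>B i\<^esub> = \<zero>\<^bsub>B i\<^esub> \<Longrightarrow> r \<otimes> u = \<zero>"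
      have "u \<otimes> ?D (n + 1) r s = \<zero>" for r s
        using rows[OF det_closed[of "n + 1" r s]] hD[of r s] u det_closed[of "n + 1" r s]
        by (simp add: A.m_comm)
      then have "u \<in> ?J" using u by blast
      then show "h i u \<in> Q" by (rule JQ)
    qed simp
  qed
  then obtain n where n: "\<And>r s. \<one> \<otimes> ?D n r s = \<zero>" by blast
  have "minors_vanish A n (hankel f)"
    by (rule A.minors_vanishI) (use n det_closed in simp)
  \<comment> \<open>The size \<open>n\<close> may be too small for the positive bound in
    \<open>W_J\<close>, hence \<open>Suc n + 1\<close>.\<close>
  then have "minors_vanish A (Suc n + 1) (hankel f)" by (rule A.minors_vanish_mono[OF fU]) simp
  then show ?thesis using f by (auto simp: W_J_def intro!: exI[of _ "Suc n"])
qed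

lemma W_rat_descent:
  assumes f: "f \<in> witt_set A" and loc: "\<And>i. i \<in> I \<Longrightarrow> witt_map (h i) f \<in> carrier (W_rat (B i))"
  shows "f \<in> carrier (W_rat A)"
proof -
  have fU: "f \<in> UNIV \<rightarrow> carrier A" by (rule A.witt_setD[OF f])
  have fc: "f k \<in> carrier A" for k using fU by auto
  \<comment> \<open>Leading coefficients of recurrences of all orders; orders are equalised before
    adding.\<close>
  let ?J = "{c. \<exists>n q. recurrence A f n q \<and> q 0 = c}"
  have qc: "q i \<in> carrier A" if "recurrence A f n q" "i < Suc n" for n q i
    using that by (simp add: recurrence_def)
  have sum: "recurrence A f n (\<lambda>i. a \<otimes> q i \<oplus> q' i)"
    if q: "recurrence A f n q" "recurrence A f n q'" "a \<in> carrier A" for n q q' a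
    unfolding recurrence_def
  proof (intro conjI allI impI)
    fix k
    have "(\<Oplus>i\<in>{..<Suc n}. (a \<otimes> q i \<oplus> q' i) \<otimes> f (k + n - i)) =
      (\<Oplus>i\<in>{..<Suc n}. a \<otimes> (q i \<otimes> f (k + n - i)) \<oplus> q' i \<otimes> f (k + n - i))"
      using qc[OF q(1)] qc[OF q(2)] q(3) fc by (intro A.finsum_cong2) (auto simp: A.l_distr A.m_assoc)
    also have "\<dots> = (\<Oplus>i\<in>{..<Suc n}. a \<otimes> (q i \<otimes> f (k + n - i))) \<oplus>
      (\<Oplus>i\<in>{..<Suc n}. q' i \<otimes> f (k + n - i))"
      using qc[OF q(1)] qc[OF q(2)] q(3) fc by (intro A.finsum_addf) auto
    also have "(\<Oplus>i\<in>{..<Suc n}. a \<otimes> (q i \<otimes> f (k + n - i))) =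
      a \<otimes> (\<Oplus>i\<in>{..<Suc n}. q i \<otimes> f (k + n - i))"
      using qc[OF q(1)] q(3) fc by (intro A.finsum_rdistr[symmetric]) auto
    finally show "(\<Oplus>i\<in>{..<Suc n}. (a \<otimes> q i \<oplus> q' i) \<otimes> f (k + n - i)) = \<zero>"
      using q by (simp add: recurrence_def)
  qed (use qc[OF q(1)] qc[OF q(2)] q(3) in auto)
  have zero: "recurrence A f 0 (\<lambda>_. \<zero>)" using fc by (simp add: recurrence_def lessThan_Suc)
  have "ideal ?J A"
  proof (rule A.idealI_mult)
    show "?J \<subseteq> carrier A" using qc by blast
    show "\<zero> \<in> ?J" using zero by blast
  next
    fix c d assume "c \<in> ?J" "d \<in> ?J"
    then obtain m q n q' where *: "recurrence A f m q" "q 0 = c" "recurrence A f n q'" "q' 0 = d" by blast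
    obtain p where p: "recurrence A f (max m n) p" "p 0 = c"
      using A.recurrence_extend[OF fU *(1), of "max m n"] *(2) by auto
    obtain p' where p': "recurrence A f (max m n) p'" "p' 0 = d"
      using A.recurrence_extend[OF fU *(3), of "max m n"] *(4) by auto
    have "\<one> \<otimes> p 0 \<oplus> p' 0 = c \<oplus> d" using p p' qc[OF p(1), of 0] by simp
    then show "c \<oplus> d \<in> ?J" using sum[OF p(1) p'(1) A.one_closed] by blast
  next
    fix c x assume "c \<in> ?J" and x: "x \<in> carrier A"
    then obtain n q where q: "recurrence A f n q" "q 0 = c" by blast
    obtain z where z: "recurrence A f n z" "z 0 = \<zero>"
      using A.recurrence_extend[OF fU zero, of n] by auto
    have "x \<otimes> q 0 \<oplus> z 0 = x \<otimes> c" using q z x qc[OF q(1), of 0] by simp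
    then show "x \<otimes> c \<in> ?J" using sum[OF q(1) z(1) x] by blast
  qed
  then have "\<one> \<in> ?J"
  proof (rule unit_ideal)
    fix i Q assume i: "i \<in> I" and Q: "primeideal Q (B i)" and JQ: "\<And>c. c \<in> ?J \<Longrightarrow> h i c \<in> Q"
    interpret h: ring_hom_cring A "B i" "h i" by (rule hom_cring[OF i])
    obtain n q where q: "recurrence (B i) (witt_map (h i) f) n q" "q 0 = \<one>\<^bsub>B i\<^esub>"
      using loc[OF i] h.S.rational_iff_recurrence[OF h.witt_map_closed[OF f]] by blast
    have qB: "q l \<in> carrier (B i)" if "l < Suc n" for l using q(1) that by (simp add: recurrence_def)
    have "q 0 \<in> Q"
    \<comment> \<open>A recurrence over \<open>B i\<close> is a system of infinitely many linear
      equations for the vector \<open>q\<close>, with coefficients from \<open>f\<close>. A solution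
      \<open>u\<close> over \<open>A\<close> of the equations satisfied by \<open>q\<close> is a
      recurrence for \<open>f\<close> itself.\<close>
    proof (rule h.flat_solution_in_ideal[OF noeth flat[OF i] primeideal.axioms(1)[OF Q] qB])
      fix u assume u: "u \<in> vecs A (Suc n)"
        and rows: "\<And>r. r \<in> UNIV \<rightarrow> carrier A \<Longrightarrow>
          (\<Oplus>\<^bsub>B i\<^esub>l\<in>{..<Suc n}. h i (r l) \<otimes>\<^bsub>B i\<^esub> q l) = \<zero>\<^bsub>B i\<^esub> \<Longrightarrow>
          (\<Oplus>l\<in>{..<Suc n}. r l \<otimes> u l) = \<zero>"
      have uc: "u l \<in> carrier A" for l using u by (auto simp: vecs_def)
      have "(\<Oplus>l\<in>{..<Suc n}. u l \<otimes> f (k + n - l)) = \<zero>" for k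
      proof -
        have "(\<Oplus>\<^bsub>B i\<^esub>l\<in>{..<Suc n}. h i (f (k + n - l)) \<otimes>\<^bsub>B i\<^esub> q l) =
            (\<Oplus>\<^bsub>B i\<^esub>l\<in>{..<Suc n}. q l \<otimes>\<^bsub>B i\<^esub> witt_map (h i) f (k + n - l))"
          using qB fc by (intro h.S.finsum_cong2) (auto simp: witt_map_def h.S.m_comm)
        also have "\<dots> = \<zero>\<^bsub>B i\<^esub>" using q(1) by (simp add: recurrence_def)
        finally have "(\<Oplus>l\<in>{..<Suc n}. f (k + n - l) \<otimes> u l) = \<zero>"
          using rows[of "\<lambda>l. f (k + n - l)"] fc by simp
        moreover have "(\<Oplus>l\<in>{..<Suc n}. u l \<otimes> f (k + n - l)) =
            (\<Oplus>l\<in>{..<Suc n}. f (k + n - l) \<otimes> u l)"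
          using uc fc by (intro A.finsum_cong2) (auto simp: A.m_comm)
        ultimately show ?thesis by simp
      qed
      then have "recurrence A f n u" using uc by (simp add: recurrence_def)
      then have "u 0 \<in> ?J" by blast
      then show "h i (u 0) \<in> Q" by (rule JQ)
    qed simp_all
    then show "\<one>\<^bsub>B i\<^esub> \<in> Q" using q(2) by simp
  qed
  then show ?thesis using A.rational_iff_recurrence[OF f] by blast
qed

end

text \<open>Elements are glued one coefficient at a time. The subrings enter only through their
  behaviour under \<open>witt_map\<close> and through descent of membership, hence as
  parameters.\<close>

lemma (in flat_covering) witt_sheaf_conditionI:
  assumes FA: "FA A = witt_ring A\<lparr>carrier := SA\<rparr>"
    and FB: "\<And>i. i \<in> I \<Longrightarrow> FB (B i) = witt_ring (B i)\<lparr>carrier := SB i\<rparr>"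
    and FT: "\<And>i j. i \<in> I \<Longrightarrow> j \<in> I \<Longrightarrow> FT (tensor_ring A (h i) (B i) (h j) (B j)) =
      witt_ring (tensor_ring A (h i) (B i) (h j) (B j))\<lparr>carrier := ST i j\<rparr>"
    and SA: "SA \<subseteq> witt_set A" and SB: "\<And>i. i \<in> I \<Longrightarrow> SB i \<subseteq> witt_set (B i)"
    and map: "\<And>i f. i \<in> I \<Longrightarrow> f \<in> SA \<Longrightarrow> witt_map (h i) f \<in> SB i"
    and left: "\<And>i j f. i \<in> I \<Longrightarrow> j \<in> I \<Longrightarrow> f \<in> SB i \<Longrightarrow>
      witt_map (\<lambda>x. tensor_elem A (h i) (B i) (h j) (B j) x \<one>\<^bsub>B j\<^esub>) f \<in> ST i j"
    and right: "\<And>i j f. i \<in> I \<Longrightarrow> j \<in> I \<Longrightarrow> f \<in> SB j \<Longrightarrow>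
      witt_map (\<lambda>y. tensor_elem A (h i) (B i) (h j) (B j) \<one>\<^bsub>B i\<^esub> y) f \<in> ST i j"
    and descent: "\<And>f. f \<in> witt_set A \<Longrightarrow> (\<And>i. i \<in> I \<Longrightarrow> witt_map (h i) f \<in> SB i) \<Longrightarrow> f \<in> SA"
  shows "witt_sheaf_condition FA FB FT A I B h"
  unfolding witt_sheaf_condition_def exact_fork_def
proof (intro conjI ballI)
  fix i assume i: "i \<in> I"
  interpret h: ring_hom_cring A "B i" "h i" by (rule hom_cring[OF i])
  show "witt_map (h i) \<in> ring_hom (FA A) (FB (B i))"
    unfolding FA FB[OF i] by (rule h.ring_hom_witt_map[OF SA map[OF i]])
next
  fix i j assume i: "i \<in> I" and j: "j \<in> I"
  interpret T: tensor_algebras A "B i" "h i" "B j" "h j" by (rule tensor_algebras[OF i j])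
  have l: "ring_hom_cring (B i) T.TB (\<lambda>x. T.te x \<one>\<^bsub>B j\<^esub>)" and r: "ring_hom_cring (B j) T.TB (\<lambda>y. T.te \<one>\<^bsub>B i\<^esub> y)"
    using T.left_hom T.right_hom T.cring_TB cringB[OF i] cringB[OF j]
    by (simp_all add: ring_hom_cring_def ring_hom_cring_axioms_def)
  show "witt_map (\<lambda>x. T.te x \<one>\<^bsub>B j\<^esub>) \<in> ring_hom (FB (B i)) (FT T.TB)"
    unfolding FB[OF i] FT[OF i j] by (rule ring_hom_cring.ring_hom_witt_map[OF l SB[OF i] left[OF i j]])
  show "witt_map (\<lambda>y. T.te \<one>\<^bsub>B i\<^esub> y) \<in> ring_hom (FB (B j)) (FT T.TB)"
    unfolding FB[OF j] FT[OF i j] by (rule ring_hom_cring.ring_hom_witt_map[OF r SB[OF j] right[OF i j]])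
next
  let ?e = "\<lambda>x. \<lambda>i\<in>I. witt_map (h i) x"
  let ?E = "{y \<in> \<Pi>\<^sub>E i\<in>I. carrier (FB (B i)). \<forall>i\<in>I. \<forall>j\<in>I.
      witt_map (\<lambda>x. tensor_elem A (h i) (B i) (h j) (B j) x \<one>\<^bsub>B j\<^esub>) (y i) =
      witt_map (tensor_elem A (h i) (B i) (h j) (B j) \<one>\<^bsub>B i\<^esub>) (y j)}"
  have cA: "carrier (FA A) = SA" by (simp add: FA)
  have cB: "carrier (FB (B i)) = SB i" if "i \<in> I" for i by (simp add: FB that)
  have SAc: "f n \<in> carrier A" if "f \<in> SA" for f n using that SA by (auto simp: witt_set_def)
  have SBc: "f n \<in> carrier (B i)" if "i \<in> I" "f \<in> SB i" for f n i
    using that(2) SB[OF that(1)] by (auto simp: witt_set_def)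
  have "inj_on ?e SA"
  proof (rule inj_onI)
    fix f g assume f: "f \<in> SA" and g: "g \<in> SA" and eq: "?e f = ?e g"
    show "f = g"
    proof
      fix n
      have "h i (f n) = h i (g n)" if i: "i \<in> I" for i
        using fun_cong[OF fun_cong[OF eq, of i], of n] i by (simp add: witt_map_def)
      then show "f n = g n" by (rule jointly_injective_eq[OF SAc[OF f] SAc[OF g]])
    qed
  qed
  moreover have "?e ` SA \<subseteq> ?E"
  proof
    fix y assume "y \<in> ?e ` SA"
    then obtain f where f: "f \<in> SA" "y = ?e f" by (rule imageE)
    have "y \<in> (\<Pi>\<^sub>E i\<in>I. carrier (FB (B i)))"
      using map f(1) cB by (auto simp: f(2))
    moreover have "witt_map (\<lambda>x. tensor_elem A (h i) (B i) (h j) (B j) x \<one>\<^bsub>B j\<^esub>) (y i) =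
      witt_map (tensor_elem A (h i) (B i) (h j) (B j) \<one>\<^bsub>B i\<^esub>) (y j)" if i: "i \<in> I" and j: "j \<in> I" for i j
    proof -
      interpret T: tensor_algebras A "B i" "h i" "B j" "h j" by (rule tensor_algebras[OF i j])
      show ?thesis using T.te_scalar SAc[OF f(1)] i j by (simp add: f(2) witt_map_def fun_eq_iff)
    qed
    ultimately show "y \<in> ?E" by blast
  qed
  moreover have "?E \<subseteq> ?e ` SA"
  proof
    fix y assume y: "y \<in> ?E"
    then have yP: "y \<in> (\<Pi>\<^sub>E i\<in>I. carrier (FB (B i)))" by simp
    have yB: "y i \<in> SB i" if i: "i \<in> I" for i using PiE_mem[OF yP i] cB[OF i] by simp
    have comp: "tensor_elem A (h i) (B i) (h j) (B j) (y i n) \<one>\<^bsub>B j\<^esub> =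
        tensor_elem A (h i) (B i) (h j) (B j) \<one>\<^bsub>B i\<^esub> (y j n)" if "i \<in> I" "j \<in> I" for i j n
    proof -
      have "witt_map (\<lambda>x. tensor_elem A (h i) (B i) (h j) (B j) x \<one>\<^bsub>B j\<^esub>) (y i) =
        witt_map (tensor_elem A (h i) (B i) (h j) (B j) \<one>\<^bsub>B i\<^esub>) (y j)" using y that by simp
      from fun_cong[OF this, of n] show ?thesis by (simp add: witt_map_def)
    qed
    have "\<exists>a\<in>carrier A. \<forall>i\<in>I. h i a = y i n" for n
    proof (rule glue)
      show "y i n \<in> carrier (B i)" if "i \<in> I" for i by (rule SBc[OF that yB[OF that]])
    qed (rule comp)
    then have "\<forall>n. \<exists>a. a \<in> carrier A \<and> (\<forall>i\<in>I. h i a = y i n)" by (simp add: Bex_def)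
    then have "\<exists>f. \<forall>n. f n \<in> carrier A \<and> (\<forall>i\<in>I. h i (f n) = y i n)" by (rule choice)
    then obtain f where "\<forall>n. f n \<in> carrier A \<and> (\<forall>i\<in>I. h i (f n) = y i n)" by (elim exE)
    then have f: "\<And>n. f n \<in> carrier A" "\<And>n i. i \<in> I \<Longrightarrow> h i (f n) = y i n" by simp_all
    have yf: "witt_map (h i) f = y i" if "i \<in> I" for i using f(2)[OF that] by (simp add: witt_map_def fun_eq_iff)
    \<comment> \<open>That the constant term is 1 is known only in the members, so joint injectivity
      is needed once more.\<close>
    have "f 0 = \<one>"
    proof (rule jointly_injective_eq[OF f(1) A.one_closed])
      fix i assume i: "i \<in> I"
      interpret h: ring_hom_cring A "B i" "h i" by (rule hom_cring[OF i])
      have "y i 0 = \<one>\<^bsub>B i\<^esub>" using yB[OF i] SB[OF i] by (auto simp: witt_set_def)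
      then show "h i (f 0) = h i \<one>" using f(2)[OF i] by simp
    qed
    then have "f \<in> witt_set A" using f(1) by (simp add: witt_set_def)
    then have fS: "f \<in> SA" by (rule descent) (simp add: yf yB)
    have "y = ?e f"
    proof
      fix i show "y i = ?e f i"
        using yf[of i] PiE_arb[OF yP, of i] by (cases "i \<in> I") auto
    qed
    then show "y \<in> ?e ` SA" using fS by (rule image_eqI)
  qed
  ultimately show "bij_betw ?e (carrier (FA A)) ?E" unfolding cA bij_betw_def by blast
qed

lemma (in flat_covering) W_rat_sheaf: "witt_sheaf_condition W_rat W_rat W_rat A I B h"
proof (rule witt_sheaf_conditionI)
  show "W_rat A = witt_ring A\<lparr>carrier := carrier (W_rat A)\<rparr>" by (simp add: W_rat_def)
  show "W_rat (B i) = witt_ring (B i)\<lparr>carrier := carrier (W_rat (B i))\<rparr>" for i by (simp add: W_rat_def)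
  show "W_rat (tensor_ring A (h i) (B i) (h j) (B j)) = witt_ring (tensor_ring A (h i) (B i) (h j) (B j))
    \<lparr>carrier := carrier (W_rat (tensor_ring A (h i) (B i) (h j) (B j)))\<rparr>" for i j by (simp add: W_rat_def)
  show "carrier (W_rat A) \<subseteq> witt_set A" by (rule A.W_rat_witt_set)
  show "carrier (W_rat (B i)) \<subseteq> witt_set (B i)" if "i \<in> I" for i
    by (rule cring.W_rat_witt_set[OF cringB[OF that]])
  show "witt_map (h i) f \<in> carrier (W_rat (B i))" if "i \<in> I" "f \<in> carrier (W_rat A)" for i f
    by (rule ring_hom_cring.witt_map_W_rat[OF hom_cring[OF that(1)] that(2)])
  fix i j f assume i: "i \<in> I" and j: "j \<in> I"
  interpret T: tensor_algebras A "B i" "h i" "B j" "h j" by (rule tensor_algebras[OF i j])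
  have l: "ring_hom_cring (B i) T.TB (\<lambda>x. T.te x \<one>\<^bsub>B j\<^esub>)" and r: "ring_hom_cring (B j) T.TB (\<lambda>y. T.te \<one>\<^bsub>B i\<^esub> y)"
    using T.left_hom T.right_hom T.cring_TB cringB[OF i] cringB[OF j]
    by (simp_all add: ring_hom_cring_def ring_hom_cring_axioms_def)
  show "witt_map (\<lambda>x. T.te x \<one>\<^bsub>B j\<^esub>) f \<in> carrier (W_rat T.TB)" if "f \<in> carrier (W_rat (B i))"
    by (rule ring_hom_cring.witt_map_W_rat[OF l that])
  show "witt_map (\<lambda>y. T.te \<one>\<^bsub>B i\<^esub> y) f \<in> carrier (W_rat T.TB)" if "f \<in> carrier (W_rat (B j))"
    by (rule ring_hom_cring.witt_map_W_rat[OF r that])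
qed (rule W_rat_descent)

lemma (in flat_covering) W_J_sheaf: "witt_sheaf_condition W_J W_J W_J A I B h"
proof (rule witt_sheaf_conditionI)
  show "W_J A = witt_ring A\<lparr>carrier := carrier (W_J A)\<rparr>" by (simp add: W_J_def)
  show "W_J (B i) = witt_ring (B i)\<lparr>carrier := carrier (W_J (B i))\<rparr>" for i by (simp add: W_J_def)
  show "W_J (tensor_ring A (h i) (B i) (h j) (B j)) = witt_ring (tensor_ring A (h i) (B i) (h j) (B j))
    \<lparr>carrier := carrier (W_J (tensor_ring A (h i) (B i) (h j) (B j)))\<rparr>" for i j by (simp add: W_J_def)
  show "carrier (W_J A) \<subseteq> witt_set A" by (rule A.W_J_witt_set)
  show "carrier (W_J (B i)) \<subseteq> witt_set (B i)" if "i \<in> I" for i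
    by (rule cring.W_J_witt_set[OF cringB[OF that]])
  show "witt_map (h i) f \<in> carrier (W_J (B i))" if "i \<in> I" "f \<in> carrier (W_J A)" for i f
    by (rule ring_hom_cring.witt_map_W_J[OF hom_cring[OF that(1)] that(2)])
  fix i j f assume i: "i \<in> I" and j: "j \<in> I"
  interpret T: tensor_algebras A "B i" "h i" "B j" "h j" by (rule tensor_algebras[OF i j])
  have l: "ring_hom_cring (B i) T.TB (\<lambda>x. T.te x \<one>\<^bsub>B j\<^esub>)" and r: "ring_hom_cring (B j) T.TB (\<lambda>y. T.te \<one>\<^bsub>B i\<^esub> y)"
    using T.left_hom T.right_hom T.cring_TB cringB[OF i] cringB[OF j]
    by (simp_all add: ring_hom_cring_def ring_hom_cring_axioms_def)
  show "witt_map (\<lambda>x. T.te x \<one>\<^bsub>B j\<^esub>) f \<in> carrier (W_J T.TB)" if "f \<in> carrier (W_J (B i))"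
    by (rule ring_hom_cring.witt_map_W_J[OF l that])
  show "witt_map (\<lambda>y. T.te \<one>\<^bsub>B i\<^esub> y) f \<in> carrier (W_J T.TB)" if "f \<in> carrier (W_J (B j))"
    by (rule ring_hom_cring.witt_map_W_J[OF r that])
qed (rule W_J_descent)

lemma fpqc_covering_flat:
  assumes "cring A" "noetherian_ring A" "\<And>i. i \<in> I \<Longrightarrow> cring (B i)" "fpqc_covering A I B h"
  shows "flat_covering A I B h"
  using assms by (simp add: flat_covering_def flat_covering_axioms_def fpqc_covering_def)

section \<open>The dual numbers\<close>

lemma dual_numbers_simps [simp]:
  "carrier (dual_numbers R) = carrier R \<times> carrier R"
  "(a, b) \<otimes>\<^bsub>dual_numbers R\<^esub> (c, d) = (a \<otimes>\<^bsub>R\<^esub> c, (a \<otimes>\<^bsub>R\<^esub> d) \<oplus>\<^bsub>R\<^esub> (b \<otimes>\<^bsub>R\<^esub> c))"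
  "\<one>\<^bsub>dual_numbers R\<^esub> = (\<one>\<^bsub>R\<^esub>, \<zero>\<^bsub>R\<^esub>)"
  "\<zero>\<^bsub>dual_numbers R\<^esub> = (\<zero>\<^bsub>R\<^esub>, \<zero>\<^bsub>R\<^esub>)"
  "(a, b) \<oplus>\<^bsub>dual_numbers R\<^esub> (c, d) = (a \<oplus>\<^bsub>R\<^esub> c, b \<oplus>\<^bsub>R\<^esub> d)"
  by (simp_all add: dual_numbers_def)

lemma (in cring) cring_dual_numbers: "cring (dual_numbers R)"
proof (rule cringI)
  show "abelian_group (dual_numbers R)"
  proof (rule abelian_groupI)
    fix x assume "x \<in> carrier (dual_numbers R)"
    then obtain a b where "x = (a, b)" "a \<in> carrier R" "b \<in> carrier R" by auto
    then show "\<exists>y\<in>carrier (dual_numbers R). y \<oplus>\<^bsub>dual_numbers R\<^esub> x = \<zero>\<^bsub>dual_numbers R\<^esub>"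
      by (intro bexI[of _ "(\<ominus> a, \<ominus> b)"]) (auto simp: l_neg)
  qed (auto simp: a_ac)
  show "comm_monoid (dual_numbers R)"
    by (rule comm_monoidI) (auto simp: l_distr r_distr a_ac m_ac)
qed (auto simp: l_distr r_distr a_ac)

lemma (in ring) finite_imp_noetherian:
  assumes "finite (carrier R)" shows "noetherian_ring R"
proof (rule noetherian_ringI)
  fix J assume J: "ideal J R"
  have sub: "J \<subseteq> carrier R" by (rule additive_subgroup.a_subset[OF ideal.axioms(1)[OF J]])
  have "J = Idl J"
    by (rule equalityI) (rule genideal_self[OF sub], rule genideal_minimal[OF J subset_refl])
  then show "\<exists>G\<subseteq>carrier R. finite G \<and> J = Idl G"
    using sub finite_subset[OF sub assms] by (intro exI[of _ J] conjI)
qed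

text \<open>
  Over \<open>R[\<epsilon>]\<close> the Hankel matrix of \<open>1 + \<epsilon> g\<close> with \<open>g(0) = 0\<close> has all entries but the first in
  \<open>(\<epsilon>)\<close>, so its \<open>3 \<times> 3\<close>-minors vanish.  If \<open>1 + \<epsilon> g\<close> is rational then so is \<open>g\<close>, which fails for
  the lacunary series \<open>g = \<Sum>\<^sub>s T^(2^s)\<close>.
\<close>

definition lacunary :: "('a, 'm) ring_scheme \<Rightarrow> nat \<Rightarrow> 'a \<times> 'a" where
  "lacunary R n = (if n = 0 then \<one>\<^bsub>R\<^esub> else \<zero>\<^bsub>R\<^esub>, if \<exists>s. n = 2 ^ s then \<one>\<^bsub>R\<^esub> else \<zero>\<^bsub>R\<^esub>)"

context cring
begin

lemma lacunary_witt_set: "lacunary R \<in> witt_set (dual_numbers R)"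
  by (auto simp: lacunary_def witt_set_def)

lemma lacunary_W_J: "lacunary R \<in> carrier (W_J (dual_numbers R))"
proof -
  let ?D = "dual_numbers R"
  interpret D: cring ?D by (rule cring_dual_numbers)
  have lc: "lacunary R n \<in> carrier ?D" for n by (simp add: lacunary_def)
  have "minors_vanish (dual_numbers R) (2 + 1) (hankel (lacunary R))"
    unfolding minors_vanish_def
  proof (intro allI impI)
    fix r c :: "nat \<Rightarrow> nat"
    assume rc: "strict_mono_on {..<2 + 1} r \<and> strict_mono_on {..<2 + 1} c"
    \<comment> \<open>Only the first chosen row can have index 0. In the other two all entries are
      multiples of \<epsilon>, and two such factors have product 0.\<close>
    then have "r 0 < r 1" "r 1 < r 2" by (auto intro: strict_mono_onD)
    then have r: "r 1 > 0" "r 2 > 0" by auto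
    have mat: "D.mat_in (2 + 1) (\<lambda>i j. hankel (lacunary R) (r i) (c j))"
      using lc by (simp add: D.mat_in_def hankel_def)
    have prod: "(\<Otimes>\<^bsub>?D\<^esub>i\<in>{..<2 + 1}. hankel (lacunary R) (r i) (c (\<rho> i))) = \<zero>\<^bsub>?D\<^esub>" for \<rho>
    proof -
      let ?g = "\<lambda>i. hankel (lacunary R) (r i) (c (\<rho> i))"
      have gc: "?g i \<in> carrier ?D" for i using lc by (simp add: hankel_def)
      have "{..<2 + 1} = insert 2 (insert 1 {0 :: nat})" by auto
      then have "(\<Otimes>\<^bsub>?D\<^esub>i\<in>{..<2 + 1}. ?g i) =
          ?g 2 \<otimes>\<^bsub>?D\<^esub> (?g 1 \<otimes>\<^bsub>?D\<^esub> ?g 0)"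
        using gc by (simp add: Pi_iff del: dual_numbers_simps)
      also have "\<dots> = (?g 2 \<otimes>\<^bsub>?D\<^esub> ?g 1) \<otimes>\<^bsub>?D\<^esub> ?g 0"
        by (rule D.m_assoc[symmetric]) (rule gc)+
      also have "?g 2 \<otimes>\<^bsub>?D\<^esub> ?g 1 = \<zero>\<^bsub>?D\<^esub>"
        using r by (simp add: hankel_def lacunary_def)
      finally show ?thesis using D.l_null[OF gc] by simp
    qed
    show "det_in (dual_numbers R) (2 + 1) (\<lambda>i j. hankel (lacunary R) (r i) (c j)) = \<zero>\<^bsub>?D\<^esub>"
      unfolding D.det_in_eq[OF mat] prod using D.sgn_in_closed
      by (intro D.add.finprod_one_eqI) (rule D.r_null)
  qed
  then show ?thesis using lacunary_witt_set by (auto simp: W_J_def intro!: exI[of _ 2])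
qed

lemma lacunary_not_W_rat:
  assumes "\<one> \<noteq> \<zero>"
  shows "lacunary R \<notin> carrier (W_rat (dual_numbers R))"
proof
  let ?D = "dual_numbers R"
  interpret D: cring ?D by (rule cring_dual_numbers)
  have lc: "lacunary R n \<in> carrier ?D" for n by (simp add: lacunary_def)
  assume "lacunary R \<in> carrier (W_rat (dual_numbers R))"
  then obtain n q where q: "recurrence (dual_numbers R) (lacunary R) n q" "q 0 = \<one>\<^bsub>?D\<^esub>"
    using D.rational_iff_recurrence[OF lacunary_witt_set] by blast
  have qc: "q i \<in> carrier ?D" if "i < Suc n" for i using q(1) that by (simp add: recurrence_def)
  \<comment> \<open>The preceding power of two is \<open>2 ^ n\<close> away, which exceeds
    \<open>n\<close>. So a recurrence of order \<open>n\<close>, read where its leading term is at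
    \<open>?N\<close>, meets only this one nonzero coefficient.\<close>
  let ?N = "2 ^ Suc n :: nat"
  have n: "n < 2 ^ n" by (rule less_exp)
  have gap: "lacunary R (?N - i) = \<zero>\<^bsub>?D\<^esub>" if i: "0 < i" "i \<le> n" for i
  proof -
    have "i < 2 ^ n" using i n by linarith
    then have lt: "2 ^ n < ?N - i" "?N - i < ?N" using i by simp_all
    have "?N - i \<noteq> 2 ^ s" for s
    proof
      assume s: "?N - i = 2 ^ s"
      then have "n < s" "s < Suc n" using lt power_strict_increasing_iff[of "2::nat"] by (metis one_less_numeral_iff semiring_norm(76))+
      then show False by simp
    qed
    then show ?thesis using lt by (auto simp: lacunary_def)
  qed
  have "n \<le> ?N" using n unfolding power_Suc by linarith
  then have "?N - n + n = ?N" by simp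
  then have "(\<Oplus>\<^bsub>?D\<^esub>i\<in>{..<Suc n}. q i \<otimes>\<^bsub>?D\<^esub> lacunary R (?N - i)) = \<zero>\<^bsub>?D\<^esub>"
    using q(1) unfolding recurrence_def by metis
  moreover have "(\<Oplus>\<^bsub>?D\<^esub>i\<in>{..<Suc n}. q i \<otimes>\<^bsub>?D\<^esub> lacunary R (?N - i)) =
      (\<Oplus>\<^bsub>?D\<^esub>i\<in>{0}. q i \<otimes>\<^bsub>?D\<^esub> lacunary R (?N - i))"
  proof (rule D.add.finprod_mono_neutral_cong_right)
    fix i assume "i \<in> {..<Suc n} - {0}"
    then show "q i \<otimes>\<^bsub>?D\<^esub> lacunary R (?N - i) = \<zero>\<^bsub>?D\<^esub>"
      using gap[of i] D.r_null[OF qc[of i]] by simp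
  next
    show "(\<lambda>i. q i \<otimes>\<^bsub>?D\<^esub> lacunary R (?N - i)) \<in> {..<Suc n} \<rightarrow> carrier ?D"
      using D.m_closed[OF qc lc] by auto
  qed auto
  moreover have "(\<Oplus>\<^bsub>?D\<^esub>i\<in>{0}. q i \<otimes>\<^bsub>?D\<^esub> lacunary R (?N - i)) = lacunary R ?N"
  proof -
    have "(\<Oplus>\<^bsub>?D\<^esub>i\<in>{0}. q i \<otimes>\<^bsub>?D\<^esub> lacunary R (?N - i)) =
      q 0 \<otimes>\<^bsub>?D\<^esub> lacunary R (?N - 0) \<oplus>\<^bsub>?D\<^esub> \<zero>\<^bsub>?D\<^esub>"
      using D.m_closed[OF qc lc, of 0 ?N] D.finsum_insert[of "{}" "0::nat" "\<lambda>i. q i \<otimes>\<^bsub>?D\<^esub> lacunary R (?N - i)"]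
      by (simp del: dual_numbers_simps power_Suc)
    then show ?thesis using D.l_one[OF lc, of ?N] D.r_zero[OF lc, of ?N] q(2) by (simp del: dual_numbers_simps power_Suc)
  qed
  ultimately have "lacunary R ?N = \<zero>\<^bsub>?D\<^esub>" by simp
  moreover have "lacunary R ?N = (\<zero>, \<one>)" unfolding lacunary_def by (simp del: power_Suc)
  ultimately show False using assms by simp
qed

end

theorem theorem3p4:
  shows
    "(\<forall>(A :: 'a ring) (I :: 'i set) (B :: 'i \<Rightarrow> 'b ring) h.
        cring A \<and> noetherian_ring A \<and> (\<forall>i\<in>I. cring (B i) \<and> noetherian_ring (B i)) \<and>
        fpqc_covering A I B h \<longrightarrow>
          witt_sheaf_condition W_rat W_rat W_rat A I B h \<and>
          witt_sheaf_condition W_J W_J W_J A I B h) \<and>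
     (\<forall>A :: 'a ring. cring A \<and> noetherian_ring A \<longrightarrow> carrier (W_rat A) \<subseteq> carrier (W_J A)) \<and>
     (\<forall>A :: 'a ring. domain A \<and> noetherian_ring A \<longrightarrow> W_rat A = W_J A) \<and>
     cring (dual_numbers (residue_ring 2)) \<and> noetherian_ring (dual_numbers (residue_ring 2)) \<and>
     carrier (W_rat (dual_numbers (residue_ring 2))) \<noteq>
       carrier (W_J (dual_numbers (residue_ring 2)))"
proof (intro conjI allI impI)
  fix A :: "'a ring" and I :: "'i set" and B :: "'i \<Rightarrow> 'b ring" and h
  assume *: "cring A \<and> noetherian_ring A \<and> (\<forall>i\<in>I. cring (B i) \<and> noetherian_ring (B i)) \<and>
    fpqc_covering A I B h"
  then have "flat_covering A I B h" by (intro fpqc_covering_flat) auto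
  then show "witt_sheaf_condition W_rat W_rat W_rat A I B h" "witt_sheaf_condition W_J W_J W_J A I B h"
    by (rule flat_covering.W_rat_sheaf, rule flat_covering.W_J_sheaf)
next
  fix A :: "'a ring" assume "cring A \<and> noetherian_ring A"
  then show "carrier (W_rat A) \<subseteq> carrier (W_J A)" by (intro cring.W_rat_subset_W_J) auto
next
  fix A :: "'a ring" assume *: "domain A \<and> noetherian_ring A"
  then have "carrier (W_rat A) = carrier (W_J A)"
    using cring.W_rat_subset_W_J[of A] domain.W_J_subset_W_rat[of A] by (auto simp: domain_def)
  then show "W_rat A = W_J A" by (simp add: W_rat_def W_J_def)
next
  interpret F: residues 2 "residue_ring 2" by unfold_locales simp_all
  have one: "\<one>\<^bsub>residue_ring 2\<^esub> \<noteq> \<zero>\<^bsub>residue_ring 2\<^esub>" by (simp add: residue_ring_def)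
  show D: "cring (dual_numbers (residue_ring 2))" by (rule F.cring_dual_numbers)
  have "finite (carrier (dual_numbers (residue_ring 2)))" by (simp add: residue_ring_def)
  then show "noetherian_ring (dual_numbers (residue_ring 2))"
    by (rule ring.finite_imp_noetherian[OF cring.axioms(1)[OF D]])
  show "carrier (W_rat (dual_numbers (residue_ring 2))) \<noteq> carrier (W_J (dual_numbers (residue_ring 2)))"
    using F.lacunary_W_J F.lacunary_not_W_rat[OF one] by blast
qed

end
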